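(* Let $\mathrm X$ be a locally compact Hausdorff space, $\kappa$ a consistent (in particular positive definite) kernel on $\mathrm X$, $\mathbf A=(A_i)_{i\in I}$ an $(I^+,I^-)$-condenser in $\mathrm X$, and $\mathbf g=(g_i)_{i\in I}$ a family of continuous functions $g_i:\mathrm X\to(0,\infty)$. For every $i\in I$, assume that either $g_{i,\sup}<\infty$, or there exist $r_i\in(1,\infty)$ and $\omega_i\in\mathcal E$ such that $$g_i^{r_i}(x)\leqslant\kappa(x,\omega_i)\quad\text{nearly everywhere in } A_i.$$ Assume moreover that, for every $i\in I$, the set $A_i$ either is compact or has finite interior capacity $C(A_i)<\infty$. Then for any vector $\mathbf a=(a_i)_{i\in I}$ with all $a_i>0$ such that $\mathrm{cap}(\mathbf A,\mathbf a,\mathbf g)>0$ and such that either $I^-=\varnothing$, or both $$\sum_{i\in I}a_i\,g_{i,\inf}^{-1}<\infty\quad\text{and}\quad \sup_{x\in A^+,\,y\in A^-}\kappa(x,y)<\infty,$$ the class $\mathfrak S(\mathbf A,\mathbf a,\mathbf g)$ of all minimizers is nonempty and $\mathbf A$-vaguely compact.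
   Context: $\mathfrak M$ is the linear space of all real-valued (signed) Radon measures on the locally compact Hausdorff space $\mathrm X$, with the vague topology (pointwise convergence on the space $\mathrm C_0(\mathrm X)$ of continuous real functions with compact support). For closed $E\subset\mathrm X$, $\mathfrak M^+(E)$ is the set of nonnegative $\nu\in\mathfrak M$ supported by $E$; $\mathfrak M^+:=\mathfrak M^+(\mathrm X)$. $\Phi(\mathrm Y)$ is the set of lower semicontinuous $\psi:\mathrm Y\to(-\infty,\infty]$ with $\psi\geqslant0$ unless $\mathrm Y$ is compact. A kernel is an element $\kappa\in\Phi(\mathrm X\times\mathrm X)$; the mutual energy is $\kappa(\nu,\nu_1)=\int\kappa\,d(\nu\otimes\nu_1)$, the energy of $\nu$ is $\kappa(\nu,\nu)$, and the potential is $\kappa(x,\nu)=\int\kappa(x,y)\,d\nu(y)$, whenever well defined (integral against a signed measure: difference of the integrals against the positive and negative parts, not both infinite). $\kappa$ is positive definite if it is symmetric and $\kappa(\nu,\nu)\geqslant0$ whenever defined. $\mathcal E$ is the set of $\nu\in\mathfrak M$ of finite energy, a pre-Hilbert space with seminorm $\|\nu\|=\sqrt{\kappa(\nu,\nu)}$ (strong topology); $\mathcal E^+:=\mathcal E\cap\mathfrak M^+$. A positive definite kernel is consistent if every strong Cauchy net in $\mathcal E^+$ converges strongly to each of its vague cluster points; equivalently, every strongly bounded, vaguely convergent net $(\nu_s)$ in $\mathcal E^+$ with vague limit $\nu$ satisfies $\kappa(\nu_s,\mu)\to\kappa(\nu,\mu)$ for all $\mu\in\mathcal E$. Interior capacity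 of a set $E\subset \mathrm X$: $C(E)=1/\inf\kappa(\nu,\nu)$, the infimum over $\nu\in\mathcal E^+$ with compact support contained in $E$ and $\nu(\mathrm X)=1$ (with $1/0=+\infty$, $1/(+\infty)=0$, $\inf\varnothing=+\infty$). A property holds nearly everywhere in $E$ if the set of $x\in E$ where it fails has interior capacity zero. Condensers: $I^+\neq\varnothing$ and $I^-$ (possibly empty) are disjoint countable (finite or infinite) subsets of $\mathbb N$, $I=I^+\cup I^-$. An $(I^+,I^-)$-condenser is a family $\mathbf A=(A_i)_{i\in I}$ of nonempty closed subsets of $\mathrm X$ such that every compact set meets at most finitely many $A_i$ and $A_i\cap A_j=\varnothing$ for $i\in I^+$, $j\in I^-$. $A^\pm:=\bigcup_{i\in I^\pm}A_i$; $\alpha_i=\pm1$ for $i\in I^\pm$. $\mathfrak M(\mathbf A)$ is the set of formal combinations $\mu=\sum_{i\in I}\alpha_i\mu^i$ with $\mu^i\in\mathfrak M^+(A_i)$, identified with $\prod_{i\in I}\mathfrak M^+(A_i)$; the $\mathbf A$-vague topology is the product of the vague topologies. $R\mu\in\mathfrak M$ is the Radon measure with $R\mu(\varphi)=\sum_i\alpha_i\mu^i(\varphi)$, $\varphi\in\mathrm C_0(\mathrm X)$. The energy of $\mu$ is $\kappa(\mu,\mu):=\kappa(R\mu,R\mu)$; $\mathcal E(\mathbf A)$ is the set of $\mu\in\mathfrak M(\mathbf A)$ of finite energy, and $\|\mu\|:=\|R\mu\|$. Let $g_{i,\inf}$, $g_{i,\sup}$ be the infimum and supremum of $g_i$ over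 $A_i$ (with $1/0=+\infty$). $\mathcal E(\mathbf A,\mathbf a,\mathbf g)$ is the set of $\mu\in\mathcal E(\mathbf A)$ with $\int g_i\,d\mu^i=a_i$ for all $i\in I$; $\|\mathcal E(\mathbf A,\mathbf a,\mathbf g)\|^2:=\inf\{\|\mu\|^2:\mu\in\mathcal E(\mathbf A,\mathbf a,\mathbf g)\}$ ($+\infty$ if the set is empty), and $\mathrm{cap}(\mathbf A,\mathbf a,\mathbf g):=1/\|\mathcal E(\mathbf A,\mathbf a,\mathbf g)\|^2$. $\mathfrak S(\mathbf A,\mathbf a,\mathbf g)$ is the set of $\lambda\in\mathcal E(\mathbf A,\mathbf a,\mathbf g)$ with $\|\lambda\|^2=\|\mathcal E(\mathbf A,\mathbf a,\mathbf g)\|^2$. *)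

theory Defs
  imports "HOL-Analysis.Analysis"
begin

section \<open>Radon measures\<close>

text \<open>
  Signed Radon measures on a locally compact Hausdorff space need be neither finite nor
  sigma-finite, so in general they are not set functions on the Borel sets.  As usual (Bourbaki)
  they are taken to be the continuous linear functionals on the space of continuous functions
  with compact support.
\<close>

definition func_support :: "('b::topological_space \<Rightarrow> real) \<Rightarrow> 'b set" where
  "func_support \<phi> = closure {x. \<phi> x \<noteq> 0}"

definition Cc :: "('b::topological_space \<Rightarrow> real) set" where
  "Cc = {\<phi>. continuous_on UNIV \<phi> \<and> compact (func_support \<phi>)}"

text \<open>
  Functionals are extensional on \<^term>\<open>Cc\<close>, so that equality of measures is HOL equality.
  The bound is continuity for the inductive limit topology on \<^term>\<open>Cc\<close>.
\<close>

definition radon :: "(('b::topological_space \<Rightarrow> real) \<Rightarrow> real) set" where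
  "radon = {\<nu> \<in> extensional Cc.
     (\<forall>\<phi>\<in>Cc. \<forall>\<psi>\<in>Cc. \<nu> (\<lambda>x. \<phi> x + \<psi> x) = \<nu> \<phi> + \<nu> \<psi>) \<and>
     (\<forall>\<phi>\<in>Cc. \<forall>c. \<nu> (\<lambda>x. c * \<phi> x) = c * \<nu> \<phi>) \<and>
     (\<forall>K. compact K \<longrightarrow>
        (\<exists>M. \<forall>\<phi>\<in>Cc. func_support \<phi> \<subseteq> K \<longrightarrow> \<bar>\<nu> \<phi>\<bar> \<le> M * (SUP x. \<bar>\<phi> x\<bar>)))}"

definition radon_diff ::
  "(('b::topological_space \<Rightarrow> real) \<Rightarrow> real) \<Rightarrow> (('b \<Rightarrow> real) \<Rightarrow> real) \<Rightarrow> (('b \<Rightarrow> real) \<Rightarrow> real)" where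
  "radon_diff \<nu> \<nu>' = (\<lambda>\<phi>\<in>Cc. \<nu> \<phi> - \<nu>' \<phi>)"

definition meas_support :: "(('b::topological_space \<Rightarrow> real) \<Rightarrow> real) \<Rightarrow> 'b set" where
  "meas_support \<nu> = - \<Union>{U. open U \<and> (\<forall>\<phi>\<in>Cc. func_support \<phi> \<subseteq> U \<longrightarrow> \<nu> \<phi> = 0)}"

definition radon_pos :: "'b::topological_space set \<Rightarrow> (('b \<Rightarrow> real) \<Rightarrow> real) set" where
  "radon_pos E = {\<nu> \<in> radon. (\<forall>\<phi>\<in>Cc. (\<forall>x. 0 \<le> \<phi> x) \<longrightarrow> 0 \<le> \<nu> \<phi>) \<and> meas_support \<nu> \<subseteq> E}"

definition vague :: "(('b::topological_space \<Rightarrow> real) \<Rightarrow> real) topology" where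
  "vague = subtopology (powertop_real Cc) radon"

text \<open>
  Jordan decomposition: on nonnegative \<open>\<phi>\<close> the positive part is
  \<open>sup {\<nu> \<psi> | 0 \<le> \<psi> \<le> \<phi>}\<close>, extended linearly.
\<close>

definition pos_part ::
  "(('b::topological_space \<Rightarrow> real) \<Rightarrow> real) \<Rightarrow> (('b \<Rightarrow> real) \<Rightarrow> real)" where
  "pos_part \<nu> = (\<lambda>\<phi>\<in>Cc. Sup {\<nu> \<psi> |\<psi>. \<psi> \<in> Cc \<and> (\<forall>x. 0 \<le> \<psi> x \<and> \<psi> x \<le> max (\<phi> x) 0)}
                         - Sup {\<nu> \<psi> |\<psi>. \<psi> \<in> Cc \<and> (\<forall>x. 0 \<le> \<psi> x \<and> \<psi> x \<le> max (- \<phi> x) 0)})"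

definition neg_part ::
  "(('b::topological_space \<Rightarrow> real) \<Rightarrow> real) \<Rightarrow> (('b \<Rightarrow> real) \<Rightarrow> real)" where
  "neg_part \<nu> = pos_part (\<lambda>\<phi>\<in>Cc. - \<nu> \<phi>)"

definition tensor ::
  "(('b::topological_space \<Rightarrow> real) \<Rightarrow> real) \<Rightarrow> (('c::topological_space \<Rightarrow> real) \<Rightarrow> real)
     \<Rightarrow> (('b \<times> 'c \<Rightarrow> real) \<Rightarrow> real)" where
  "tensor \<nu> \<nu>' = (\<lambda>f\<in>Cc. \<nu> (\<lambda>x. \<nu>' (\<lambda>y. f (x, y))))"


section \<open>Integration of lower semicontinuous functions\<close>

definition Phi :: "('b::topological_space \<Rightarrow> ereal) set" where
  "Phi = {\<psi>. (\<forall>c. open {x. c < \<psi> x}) \<and> (\<forall>x. \<psi> x \<noteq> -\<infinity>) \<and>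
             (compact (UNIV :: 'b set) \<or> (\<forall>x. 0 \<le> \<psi> x))}"

text \<open>
  The (upper) integral of \<open>\<psi> \<in> Phi\<close> against a nonnegative Radon measure.  If \<open>\<psi> \<ge> 0\<close> the
  test functions may equivalently be restricted to nonnegative ones; on a compact space,
  where \<open>\<psi>\<close> is merely bounded below, this agrees with integrating \<open>\<psi> + c\<close> and
  subtracting the integral of \<open>c\<close>.
\<close>

definition pos_integral ::
  "(('b::topological_space \<Rightarrow> real) \<Rightarrow> real) \<Rightarrow> ('b \<Rightarrow> ereal) \<Rightarrow> ereal" where
  "pos_integral \<nu> \<psi> = (SUP \<phi> \<in> {\<phi> \<in> Cc. \<forall>x. ereal (\<phi> x) \<le> \<psi> x}. ereal (\<nu> \<phi>))"

definition integral_defined ::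
  "(('b::topological_space \<Rightarrow> real) \<Rightarrow> real) \<Rightarrow> ('b \<Rightarrow> ereal) \<Rightarrow> bool" where
  "integral_defined \<nu> \<psi> \<longleftrightarrow>
     \<not> (pos_integral (pos_part \<nu>) \<psi> = \<infinity> \<and> pos_integral (neg_part \<nu>) \<psi> = \<infinity>)"

definition signed_integral ::
  "(('b::topological_space \<Rightarrow> real) \<Rightarrow> real) \<Rightarrow> ('b \<Rightarrow> ereal) \<Rightarrow> ereal" where
  "signed_integral \<nu> \<psi> = pos_integral (pos_part \<nu>) \<psi> - pos_integral (neg_part \<nu>) \<psi>"


section \<open>Kernels, energy and capacity\<close>

definition energy_defined ::
  "('a::topological_space \<times> 'a \<Rightarrow> ereal) \<Rightarrow> (('a \<Rightarrow> real) \<Rightarrow> real) \<Rightarrow> (('a \<Rightarrow> real) \<Rightarrow> real) \<Rightarrow> bool" where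
  "energy_defined \<kappa> \<nu> \<nu>' \<longleftrightarrow> integral_defined (tensor \<nu> \<nu>') \<kappa>"

definition energy ::
  "('a::topological_space \<times> 'a \<Rightarrow> ereal) \<Rightarrow> (('a \<Rightarrow> real) \<Rightarrow> real) \<Rightarrow> (('a \<Rightarrow> real) \<Rightarrow> real) \<Rightarrow> ereal" where
  "energy \<kappa> \<nu> \<nu>' = signed_integral (tensor \<nu> \<nu>') \<kappa>"

definition potential_defined ::
  "('a::topological_space \<times> 'a \<Rightarrow> ereal) \<Rightarrow> 'a \<Rightarrow> (('a \<Rightarrow> real) \<Rightarrow> real) \<Rightarrow> bool" where
  "potential_defined \<kappa> x \<nu> \<longleftrightarrow> integral_defined \<nu> (\<lambda>y. \<kappa> (x, y))"

definition potential ::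
  "('a::topological_space \<times> 'a \<Rightarrow> ereal) \<Rightarrow> 'a \<Rightarrow> (('a \<Rightarrow> real) \<Rightarrow> real) \<Rightarrow> ereal" where
  "potential \<kappa> x \<nu> = signed_integral \<nu> (\<lambda>y. \<kappa> (x, y))"

definition positive_definite :: "('a::topological_space \<times> 'a \<Rightarrow> ereal) \<Rightarrow> bool" where
  "positive_definite \<kappa> \<longleftrightarrow> (\<forall>x y. \<kappa> (x, y) = \<kappa> (y, x)) \<and>
     (\<forall>\<nu>\<in>radon. energy_defined \<kappa> \<nu> \<nu> \<longrightarrow> 0 \<le> energy \<kappa> \<nu> \<nu>)"

definition finite_energy ::
  "('a::topological_space \<times> 'a \<Rightarrow> ereal) \<Rightarrow> (('a \<Rightarrow> real) \<Rightarrow> real) set" where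
  "finite_energy \<kappa> = {\<nu> \<in> radon. energy_defined \<kappa> \<nu> \<nu> \<and> \<bar>energy \<kappa> \<nu> \<nu>\<bar> \<noteq> \<infinity>}"

definition finite_energy_pos ::
  "('a::topological_space \<times> 'a \<Rightarrow> ereal) \<Rightarrow> (('a \<Rightarrow> real) \<Rightarrow> real) set" where
  "finite_energy_pos \<kappa> = finite_energy \<kappa> \<inter> radon_pos UNIV"

definition strong_norm ::
  "('a::topological_space \<times> 'a \<Rightarrow> ereal) \<Rightarrow> (('a \<Rightarrow> real) \<Rightarrow> real) \<Rightarrow> real" where
  "strong_norm \<kappa> \<nu> = sqrt (real_of_ereal (energy \<kappa> \<nu> \<nu>))"

text \<open>
  Nets are rendered by proper filters (the filter of a net consists of the sets containing one
  of its tails; conversely every proper filter arises from a net).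
\<close>

definition consistent :: "('a::topological_space \<times> 'a \<Rightarrow> ereal) \<Rightarrow> bool" where
  "consistent \<kappa> \<longleftrightarrow> positive_definite \<kappa> \<and>
     (\<forall>F \<nu>. F \<noteq> bot \<longrightarrow>
        (\<forall>\<^sub>F \<sigma> in F. \<sigma> \<in> finite_energy_pos \<kappa>) \<longrightarrow>
        (\<forall>\<epsilon>>0. \<forall>\<^sub>F (\<sigma>, \<tau>) in F \<times>\<^sub>F F. strong_norm \<kappa> (radon_diff \<sigma> \<tau>) < \<epsilon>) \<longrightarrow>
        \<nu> \<in> radon \<longrightarrow> (\<forall>U. openin vague U \<longrightarrow> \<nu> \<in> U \<longrightarrow> (\<exists>\<^sub>F \<sigma> in F. \<sigma> \<in> U)) \<longrightarrow>
        \<nu> \<in> finite_energy \<kappa> \<and> ((\<lambda>\<sigma>. strong_norm \<kappa> (radon_diff \<sigma> \<nu>)) \<longlongrightarrow> 0) F)"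

definition inner_capacity :: "('a::topological_space \<times> 'a \<Rightarrow> ereal) \<Rightarrow> 'a set \<Rightarrow> ereal" where
  "inner_capacity \<kappa> E =
     1 / (INF \<nu> \<in> {\<nu> \<in> finite_energy_pos \<kappa>. compact (meas_support \<nu>) \<and> meas_support \<nu> \<subseteq> E \<and>
                     pos_integral \<nu> (\<lambda>_. 1) = 1}. energy \<kappa> \<nu> \<nu>)"

definition nearly_everywhere ::
  "('a::topological_space \<times> 'a \<Rightarrow> ereal) \<Rightarrow> 'a set \<Rightarrow> ('a \<Rightarrow> bool) \<Rightarrow> bool" where
  "nearly_everywhere \<kappa> E P \<longleftrightarrow> inner_capacity \<kappa> {x \<in> E. \<not> P x} = 0"


section \<open>Condensers\<close>

text \<open>In what follows \<open>P\<close> and \<open>N\<close> are the index sets of the positive and negative plates.\<close>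

definition condenser :: "nat set \<Rightarrow> nat set \<Rightarrow> (nat \<Rightarrow> 'a::topological_space set) \<Rightarrow> bool" where
  "condenser P N A \<longleftrightarrow> P \<noteq> {} \<and> P \<inter> N = {} \<and>
     (\<forall>i\<in>P \<union> N. closed (A i) \<and> A i \<noteq> {}) \<and>
     (\<forall>K. compact K \<longrightarrow> finite {i \<in> P \<union> N. A i \<inter> K \<noteq> {}}) \<and>
     (\<forall>i\<in>P. \<forall>j\<in>N. A i \<inter> A j = {})"

definition sign_coeff :: "nat set \<Rightarrow> nat \<Rightarrow> real" where
  "sign_coeff P i = (if i \<in> P then 1 else - 1)"

text \<open>\<open>M(A)\<close> in its product description; members are extensional families \<open>(\<mu>\<^sup>i)\<close>.\<close>

definition cond_meas ::
  "nat set \<Rightarrow> nat set \<Rightarrow> (nat \<Rightarrow> 'a::topological_space set) \<Rightarrow> (nat \<Rightarrow> ('a \<Rightarrow> real) \<Rightarrow> real) set" where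
  "cond_meas P N A = (\<Pi>\<^sub>E i\<in>P \<union> N. radon_pos (A i))"

definition cond_vague ::
  "nat set \<Rightarrow> nat set \<Rightarrow> (nat \<Rightarrow> 'a::topological_space set) \<Rightarrow> (nat \<Rightarrow> ('a \<Rightarrow> real) \<Rightarrow> real) topology" where
  "cond_vague P N A = product_topology (\<lambda>i. subtopology vague (radon_pos (A i))) (P \<union> N)"

text \<open>For each \<open>\<phi>\<close> only finitely many summands are nonzero, by local finiteness of the plates.\<close>

definition cond_R ::
  "nat set \<Rightarrow> nat set \<Rightarrow> (nat \<Rightarrow> ('a::topological_space \<Rightarrow> real) \<Rightarrow> real) \<Rightarrow> (('a \<Rightarrow> real) \<Rightarrow> real)" where
  "cond_R P N \<mu> = (\<lambda>\<phi>\<in>Cc. \<Sum>\<^sub>\<infinity>i\<in>P \<union> N. sign_coeff P i * \<mu> i \<phi>)"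

definition cond_finite_energy ::
  "('a::topological_space \<times> 'a \<Rightarrow> ereal) \<Rightarrow> nat set \<Rightarrow> nat set \<Rightarrow> (nat \<Rightarrow> 'a set)
     \<Rightarrow> (nat \<Rightarrow> ('a \<Rightarrow> real) \<Rightarrow> real) set" where
  "cond_finite_energy \<kappa> P N A = {\<mu> \<in> cond_meas P N A. cond_R P N \<mu> \<in> finite_energy \<kappa>}"

definition cond_norm ::
  "('a::topological_space \<times> 'a \<Rightarrow> ereal) \<Rightarrow> nat set \<Rightarrow> nat set
     \<Rightarrow> (nat \<Rightarrow> ('a \<Rightarrow> real) \<Rightarrow> real) \<Rightarrow> real" where
  "cond_norm \<kappa> P N \<mu> = strong_norm \<kappa> (cond_R P N \<mu>)"

definition admissible ::
  "('a::topological_space \<times> 'a \<Rightarrow> ereal) \<Rightarrow> nat set \<Rightarrow> nat set \<Rightarrow> (nat \<Rightarrow> 'a set)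
     \<Rightarrow> (nat \<Rightarrow> real) \<Rightarrow> (nat \<Rightarrow> 'a \<Rightarrow> real) \<Rightarrow> (nat \<Rightarrow> ('a \<Rightarrow> real) \<Rightarrow> real) set" where
  "admissible \<kappa> P N A a g = {\<mu> \<in> cond_finite_energy \<kappa> P N A.
     \<forall>i\<in>P \<union> N. pos_integral (\<mu> i) (\<lambda>x. ereal (g i x)) = ereal (a i)}"

definition min_energy ::
  "('a::topological_space \<times> 'a \<Rightarrow> ereal) \<Rightarrow> nat set \<Rightarrow> nat set \<Rightarrow> (nat \<Rightarrow> 'a set)
     \<Rightarrow> (nat \<Rightarrow> real) \<Rightarrow> (nat \<Rightarrow> 'a \<Rightarrow> real) \<Rightarrow> ereal" where
  "min_energy \<kappa> P N A a g = (INF \<mu> \<in> admissible \<kappa> P N A a g. ereal ((cond_norm \<kappa> P N \<mu>)\<^sup>2))"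

definition cond_cap ::
  "('a::topological_space \<times> 'a \<Rightarrow> ereal) \<Rightarrow> nat set \<Rightarrow> nat set \<Rightarrow> (nat \<Rightarrow> 'a set)
     \<Rightarrow> (nat \<Rightarrow> real) \<Rightarrow> (nat \<Rightarrow> 'a \<Rightarrow> real) \<Rightarrow> ereal" where
  "cond_cap \<kappa> P N A a g = 1 / min_energy \<kappa> P N A a g"

definition minimizers ::
  "('a::topological_space \<times> 'a \<Rightarrow> ereal) \<Rightarrow> nat set \<Rightarrow> nat set \<Rightarrow> (nat \<Rightarrow> 'a set)
     \<Rightarrow> (nat \<Rightarrow> real) \<Rightarrow> (nat \<Rightarrow> 'a \<Rightarrow> real) \<Rightarrow> (nat \<Rightarrow> ('a \<Rightarrow> real) \<Rightarrow> real) set" where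
  "minimizers \<kappa> P N A a g = {\<mu> \<in> admissible \<kappa> P N A a g.
     ereal ((cond_norm \<kappa> P N \<mu>)\<^sup>2) = min_energy \<kappa> P N A a g}"

end

theory Submission
  imports Defs
begin

text \<open>
  The minimizers are the intersection, over \<open>\<epsilon> > 0\<close>, of the vague closures of the convex sets
  \<open>W\<^sub>\<epsilon>\<close> of admissible \<open>\<mu>\<close> with \<open>\<parallel>\<mu>\<parallel>\<^sup>2 \<le> m + \<epsilon>\<close>, where \<open>m\<close> is the infimum of the energy; these
  closures are nonempty and, by boundedness of \<open>\<mu>\<^sup>i(\<phi>)\<close>, contained in a compact set.

  Let \<open>\<rho>\<close> lie in all of them. Along the sets \<open>W\<^sub>\<epsilon> \<inter> U\<close>, with \<open>U\<close> a convex vague neighbourhood of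
  \<open>\<rho>\<close>, the almost-minimizers of \<open>\<parallel>R\<mu>\<^sup>+\<parallel>\<^sup>2 + \<parallel>R\<mu>\<^sup>-\<parallel>\<^sup>2\<close> form, by the parallelogram identity, a filter
  on which \<open>R\<mu>\<^sup>+\<close> and \<open>R\<mu>\<^sup>-\<close> are separately strong Cauchy. This functional is bounded on the sets,
  because the masses are summable and \<open>\<kappa>\<close> is bounded on \<open>A\<^sup>+ \<times> A\<^sup>-\<close>. Consistency then gives strong
  convergence of both parts to those of \<open>\<rho>\<close>, so \<open>\<parallel>\<rho>\<parallel>\<^sup>2 \<le> m\<close>.

  The constraints \<open>\<integral>g\<^sub>i d\<mu>\<^sup>i = a\<^sub>i\<close> pass to the limit because no mass escapes: if \<open>C(A\<^sub>i) < \<infinity>\<close>, then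
  \<open>C(A\<^sub>i - K)\<close> tends to \<open>0\<close> along the compact sets \<open>K\<close>, again by consistency, and the mass that a
  measure of bounded energy gives to \<open>A\<^sub>i - K\<close> is controlled by that capacity.
\<close>

section \<open>Continuous functions with compact support\<close>

text \<open>Consistency is the only source of completeness, and it speaks of nonnegative measures
  only; the signed measures of finite energy need not form a complete space. A minimizing net makes
  R\<mu> Cauchy, but this says nothing about its two charges separately, and the energy of a signed
  measure need not be vaguely semicontinuous. Hence the second functional, which sees both charges.
  Plates of equal sign may overlap, so a minimizer need not be unique and its components cannot be
  read off from a strong limit; the vague limit \<open>\<rho>\<close> is fixed beforehand.

  The two alternatives for a plate match two cases for the kernel. From a compact plate nothing can
  escape. A noncompact plate forces the space to be noncompact, so \<kappa> \<ge> 0, and then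
  smaller measures have smaller energy, which is what cutting off requires. The exponent r > 1 is
  there for uniform integrability: integrals of g^r against measures of bounded energy are bounded,
  so the part of the integral of g where g is large is uniformly small, and the remaining part is
  controlled by mass.\<close>

lemma CcI:
  fixes \<phi> :: "'b::t2_space \<Rightarrow> real"
  assumes "continuous_on UNIV \<phi>" "compact K" "\<And>x. x \<notin> K \<Longrightarrow> \<phi> x = 0"
  shows "\<phi> \<in> Cc"
proof -
  have "closure {x. \<phi> x \<noteq> 0} \<subseteq> K"
    by (rule closure_minimal) (use assms compact_imp_closed in auto)
  then have "closure {x. \<phi> x \<noteq> 0} = K \<inter> closure {x. \<phi> x \<noteq> 0}"
    by blast
  then have "compact (closure {x. \<phi> x \<noteq> 0})"
    using compact_Int_closed[OF assms(2) closed_closure, of "{x. \<phi> x \<noteq> 0}"] by simp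
  then show ?thesis
    using assms(1) by (simp add: Cc_def func_support_def)
qed

lemma CcD:
  assumes "\<phi> \<in> Cc"
  shows "continuous_on UNIV \<phi>" "compact (func_support \<phi>)" "\<And>x. x \<notin> func_support \<phi> \<Longrightarrow> \<phi> x = 0"
  using assms closure_subset[of "{x. \<phi> x \<noteq> 0}"] by (auto simp: Cc_def func_support_def)

lemma func_support_subset:
  fixes \<phi> :: "'b::t2_space \<Rightarrow> real"
  assumes "closed K" "\<And>x. x \<notin> K \<Longrightarrow> \<phi> x = 0"
  shows "func_support \<phi> \<subseteq> K"
  unfolding func_support_def by (rule closure_minimal) (use assms in auto)

lemma Cc_zero [simp]: "(\<lambda>x::'b::t2_space. 0) \<in> Cc"
  by (rule CcI[of _ "{}"]) auto

lemma Cc_mult: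
  fixes \<phi> :: "'b::t2_space \<Rightarrow> real"
  assumes "\<phi> \<in> Cc" "continuous_on UNIV h"
  shows "(\<lambda>x. h x * \<phi> x) \<in> Cc" "(\<lambda>x. \<phi> x * h x) \<in> Cc"
  using CcD[OF assms(1)] assms(2)
  by (auto intro!: CcI[of _ "func_support \<phi>"] continuous_intros)

lemma Cc_cmult [simp]:
  fixes \<phi> :: "'b::t2_space \<Rightarrow> real"
  assumes "\<phi> \<in> Cc"
  shows "(\<lambda>x. c * \<phi> x) \<in> Cc"
  using Cc_mult(1)[OF assms continuous_on_const] .

lemma Cc_minus [simp]:
  fixes \<phi> :: "'b::t2_space \<Rightarrow> real"
  assumes "\<phi> \<in> Cc"
  shows "(\<lambda>x. - \<phi> x) \<in> Cc"
  using Cc_cmult[OF assms, of "-1"] by simp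

lemma Cc_binop:
  fixes \<phi> \<psi> :: "'b::t2_space \<Rightarrow> real"
  assumes "\<phi> \<in> Cc" "\<psi> \<in> Cc" "continuous_on UNIV (\<lambda>x. h (\<phi> x) (\<psi> x))" "h 0 0 = 0"
  shows "(\<lambda>x. h (\<phi> x) (\<psi> x)) \<in> Cc"
  using CcD[OF assms(1)] CcD[OF assms(2)] assms(3,4)
  by (intro CcI[of _ "func_support \<phi> \<union> func_support \<psi>"]) auto

lemma Cc_ops [simp]:
  fixes \<phi> \<psi> :: "'b::t2_space \<Rightarrow> real"
  assumes "\<phi> \<in> Cc" "\<psi> \<in> Cc"
  shows "(\<lambda>x. \<phi> x + \<psi> x) \<in> Cc" "(\<lambda>x. \<phi> x - \<psi> x) \<in> Cc" "(\<lambda>x. \<phi> x * \<psi> x) \<in> Cc"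
    "(\<lambda>x. max (\<phi> x) (\<psi> x)) \<in> Cc" "(\<lambda>x. min (\<phi> x) (\<psi> x)) \<in> Cc"
  using Cc_binop[OF assms, of "(+)"] Cc_binop[OF assms, of "(-)"] Cc_binop[OF assms, of "(*)"]
    Cc_binop[OF assms, of max] Cc_binop[OF assms, of min] CcD(1)[OF assms(1)] CcD(1)[OF assms(2)]
  by (auto intro!: continuous_intros)

lemma Cc_pos [simp]:
  fixes \<phi> :: "'b::t2_space \<Rightarrow> real"
  assumes "\<phi> \<in> Cc"
  shows "(\<lambda>x. max (\<phi> x) 0) \<in> Cc" "(\<lambda>x. max (- \<phi> x) 0) \<in> Cc" "(\<lambda>x. \<bar>\<phi> x\<bar>) \<in> Cc"
proof -
  have "(\<lambda>x. \<bar>\<phi> x\<bar>) = (\<lambda>x. max (\<phi> x) (- \<phi> x))" by (auto simp: fun_eq_iff)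
  then show "(\<lambda>x. \<bar>\<phi> x\<bar>) \<in> Cc"
    using Cc_ops(4)[OF assms Cc_minus[OF assms]] by metis
qed (rule Cc_ops(4)[OF assms Cc_zero] Cc_ops(4)[OF Cc_minus[OF assms] Cc_zero])+

lemma Cc_bounded:
  fixes \<phi> :: "'b::t2_space \<Rightarrow> real"
  assumes "\<phi> \<in> Cc"
  obtains B where "0 \<le> B" "\<And>x. \<bar>\<phi> x\<bar> \<le> B"
proof -
  have "compact (\<phi> ` func_support \<phi>)"
    using CcD[OF assms] by (meson compact_continuous_image continuous_on_subset subset_UNIV)
  then have "bounded (\<phi> ` func_support \<phi>)"
    by (rule compact_imp_bounded)
  then obtain B where B: "\<And>x. x \<in> func_support \<phi> \<Longrightarrow> \<bar>\<phi> x\<bar> \<le> B"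
    unfolding bounded_iff by auto
  have "\<bar>\<phi> x\<bar> \<le> max B 0" for x
    using B[of x] CcD(3)[OF assms, of x] by (cases "x \<in> func_support \<phi>") auto
  then show thesis
    by (intro that[of "max B 0"]) auto
qed

lemma Hausdorff_space_euclidean_t2: "Hausdorff_space (euclidean :: 'b::t2_space topology)"
  unfolding Hausdorff_space_def using hausdorff by (fastforce simp: disjnt_def)

text \<open>Urysohn's lemma for a compact set. The function vanishes off the open set
  \<open>W\<close>, and \<open>W\<close> lies in a compact, hence closed, subset \<open>L\<close> of
  \<open>U\<close>; this keeps the closed support inside \<open>U\<close>.\<close>

lemma bump_function:
  fixes K U :: "'b::t2_space set"
  assumes lc: "locally_compact_space (euclidean :: 'b topology)"
    and "compact K" "open U" "K \<subseteq> U"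
  obtains \<eta> where "\<eta> \<in> Cc" "\<And>x. 0 \<le> \<eta> x" "\<And>x. \<eta> x \<le> 1" "\<And>x. x \<in> K \<Longrightarrow> \<eta> x = 1"
    "func_support \<eta> \<subseteq> U"
proof -
  have nb: "neighbourhood_base_of (\<lambda>C. compactin euclidean C \<and> closedin euclidean C) (euclidean :: 'b topology)"
    using iffD1[OF locally_compact_space_neighbourhood_base_closedin[OF disjI1[OF Hausdorff_space_euclidean_t2]] lc] .
  have "\<forall>x\<in>K. \<exists>V C. open V \<and> compact C \<and> x \<in> V \<and> V \<subseteq> C \<and> C \<subseteq> U"
    using nb assms unfolding neighbourhood_base_of by (simp add: subset_iff) metis
  then obtain V where "\<forall>x\<in>K. \<exists>C. open (V x) \<and> compact C \<and> x \<in> V x \<and> V x \<subseteq> C \<and> C \<subseteq> U"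
    by (rule bchoice[THEN exE])
  then obtain C where VC0: "\<forall>x\<in>K. open (V x) \<and> compact (C x) \<and> x \<in> V x \<and> V x \<subseteq> C x \<and> C x \<subseteq> U"
    by (rule bchoice[THEN exE])
  have VC: "open (V x)" "compact (C x)" "x \<in> V x" "V x \<subseteq> C x" "C x \<subseteq> U" if "x \<in> K" for x
    using bspec[OF VC0 that] by simp_all
  obtain F where F: "F \<subseteq> K" "finite F" "K \<subseteq> (\<Union>x\<in>F. V x)"
    by (rule compactE_image[OF assms(2), of K V]) (use VC in auto)
  define W where "W = (\<Union>x\<in>F. V x)"
  define L where "L = (\<Union>x\<in>F. C x)"
  have L: "compact L" "W \<subseteq> L" "L \<subseteq> U" "open W" "K \<subseteq> W"
  proof -
    show "W \<subseteq> L" unfolding W_def L_def using VC(4) F(1) by (intro UN_mono) auto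
    show "L \<subseteq> U" unfolding L_def using VC(5) F(1) by (intro UN_least) auto
  qed (use F VC in \<open>auto simp: L_def W_def intro!: compact_UN\<close>)
  have cr: "completely_regular_space (euclidean :: 'b topology)"
    using iffD2[OF completely_regular_eq_regular_space[OF lc]
        locally_compact_Hausdorff_imp_regular_space[OF lc Hausdorff_space_euclidean_t2]] .
  obtain f where f: "continuous_map euclidean (subtopology euclidean {0..1::real}) f"
      "f ` (- W) \<subseteq> {0}" "f ` K \<subseteq> {1}"
  proof (rule Urysohn_completely_regular_compact_closed[of 0 1 euclidean K "- W"])
    show "closedin euclidean (- W)"
      using L(4) by (simp add: closed_Compl)
    show "disjnt K (- W)"
      using L(5) by (auto simp: disjnt_def)
  qed (use cr assms(2) in auto)
  have c: "continuous_on UNIV f" and r: "\<And>x. 0 \<le> f x \<and> f x \<le> 1"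
    using f(1) by (auto simp: continuous_map_in_subtopology image_subset_iff)
  have z: "f x = 0" if "x \<notin> L" for x
    using f(2) L(2) that by auto
  show thesis
  proof (rule that[of f])
    show "f \<in> Cc"
      by (rule CcI[OF c L(1) z])
    show "func_support f \<subseteq> U"
      using func_support_subset[of L f] L z compact_imp_closed by blast
  qed (use f r in auto)
qed

section \<open>Linear functionals\<close>

type_synonym 'b functional = "('b \<Rightarrow> real) \<Rightarrow> real"

definition linfun :: "'b::topological_space functional \<Rightarrow> bool" where
  "linfun \<nu> \<longleftrightarrow> \<nu> \<in> extensional Cc \<and>
     (\<forall>\<phi>\<in>Cc. \<forall>\<psi>\<in>Cc. \<nu> (\<lambda>x. \<phi> x + \<psi> x) = \<nu> \<phi> + \<nu> \<psi>) \<and>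
     (\<forall>\<phi>\<in>Cc. \<forall>c. \<nu> (\<lambda>x. c * \<phi> x) = c * \<nu> \<phi>)"

text \<open>Continuity is absent because positivity implies it, by \<open>posfun_radon\<close>;
  nonnegative Radon measures can thus be handled purely algebraically.\<close>

definition posfun :: "'b::topological_space functional \<Rightarrow> bool" where
  "posfun \<nu> \<longleftrightarrow> linfun \<nu> \<and> (\<forall>\<phi>\<in>Cc. (\<forall>x. 0 \<le> \<phi> x) \<longrightarrow> 0 \<le> \<nu> \<phi>)"

definition radon_add ::
  "'b::topological_space functional \<Rightarrow> 'b functional \<Rightarrow> 'b functional" where
  "radon_add \<sigma> \<tau> = (\<lambda>\<phi>\<in>Cc. \<sigma> \<phi> + \<tau> \<phi>)"

definition radon_scale :: "real \<Rightarrow> 'b::topological_space functional \<Rightarrow> 'b functional" where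
  "radon_scale c \<sigma> = (\<lambda>\<phi>\<in>Cc. c * \<sigma> \<phi>)"

text \<open>The measure with density \<open>h\<close> with respect to
  \<open>\<sigma>\<close>.\<close>

definition radon_mult ::
  "('b::topological_space \<Rightarrow> real) \<Rightarrow> 'b functional \<Rightarrow> 'b functional" where
  "radon_mult h \<sigma> = (\<lambda>\<phi>\<in>Cc. \<sigma> (\<lambda>x. h x * \<phi> x))"

lemma linfun_add: "linfun \<nu> \<Longrightarrow> \<phi> \<in> Cc \<Longrightarrow> \<psi> \<in> Cc \<Longrightarrow> \<nu> (\<lambda>x. \<phi> x + \<psi> x) = \<nu> \<phi> + \<nu> \<psi>"
  and linfun_cmult: "linfun \<nu> \<Longrightarrow> \<phi> \<in> Cc \<Longrightarrow> \<nu> (\<lambda>x. c * \<phi> x) = c * \<nu> \<phi>"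
  by (simp_all add: linfun_def)

lemma linfun_minus: "linfun \<nu> \<Longrightarrow> \<phi> \<in> Cc \<Longrightarrow> \<nu> (\<lambda>x. - \<phi> x) = - \<nu> \<phi>"
  using linfun_cmult[of \<nu> \<phi> "-1"] by simp

lemma linfun_diff:
  fixes \<nu> :: "'b::t2_space functional"
  shows "linfun \<nu> \<Longrightarrow> \<phi> \<in> Cc \<Longrightarrow> \<psi> \<in> Cc \<Longrightarrow> \<nu> (\<lambda>x. \<phi> x - \<psi> x) = \<nu> \<phi> - \<nu> \<psi>"
  using linfun_add[of \<nu> \<phi> "\<lambda>x. - \<psi> x"] linfun_minus[of \<nu> \<psi>] by simp

lemma linfun_zero:
  fixes \<nu> :: "'b::t2_space functional"
  shows "linfun \<nu> \<Longrightarrow> \<nu> (\<lambda>x. 0) = 0"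
  using linfun_cmult[of \<nu> "\<lambda>x. 0" 0] by simp

lemma linfun_eqI:
  assumes "linfun \<sigma>" "linfun \<tau>" "\<And>\<phi>. \<phi> \<in> Cc \<Longrightarrow> \<sigma> \<phi> = \<tau> \<phi>"
  shows "\<sigma> = \<tau>"
  using assms extensionalityI unfolding linfun_def by blast

lemma posfun_linfun [simp]: "posfun \<nu> \<Longrightarrow> linfun \<nu>"
  by (simp add: posfun_def)

lemmas posfun_add = linfun_add[OF posfun_linfun]
  and posfun_cmult = linfun_cmult[OF posfun_linfun]
  and posfun_minus = linfun_minus[OF posfun_linfun]
  and posfun_diff = linfun_diff[OF posfun_linfun]
  and posfun_zero = linfun_zero[OF posfun_linfun]

lemma posfun_nonneg: "posfun \<nu> \<Longrightarrow> \<phi> \<in> Cc \<Longrightarrow> (\<And>x. 0 \<le> \<phi> x) \<Longrightarrow> 0 \<le> \<nu> \<phi>"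
  by (simp add: posfun_def)

lemma posfun_mono:
  fixes \<nu> :: "'b::t2_space functional"
  assumes "posfun \<nu>" "\<phi> \<in> Cc" "\<psi> \<in> Cc" "\<And>x. \<phi> x \<le> \<psi> x"
  shows "\<nu> \<phi> \<le> \<nu> \<psi>"
  using posfun_nonneg[OF assms(1), of "\<lambda>x. \<psi> x - \<phi> x"] linfun_diff[of \<nu> \<psi> \<phi>] assms by simp

lemma posfun_abs:
  fixes \<nu> :: "'b::t2_space functional"
  assumes "posfun \<nu>" "\<phi> \<in> Cc"
  shows "\<bar>\<nu> \<phi>\<bar> \<le> \<nu> (\<lambda>x. \<bar>\<phi> x\<bar>)"
  using posfun_mono[OF assms(1), of \<phi> "\<lambda>x. \<bar>\<phi> x\<bar>"] posfun_mono[OF assms(1), of "\<lambda>x. -\<phi> x" "\<lambda>x. \<bar>\<phi> x\<bar>"]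
    linfun_minus[of \<nu> \<phi>] assms by (simp add: abs_le_iff)

lemma linfun_ops [simp]:
  fixes \<sigma> \<tau> :: "'b::t2_space functional"
  shows "linfun \<sigma> \<Longrightarrow> linfun \<tau> \<Longrightarrow> linfun (radon_add \<sigma> \<tau>)"
    "linfun \<sigma> \<Longrightarrow> linfun \<tau> \<Longrightarrow> linfun (radon_diff \<sigma> \<tau>)"
    "linfun \<sigma> \<Longrightarrow> linfun (radon_scale c \<sigma>)"
    "linfun (\<lambda>\<phi>\<in>(Cc :: ('b \<Rightarrow> real) set). 0)"
  by (auto simp: linfun_def radon_add_def radon_diff_def radon_scale_def algebra_simps)

lemma posfun_ops [simp]:
  fixes \<sigma> \<tau> :: "'b::t2_space functional"
  shows "posfun \<sigma> \<Longrightarrow> posfun \<tau> \<Longrightarrow> posfun (radon_add \<sigma> \<tau>)"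
    "0 \<le> c \<Longrightarrow> posfun \<sigma> \<Longrightarrow> posfun (radon_scale c \<sigma>)"
    "posfun (\<lambda>\<phi>\<in>(Cc :: ('b \<Rightarrow> real) set). 0)"
  by (auto simp: posfun_def) (auto simp: radon_add_def radon_scale_def)

lemma radon_ops_apply [simp]:
  "\<phi> \<in> Cc \<Longrightarrow> radon_add \<sigma> \<tau> \<phi> = \<sigma> \<phi> + \<tau> \<phi>"
  "\<phi> \<in> Cc \<Longrightarrow> radon_diff \<sigma> \<tau> \<phi> = \<sigma> \<phi> - \<tau> \<phi>"
  "\<phi> \<in> Cc \<Longrightarrow> radon_scale c \<sigma> \<phi> = c * \<sigma> \<phi>"
  "\<phi> \<in> Cc \<Longrightarrow> radon_mult h \<sigma> \<phi> = \<sigma> (\<lambda>x. h x * \<phi> x)"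
  by (simp_all add: radon_add_def radon_diff_def radon_scale_def radon_mult_def)

lemma posfun_mult:
  fixes \<sigma> :: "'b::t2_space functional"
  assumes "posfun \<sigma>" "continuous_on UNIV h" "\<And>x. 0 \<le> h x"
  shows "posfun (radon_mult h \<sigma>)"
proof -
  have l: "linfun \<sigma>" using assms by simp
  have c: "(\<lambda>x. h x * \<phi> x) \<in> Cc" if "\<phi> \<in> Cc" for \<phi>
    using Cc_mult(1)[OF that assms(2)] .
  have "linfun (radon_mult h \<sigma>)"
    unfolding linfun_def
  proof (intro conjI ballI allI)
    show "radon_mult h \<sigma> \<in> extensional Cc"
      unfolding radon_mult_def by (rule restrict_extensional)
  next
    fix \<phi> \<psi> :: "'b \<Rightarrow> real" assume *: "\<phi> \<in> Cc" "\<psi> \<in> Cc"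
    show "radon_mult h \<sigma> (\<lambda>x. \<phi> x + \<psi> x) = radon_mult h \<sigma> \<phi> + radon_mult h \<sigma> \<psi>"
      using linfun_add[OF l c[OF *(1)] c[OF *(2)]] * by (simp add: distrib_left)
  next
    fix \<phi> :: "'b \<Rightarrow> real" and k assume *: "\<phi> \<in> Cc"
    have "\<sigma> (\<lambda>x. h x * (k * \<phi> x)) = k * \<sigma> (\<lambda>x. h x * \<phi> x)"
      unfolding mult.left_commute[of _ k] by (rule linfun_cmult[OF l c[OF *]])
    then show "radon_mult h \<sigma> (\<lambda>x. k * \<phi> x) = k * radon_mult h \<sigma> \<phi>"
      using * by simp
  qed
  then show ?thesis
    unfolding posfun_def using posfun_nonneg[OF assms(1) c] assms(3) by simp
qed

lemma radon_linfun: "\<nu> \<in> radon \<Longrightarrow> linfun \<nu>"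
  by (simp add: radon_def linfun_def)

text \<open>If \<open>\<eta>\<close> is 1 on \<open>K\<close>, then a \<phi> supported in
  \<open>K\<close> is dominated in absolute value by its supremum times \<open>\<eta>\<close>, so
  positivity gives the bound with constant \<open>\<nu> \<eta>\<close>.\<close>

lemma posfun_radon:
  fixes \<nu> :: "'b::t2_space functional"
  assumes lc: "locally_compact_space (euclidean :: 'b topology)" and "posfun \<nu>"
  shows "\<nu> \<in> radon"
proof -
  have "\<exists>M. \<forall>\<phi>\<in>Cc. func_support \<phi> \<subseteq> K \<longrightarrow> \<bar>\<nu> \<phi>\<bar> \<le> M * (SUP x. \<bar>\<phi> x\<bar>)" if K: "compact K" for K
  proof -
    obtain \<eta> where \<eta>: "\<eta> \<in> Cc" "\<And>x. 0 \<le> \<eta> x" "\<And>x. x \<in> K \<Longrightarrow> \<eta> x = 1"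
      using bump_function[OF lc K open_UNIV] by (metis subset_UNIV)
    have "\<bar>\<nu> \<phi>\<bar> \<le> \<nu> \<eta> * (SUP x. \<bar>\<phi> x\<bar>)" if \<phi>: "\<phi> \<in> Cc" "func_support \<phi> \<subseteq> K" for \<phi>
    proof -
      define S where "S = (SUP x. \<bar>\<phi> x\<bar>)"
      have bdd: "bdd_above (range (\<lambda>x. \<bar>\<phi> x\<bar>))"
        by (rule Cc_bounded[OF \<phi>(1)]) (auto intro!: bdd_aboveI2)
      have S: "\<bar>\<phi> x\<bar> \<le> S" for x
        unfolding S_def by (rule cSUP_upper[OF _ bdd]) simp
      have "0 \<le> S" using S abs_ge_zero order_trans by blast
      then have "\<bar>\<phi> x\<bar> \<le> S * \<eta> x" for x
        using S[of x] \<eta>(2)[of x] \<eta>(3)[of x] \<phi>(2) CcD(3)[OF \<phi>(1), of x]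
        by (cases "x \<in> func_support \<phi>") auto
      then have "\<nu> (\<lambda>x. \<bar>\<phi> x\<bar>) \<le> \<nu> (\<lambda>x. S * \<eta> x)"
        by (intro posfun_mono[OF assms(2)]) (use assms \<phi> \<eta> in auto)
      then show ?thesis
        using posfun_abs[OF assms(2) \<phi>(1)] linfun_cmult[of \<nu> \<eta> S] assms(2) \<eta>(1)
        by (simp add: S_def mult.commute)
    qed
    then show ?thesis by blast
  qed
  then show ?thesis
    using assms(2) by (auto simp: radon_def posfun_def linfun_def)
qed

lemma radon_bound:
  assumes "\<nu> \<in> radon" "compact K"
  shows "\<exists>M. \<forall>\<phi>\<in>Cc. func_support \<phi> \<subseteq> K \<longrightarrow> \<bar>\<nu> \<phi>\<bar> \<le> M * (SUP x. \<bar>\<phi> x\<bar>)"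
  using assms by (simp add: radon_def)

lemma radon_radon_diff:
  fixes \<sigma> \<tau> :: "'b::t2_space functional"
  assumes "\<sigma> \<in> radon" "\<tau> \<in> radon"
  shows "radon_diff \<sigma> \<tau> \<in> radon"
proof -
  have "\<exists>M. \<forall>\<phi>\<in>Cc. func_support \<phi> \<subseteq> K \<longrightarrow> \<bar>radon_diff \<sigma> \<tau> \<phi>\<bar> \<le> M * (SUP x. \<bar>\<phi> x\<bar>)" if K: "compact K" for K
  proof -
    obtain M where M: "\<forall>\<phi>\<in>Cc. func_support \<phi> \<subseteq> K \<longrightarrow> \<bar>\<sigma> \<phi>\<bar> \<le> M * (SUP x. \<bar>\<phi> x\<bar>)"
      using radon_bound[OF assms(1) K] ..
    obtain M' where M': "\<forall>\<phi>\<in>Cc. func_support \<phi> \<subseteq> K \<longrightarrow> \<bar>\<tau> \<phi>\<bar> \<le> M' * (SUP x. \<bar>\<phi> x\<bar>)"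
      using radon_bound[OF assms(2) K] ..
    have "\<bar>radon_diff \<sigma> \<tau> \<phi>\<bar> \<le> (M + M') * (SUP x. \<bar>\<phi> x\<bar>)"
      if "\<phi> \<in> Cc" "func_support \<phi> \<subseteq> K" for \<phi>
      using M[rule_format, OF that] M'[rule_format, OF that] that(1)
      by (simp add: distrib_right abs_le_iff)
    then show ?thesis by (intro exI[of _ "M + M'"]) simp
  qed
  moreover have "linfun (radon_diff \<sigma> \<tau>)"
    using assms by (simp add: radon_linfun)
  ultimately show ?thesis
    by (auto simp: radon_def linfun_def)
qed

lemma radon_pos_UNIV:
  fixes \<nu> :: "'b::t2_space functional"
  assumes lc: "locally_compact_space (euclidean :: 'b topology)"
  shows "\<nu> \<in> radon_pos E \<longleftrightarrow> posfun \<nu> \<and> meas_support \<nu> \<subseteq> E"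
proof
  assume "\<nu> \<in> radon_pos E"
  then show "posfun \<nu> \<and> meas_support \<nu> \<subseteq> E"
    using radon_linfun[of \<nu>] by (simp add: radon_pos_def posfun_def)
next
  assume *: "posfun \<nu> \<and> meas_support \<nu> \<subseteq> E"
  then show "\<nu> \<in> radon_pos E"
    using posfun_radon[OF lc, of \<nu>] by (simp add: radon_pos_def posfun_def)
qed

text \<open>The complement of the support is a union of open null sets. Compactness reduces this
  union to finitely many null bump functions whose sum exceeds 1/2 on the support of \<phi>, so
  \<phi> is dominated by a multiple of that sum.\<close>

lemma posfun_eq_0_off_support:
  fixes \<nu> :: "'b::t2_space functional"
  assumes lc: "locally_compact_space (euclidean :: 'b topology)"
    and \<nu>: "posfun \<nu>" "meas_support \<nu> \<subseteq> E" and \<phi>: "\<phi> \<in> Cc" "func_support \<phi> \<inter> E = {}"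
  shows "\<nu> \<phi> = 0"
proof -
  have "\<forall>x\<in>func_support \<phi>. \<exists>\<eta>\<in>Cc. (\<forall>y. 0 \<le> \<eta> y) \<and> \<eta> x = 1 \<and> \<nu> \<eta> = 0"
  proof
    fix x assume "x \<in> func_support \<phi>"
    then have "x \<notin> meas_support \<nu>"
      using assms by auto
    then obtain U where U: "open U" "x \<in> U" "\<And>\<psi>. \<psi> \<in> Cc \<Longrightarrow> func_support \<psi> \<subseteq> U \<Longrightarrow> \<nu> \<psi> = 0"
      unfolding meas_support_def by auto
    obtain \<eta> where "\<eta> \<in> Cc" "\<And>x. 0 \<le> \<eta> x" "\<eta> x = 1" "func_support \<eta> \<subseteq> U"
      using bump_function[OF lc _ U(1), of "{x}"] U(2)
      by (metis compact_sing bot_least insert_subset singletonI)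
    then show "\<exists>\<eta>\<in>Cc. (\<forall>y. 0 \<le> \<eta> y) \<and> \<eta> x = 1 \<and> \<nu> \<eta> = 0"
      using U(3) by blast
  qed
  then obtain \<eta> where \<eta>: "\<And>x. x \<in> func_support \<phi> \<Longrightarrow> \<eta> x \<in> Cc"
    "\<And>x y. x \<in> func_support \<phi> \<Longrightarrow> 0 \<le> \<eta> x y" "\<And>x. x \<in> func_support \<phi> \<Longrightarrow> \<eta> x x = 1"
    "\<And>x. x \<in> func_support \<phi> \<Longrightarrow> \<nu> (\<eta> x) = 0"
    by metis
  have op: "open {y. 1/2 < \<eta> x y}" if "x \<in> func_support \<phi>" for x
    using CcD(1)[OF \<eta>(1)[OF that]] by (intro open_Collect_less) auto
  obtain F where F: "F \<subseteq> func_support \<phi>" "finite F" "func_support \<phi> \<subseteq> (\<Union>x\<in>F. {y. 1/2 < \<eta> x y})"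
    using compactE_image[OF CcD(2)[OF \<phi>(1)], of "func_support \<phi>" "\<lambda>x. {y. 1/2 < \<eta> x y}"] op \<eta>(3)
    by force
  have s: "(\<lambda>y. \<Sum>x\<in>F'. \<eta> x y) \<in> Cc \<and> \<nu> (\<lambda>y. \<Sum>x\<in>F'. \<eta> x y) = 0" if "F' \<subseteq> func_support \<phi>" "finite F'" for F'
    using that(2,1)
  proof (induction F')
    case empty
    then show ?case using linfun_zero[of \<nu>] \<nu> by simp
  next
    case (insert x F')
    then show ?case using linfun_add[of \<nu> "\<eta> x" "\<lambda>y. \<Sum>x\<in>F'. \<eta> x y"] \<eta> \<nu> by simp
  qed
  obtain B where B: "0 \<le> B" "\<And>x. \<bar>\<phi> x\<bar> \<le> B" using Cc_bounded[OF \<phi>(1)] by blast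
  have "\<bar>\<phi> y\<bar> \<le> 2 * B * (\<Sum>x\<in>F. \<eta> x y)" for y
  proof (cases "y \<in> func_support \<phi>")
    case True
    then obtain x where x: "x \<in> F" "1/2 < \<eta> x y" using F by auto
    have "\<eta> x y \<le> (\<Sum>x\<in>F. \<eta> x y)"
      using F x \<eta>(2) by (intro member_le_sum) auto
    then have "B * (1/2) \<le> B * (\<Sum>x\<in>F. \<eta> x y)"
      using x B(1) by (intro mult_left_mono) auto
    then show ?thesis using B(2)[of y] by simp
  next
    case False
    then show ?thesis using CcD(3)[OF \<phi>(1)] B F \<eta>(2) by (auto intro!: mult_nonneg_nonneg sum_nonneg)
  qed
  then have "\<nu> (\<lambda>x. \<bar>\<phi> x\<bar>) \<le> \<nu> (\<lambda>y. (2 * B) * (\<Sum>x\<in>F. \<eta> x y))"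
    using s F \<phi> by (intro posfun_mono[OF \<nu>(1)]) auto
  also have "\<dots> = 0"
    using linfun_cmult[of \<nu> "\<lambda>y. \<Sum>x\<in>F. \<eta> x y" "2*B"] s F \<nu> by simp
  finally show ?thesis
    using posfun_abs[OF \<nu>(1) \<phi>(1)] by simp
qed

lemma le_of_le_add_epsilon:
  fixes a b c :: real
  assumes "\<And>e. 0 < e \<Longrightarrow> a \<le> b + e * c" "0 \<le> c"
  shows "a \<le> b"
proof (rule field_le_epsilon)
  fix d :: real assume d: "0 < d"
  have "d / (c + 1) * c \<le> d" using d assms(2) by (simp add: field_simps)
  then show "a \<le> b + d"
    using assms(1)[of "d / (c + 1)"] d assms(2) by (simp add: add_nonneg_pos)
qed

text \<open>Positive values of \<phi> may accumulate at \<open>E\<close>, so the support of its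
  positive part may touch \<open>E\<close>. Subtracting \<open>e * \<eta>\<close> leaves a positive
  part supported where \<phi> \<ge> e, which misses \<open>E\<close>; then \<open>e\<close> tends to
  0.\<close>

lemma posfun_nonpos_on_support:
  fixes \<nu> :: "'b::t2_space functional"
  assumes lc: "locally_compact_space (euclidean :: 'b topology)"
    and \<nu>: "posfun \<nu>" "meas_support \<nu> \<subseteq> E" and \<phi>: "\<phi> \<in> Cc" "\<And>x. x \<in> E \<Longrightarrow> \<phi> x \<le> 0"
  shows "\<nu> \<phi> \<le> 0"
proof -
  obtain \<eta> where \<eta>: "\<eta> \<in> Cc" "\<And>x. 0 \<le> \<eta> x" "\<And>x. x \<in> func_support \<phi> \<Longrightarrow> \<eta> x = 1"
    using bump_function[OF lc CcD(2)[OF \<phi>(1)] open_UNIV] by (metis subset_UNIV)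
  have "\<nu> \<phi> \<le> e * \<nu> \<eta>" if e: "0 < e" for e
  proof -
    let ?h = "\<lambda>x. max (\<phi> x - e * \<eta> x) 0"
    have c: "continuous_on UNIV \<phi>" using CcD(1)[OF \<phi>(1)] .
    have h: "?h \<in> Cc" using \<phi> \<eta> by simp
    have hz: "?h x = 0" if "\<phi> x < e" for x
      using that \<eta>(2,3)[of x] CcD(3)[OF \<phi>(1), of x] e by (cases "x \<in> func_support \<phi>") auto
    have "func_support ?h \<subseteq> {x. e \<le> \<phi> x}"
      by (rule func_support_subset) (use hz c in \<open>auto intro!: closed_Collect_le simp: not_le\<close>)
    then have "func_support ?h \<inter> E = {}"
      using \<phi>(2) e by force
    then have 0: "\<nu> ?h = 0"
      using posfun_eq_0_off_support[OF lc \<nu> h] by simp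
    have "\<nu> \<phi> \<le> \<nu> (\<lambda>x. ?h x + e * \<eta> x)"
      by (intro posfun_mono[OF \<nu>(1)]) (use \<phi> \<eta> h in auto)
    also have "\<dots> = e * \<nu> \<eta>"
      using linfun_add[of \<nu> ?h "\<lambda>x. e * \<eta> x"] linfun_cmult[of \<nu> \<eta> e] h \<eta> \<nu> 0 by simp
    finally show ?thesis .
  qed
  then show ?thesis
    using le_of_le_add_epsilon[of "\<nu> \<phi>" 0 "\<nu> \<eta>"] posfun_nonneg[OF \<nu>(1) \<eta>(1,2)] by simp
qed

lemma posfun_mono_on_support:
  fixes \<nu> :: "'b::t2_space functional"
  assumes lc: "locally_compact_space (euclidean :: 'b topology)"
    and \<nu>: "posfun \<nu>" "meas_support \<nu> \<subseteq> E" and \<phi>: "\<phi> \<in> Cc" "\<psi> \<in> Cc" "\<And>x. x \<in> E \<Longrightarrow> \<phi> x \<le> \<psi> x"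
  shows "\<nu> \<phi> \<le> \<nu> \<psi>"
  using posfun_nonpos_on_support[OF lc \<nu>, of "\<lambda>x. \<phi> x - \<psi> x"] linfun_diff[of \<nu> \<phi> \<psi>] assms by simp

lemma meas_support_subset_iff:
  fixes \<nu> :: "'b::t2_space functional"
  assumes lc: "locally_compact_space (euclidean :: 'b topology)" and "posfun \<nu>" "closed E"
  shows "meas_support \<nu> \<subseteq> E \<longleftrightarrow> (\<forall>\<phi>\<in>Cc. func_support \<phi> \<inter> E = {} \<longrightarrow> \<nu> \<phi> = 0)"
proof
  assume *: "\<forall>\<phi>\<in>Cc. func_support \<phi> \<inter> E = {} \<longrightarrow> \<nu> \<phi> = 0"
  have "- E \<in> {U. open U \<and> (\<forall>\<phi>\<in>Cc. func_support \<phi> \<subseteq> U \<longrightarrow> \<nu> \<phi> = 0)}"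
    using * assms(3) by (auto simp: disjoint_eq_subset_Compl)
  then show "meas_support \<nu> \<subseteq> E"
    unfolding meas_support_def by blast
qed (use posfun_eq_0_off_support[OF lc assms(2)] in blast)

lemma closed_meas_support: "closed (meas_support \<nu>)"
  unfolding meas_support_def by (intro closed_Compl open_Union) auto

section \<open>Jordan decomposition\<close>

lemma linfun_eqI_nonneg:
  fixes \<sigma> \<tau> :: "'b::t2_space functional"
  assumes "linfun \<sigma>" "linfun \<tau>" "\<And>\<phi>. \<phi> \<in> Cc \<Longrightarrow> (\<And>x. 0 \<le> \<phi> x) \<Longrightarrow> \<sigma> \<phi> = \<tau> \<phi>"
  shows "\<sigma> = \<tau>"
proof (rule linfun_eqI[OF assms(1,2)])
  fix \<phi> :: "'b \<Rightarrow> real" assume \<phi>: "\<phi> \<in> Cc"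
  have eq: "\<phi> = (\<lambda>x. max (\<phi> x) 0 - max (- \<phi> x) 0)" by (auto simp: fun_eq_iff)
  have "\<sigma> (\<lambda>x. max (\<phi> x) 0 - max (- \<phi> x) 0) = \<tau> (\<lambda>x. max (\<phi> x) 0 - max (- \<phi> x) 0)"
    using linfun_diff[OF assms(1) Cc_pos(1)[OF \<phi>] Cc_pos(2)[OF \<phi>]]
      linfun_diff[OF assms(2) Cc_pos(1)[OF \<phi>] Cc_pos(2)[OF \<phi>]]
      assms(3)[OF Cc_pos(1)[OF \<phi>]] assms(3)[OF Cc_pos(2)[OF \<phi>]] by simp
  then show "\<sigma> \<phi> = \<tau> \<phi>" using eq by simp
qed

definition nonneg_minorants :: "('b::topological_space \<Rightarrow> real) \<Rightarrow> ('b \<Rightarrow> real) set" where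
  "nonneg_minorants \<phi> = {\<psi> \<in> Cc. \<forall>x. 0 \<le> \<psi> x \<and> \<psi> x \<le> max (\<phi> x) 0}"

text \<open>This is \<open>\<nu>\<^sup>+\<close> at the positive part of \<phi>, since the minorants
  of \<phi> are those of max \<phi> 0.\<close>

definition sup_below :: "'b::topological_space functional \<Rightarrow> ('b \<Rightarrow> real) \<Rightarrow> real" where
  "sup_below \<nu> \<phi> = (SUP \<psi>\<in>nonneg_minorants \<phi>. \<nu> \<psi>)"

text \<open>Exactly what the Jordan decomposition needs. It holds for Radon functionals and for
  differences of positive ones, which covers tensor squares of signed measures without estimating
  them on compact sets.\<close>

definition order_bounded :: "'b::topological_space functional \<Rightarrow> bool" where
  "order_bounded \<nu> \<longleftrightarrow> linfun \<nu> \<and> (\<forall>\<phi>\<in>Cc. bdd_above (\<nu> ` nonneg_minorants \<phi>))"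

lemma pos_part_eq: "pos_part \<nu> = (\<lambda>\<phi>\<in>Cc. sup_below \<nu> \<phi> - sup_below \<nu> (\<lambda>x. - \<phi> x))"
proof -
  have "{\<nu> \<psi> |\<psi>. \<psi> \<in> Cc \<and> (\<forall>x. 0 \<le> \<psi> x \<and> \<psi> x \<le> max (\<phi> x) 0)} = \<nu> ` nonneg_minorants \<phi>" for \<phi>
    by (auto simp: nonneg_minorants_def)
  then show ?thesis
    unfolding pos_part_def sup_below_def by simp
qed

lemma nonneg_minorantsI: "\<psi> \<in> Cc \<Longrightarrow> (\<And>x. 0 \<le> \<psi> x) \<Longrightarrow> (\<And>x. \<psi> x \<le> max (\<phi> x) 0) \<Longrightarrow> \<psi> \<in> nonneg_minorants \<phi>"
  by (simp add: nonneg_minorants_def)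

lemma nonneg_minorantsD:
  assumes "\<psi> \<in> nonneg_minorants \<phi>"
  shows "\<psi> \<in> Cc" "0 \<le> \<psi> x" "\<psi> x \<le> max (\<phi> x) 0"
  using assms by (simp_all add: nonneg_minorants_def)

lemma zero_nonneg_minorant: "(\<lambda>x::'b::t2_space. 0) \<in> nonneg_minorants \<phi>"
  by (rule nonneg_minorantsI) auto

context
  fixes \<nu> :: "'b::t2_space functional"
  assumes ob: "order_bounded \<nu>"
begin

lemma order_bounded_linfun: "linfun \<nu>"
  using ob by (simp add: order_bounded_def)

lemma sup_below_upper: "\<phi> \<in> Cc \<Longrightarrow> \<psi> \<in> nonneg_minorants \<phi> \<Longrightarrow> \<nu> \<psi> \<le> sup_below \<nu> \<phi>"
  unfolding sup_below_def using ob by (intro cSUP_upper) (auto simp: order_bounded_def)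

lemma sup_below_least: "(\<And>\<psi>. \<psi> \<in> nonneg_minorants \<phi> \<Longrightarrow> \<nu> \<psi> \<le> B) \<Longrightarrow> sup_below \<nu> \<phi> \<le> B"
  unfolding sup_below_def using zero_nonneg_minorant by (intro cSUP_least) auto

lemma sup_below_nonneg: "\<phi> \<in> Cc \<Longrightarrow> 0 \<le> sup_below \<nu> \<phi>"
  using sup_below_upper[OF _ zero_nonneg_minorant, of \<phi>] linfun_zero[OF order_bounded_linfun] by simp

lemma sup_below_max: "sup_below \<nu> (\<lambda>x. max (\<phi> x) 0) = sup_below \<nu> \<phi>"
  by (simp add: sup_below_def nonneg_minorants_def)

lemma sup_below_nonpos: "(\<And>x. \<phi> x \<le> 0) \<Longrightarrow> sup_below \<nu> \<phi> = 0"
proof -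
  assume *: "\<And>x. \<phi> x \<le> 0"
  have "nonneg_minorants \<phi> = {\<lambda>x. 0}"
  proof
    show "nonneg_minorants \<phi> \<subseteq> {\<lambda>x. 0}"
    proof
      fix \<psi> assume \<psi>: "\<psi> \<in> nonneg_minorants \<phi>"
      have "\<psi> x = 0" for x
        using nonneg_minorantsD(2,3)[OF \<psi>, of x] *[of x] by simp
      then show "\<psi> \<in> {\<lambda>x. 0}" by auto
    qed
  qed (use zero_nonneg_minorant in auto)
  then show ?thesis
    using linfun_zero[OF order_bounded_linfun] by (simp add: sup_below_def)
qed

text \<open>Riesz decomposition: a minorant \<psi> of the sum splits into min \<psi> \<phi>1 and the
  remainder, which is a minorant of \<phi>2.\<close>

lemma sup_below_add:
  assumes "\<phi>1 \<in> Cc" "\<phi>2 \<in> Cc" "\<And>x. 0 \<le> \<phi>1 x" "\<And>x. 0 \<le> \<phi>2 x"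
  shows "sup_below \<nu> (\<lambda>x. \<phi>1 x + \<phi>2 x) = sup_below \<nu> \<phi>1 + sup_below \<nu> \<phi>2"
proof (rule antisym)
  show "sup_below \<nu> (\<lambda>x. \<phi>1 x + \<phi>2 x) \<le> sup_below \<nu> \<phi>1 + sup_below \<nu> \<phi>2"
  proof (rule sup_below_least)
    fix \<psi> assume \<psi>: "\<psi> \<in> nonneg_minorants (\<lambda>x. \<phi>1 x + \<phi>2 x)"
    note d = nonneg_minorantsD[OF \<psi>]
    let ?a = "\<lambda>x. min (\<psi> x) (\<phi>1 x)" and ?b = "\<lambda>x. \<psi> x - min (\<psi> x) (\<phi>1 x)"
    have c: "?a \<in> Cc" "?b \<in> Cc"
      using d(1) assms by simp_all
    have "?a \<in> nonneg_minorants \<phi>1"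
      by (rule nonneg_minorantsI[OF c(1)]) (use d assms in \<open>auto simp: min_def max_def\<close>)
    moreover have "?b \<in> nonneg_minorants \<phi>2"
    proof (rule nonneg_minorantsI[OF c(2)])
      fix x show "?b x \<le> max (\<phi>2 x) 0"
        using d(2,3)[of x] assms(3,4)[of x] by (simp add: min_def max_def split: if_splits)
    qed (use d assms in \<open>auto simp: min_def max_def\<close>)
    ultimately have "\<nu> ?a \<le> sup_below \<nu> \<phi>1" "\<nu> ?b \<le> sup_below \<nu> \<phi>2"
      using sup_below_upper assms by auto
    moreover have "\<nu> \<psi> = \<nu> ?a + \<nu> ?b"
      using linfun_add[OF order_bounded_linfun c] by simp
    ultimately show "\<nu> \<psi> \<le> sup_below \<nu> \<phi>1 + sup_below \<nu> \<phi>2" by simp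
  qed
  have s: "\<phi>1 \<in> Cc" "\<phi>2 \<in> Cc" "(\<lambda>x. \<phi>1 x + \<phi>2 x) \<in> Cc" using assms by simp_all
  have *: "\<nu> \<psi>1 + \<nu> \<psi>2 \<le> sup_below \<nu> (\<lambda>x. \<phi>1 x + \<phi>2 x)"
    if "\<psi>1 \<in> nonneg_minorants \<phi>1" "\<psi>2 \<in> nonneg_minorants \<phi>2" for \<psi>1 \<psi>2
  proof -
    note d = nonneg_minorantsD[OF that(1)] nonneg_minorantsD[OF that(2)]
    have "(\<lambda>x. \<psi>1 x + \<psi>2 x) \<in> nonneg_minorants (\<lambda>x. \<phi>1 x + \<phi>2 x)"
    proof (rule nonneg_minorantsI)
      fix x show "\<psi>1 x + \<psi>2 x \<le> max (\<phi>1 x + \<phi>2 x) 0"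
        using d(3,6)[of x] assms(3,4)[of x] by simp
    qed (use d in auto)
    from sup_below_upper[OF s(3) this] show ?thesis
      using linfun_add[OF order_bounded_linfun d(1) d(4)] by simp
  qed
  have "sup_below \<nu> \<phi>2 \<le> sup_below \<nu> (\<lambda>x. \<phi>1 x + \<phi>2 x) - \<nu> \<psi>1" if "\<psi>1 \<in> nonneg_minorants \<phi>1" for \<psi>1
    by (rule sup_below_least) (use *[OF that] in fastforce)
  then have "sup_below \<nu> \<phi>1 \<le> sup_below \<nu> (\<lambda>x. \<phi>1 x + \<phi>2 x) - sup_below \<nu> \<phi>2"
    by (intro sup_below_least) fastforce
  then show "sup_below \<nu> \<phi>1 + sup_below \<nu> \<phi>2 \<le> sup_below \<nu> (\<lambda>x. \<phi>1 x + \<phi>2 x)"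
    by simp
qed

lemma sup_below_cmult_le:
  assumes "\<phi> \<in> Cc" "0 < c"
  shows "sup_below \<nu> (\<lambda>x. c * \<phi> x) \<le> c * sup_below \<nu> \<phi>"
proof (rule sup_below_least)
  fix \<psi> assume \<psi>: "\<psi> \<in> nonneg_minorants (\<lambda>x. c * \<phi> x)"
  note d = nonneg_minorantsD[OF \<psi>]
  have "(\<lambda>x. inverse c * \<psi> x) \<in> nonneg_minorants \<phi>"
  proof (rule nonneg_minorantsI)
    fix x show "inverse c * \<psi> x \<le> max (\<phi> x) 0"
      using d(3)[of x] assms(2) max_mult_distrib_left[of c "\<phi> x" 0] by (simp add: field_simps)
  qed (use d assms in auto)
  from sup_below_upper[OF assms(1) this] have "inverse c * \<nu> \<psi> \<le> sup_below \<nu> \<phi>"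
    using linfun_cmult[OF order_bounded_linfun d(1)] by simp
  then show "\<nu> \<psi> \<le> c * sup_below \<nu> \<phi>"
    using assms(2) by (simp add: field_simps)
qed

lemma sup_below_cmult:
  assumes "\<phi> \<in> Cc" "0 \<le> c"
  shows "sup_below \<nu> (\<lambda>x. c * \<phi> x) = c * sup_below \<nu> \<phi>"
proof (cases "c = 0")
  case True
  then show ?thesis using sup_below_nonpos[of "\<lambda>x. 0"] by simp
next
  case False
  then have c: "0 < c" using assms by simp
  have "sup_below \<nu> (\<lambda>x. inverse c * (c * \<phi> x)) \<le> inverse c * sup_below \<nu> (\<lambda>x. c * \<phi> x)"
    by (rule sup_below_cmult_le) (use assms c in auto)
  then have "c * sup_below \<nu> \<phi> \<le> sup_below \<nu> (\<lambda>x. c * \<phi> x)"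
    using c by (simp add: field_simps)
  then show ?thesis using sup_below_cmult_le[OF assms(1) c] by simp
qed

lemma pos_part_nonneg_apply:
  assumes "\<phi> \<in> Cc" "\<And>x. 0 \<le> \<phi> x"
  shows "pos_part \<nu> \<phi> = sup_below \<nu> \<phi>"
  using assms sup_below_nonpos[of "\<lambda>x. - \<phi> x"] by (simp add: pos_part_eq)

lemma posfun_pos_part: "posfun (pos_part \<nu>)"
proof -
  have "linfun (pos_part \<nu>)"
    unfolding linfun_def
  proof (intro conjI ballI allI)
    show "pos_part \<nu> \<in> extensional Cc"
      unfolding pos_part_eq by (rule restrict_extensional)
  next
    fix \<phi> \<psi> :: "'b \<Rightarrow> real" assume *: "\<phi> \<in> Cc" "\<psi> \<in> Cc"
    let ?p = "\<lambda>f x. max (f x) (0::real)"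
    let ?s = "\<lambda>x. \<phi> x + \<psi> x"
    let ?m = "\<lambda>f x. - f x :: real"
    have c: "?p \<phi> \<in> Cc" "?p \<psi> \<in> Cc" "?p (?m \<phi>) \<in> Cc" "?p (?m \<psi>) \<in> Cc" "?p ?s \<in> Cc" "?p (?m ?s) \<in> Cc"
      using * by (intro Cc_pos Cc_ops(1); simp)+
    \<comment> \<open>The identity s^+ + \<phi>^- + \<psi>^- = s^- + \<phi>^+ + \<psi>^+ for s =
      \<phi> + \<psi> has only nonnegative terms, so additivity on nonnegative functions applies to
      both sides.\<close>
    have "(\<lambda>x. ?p ?s x + (?p (?m \<phi>) x + ?p (?m \<psi>) x)) = (\<lambda>x. ?p (?m ?s) x + (?p \<phi> x + ?p \<psi> x))"
      by (auto simp: max_def fun_eq_iff)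
    then have "sup_below \<nu> (\<lambda>x. ?p ?s x + (?p (?m \<phi>) x + ?p (?m \<psi>) x)) =
        sup_below \<nu> (\<lambda>x. ?p (?m ?s) x + (?p \<phi> x + ?p \<psi> x))" by simp
    moreover have "sup_below \<nu> (\<lambda>x. ?p ?s x + (?p (?m \<phi>) x + ?p (?m \<psi>) x)) =
        sup_below \<nu> (?p ?s) + (sup_below \<nu> (?p (?m \<phi>)) + sup_below \<nu> (?p (?m \<psi>)))"
      using sup_below_add[OF c(5) Cc_ops(1)[OF c(3,4)]] sup_below_add[OF c(3,4)] by simp
    moreover have "sup_below \<nu> (\<lambda>x. ?p (?m ?s) x + (?p \<phi> x + ?p \<psi> x)) =
        sup_below \<nu> (?p (?m ?s)) + (sup_below \<nu> (?p \<phi>) + sup_below \<nu> (?p \<psi>))"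
      using sup_below_add[OF c(6) Cc_ops(1)[OF c(1,2)]] sup_below_add[OF c(1,2)] by simp
    ultimately show "pos_part \<nu> ?s = pos_part \<nu> \<phi> + pos_part \<nu> \<psi>"
      using * by (simp add: pos_part_eq sup_below_max)
  next
    fix \<phi> :: "'b \<Rightarrow> real" and c :: real assume *: "\<phi> \<in> Cc"
    show "pos_part \<nu> (\<lambda>x. c * \<phi> x) = c * pos_part \<nu> \<phi>"
    proof (cases "0 \<le> c")
      case True
      then show ?thesis
        using sup_below_cmult[OF * True] sup_below_cmult[OF Cc_minus[OF *] True] *
        by (simp add: pos_part_eq algebra_simps)
    next
      case False
      then have "0 \<le> - c" by simp
      then show ?thesis
        using sup_below_cmult[OF *, of "-c"] sup_below_cmult[OF Cc_minus[OF *], of "-c"] *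
        by (simp add: pos_part_eq algebra_simps)
    qed
  qed
  then show ?thesis
    unfolding posfun_def using pos_part_nonneg_apply sup_below_nonneg by auto
qed

text \<open>Reflection: if \<psi> is a nonnegative minorant of \<phi>, so is max \<phi> 0 - \<psi>,
  and this turns the supremum of -\<nu> into that of \<nu>.\<close>

lemma order_bounded_uminus: "order_bounded (\<lambda>\<phi>\<in>Cc. - \<nu> \<phi>)"
  and sup_below_uminus: "\<phi> \<in> Cc \<Longrightarrow> (\<And>x. 0 \<le> \<phi> x) \<Longrightarrow>
      sup_below (\<lambda>\<phi>\<in>Cc. - \<nu> \<phi>) \<phi> = sup_below \<nu> \<phi> - \<nu> \<phi>"
proof -
  let ?m = "\<lambda>\<phi>\<in>Cc. - \<nu> \<phi>"
  have flip: "(\<lambda>x. max (\<phi> x) 0 - \<psi> x) \<in> nonneg_minorants \<phi>" if "\<phi> \<in> Cc" "\<psi> \<in> nonneg_minorants \<phi>" for \<phi> \<psi> :: "'b \<Rightarrow> real"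
  proof (rule nonneg_minorantsI)
    show "(\<lambda>x. max (\<phi> x) 0 - \<psi> x) \<in> Cc"
      by (rule Cc_ops(2)[OF Cc_pos(1)[OF that(1)] nonneg_minorantsD(1)[OF that(2)]])
  qed (use nonneg_minorantsD(2,3)[OF that(2)] in auto)
  have val: "?m \<psi> = \<nu> (\<lambda>x. max (\<phi> x) 0 - \<psi> x) - \<nu> (\<lambda>x. max (\<phi> x) 0)"
    if "\<phi> \<in> Cc" "\<psi> \<in> nonneg_minorants \<phi>" for \<phi> \<psi>
    using linfun_diff[OF order_bounded_linfun Cc_pos(1)[OF that(1)] nonneg_minorantsD(1)[OF that(2)]] nonneg_minorantsD(1)[OF that(2)] by simp
  have le: "?m \<psi> \<le> sup_below \<nu> \<phi> - \<nu> (\<lambda>x. max (\<phi> x) 0)" if "\<phi> \<in> Cc" "\<psi> \<in> nonneg_minorants \<phi>" for \<phi> \<psi>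
    using val[OF that] sup_below_upper[OF that(1) flip[OF that]] by simp
  have "?m = radon_scale (-1) \<nu>"
    by (simp add: radon_scale_def)
  then have l: "linfun ?m"
    using order_bounded_linfun by simp
  show ob': "order_bounded ?m"
    unfolding order_bounded_def
  proof (intro conjI ballI l)
    fix \<phi> :: "'b \<Rightarrow> real" assume "\<phi> \<in> Cc"
    then show "bdd_above (?m ` nonneg_minorants \<phi>)"
      by (intro bdd_aboveI2[where M = "sup_below \<nu> \<phi> - \<nu> (\<lambda>x. max (\<phi> x) 0)"] le)
  qed
  assume \<phi>: "\<phi> \<in> Cc" "\<And>x. 0 \<le> \<phi> x"
  then have mx: "(\<lambda>x. max (\<phi> x) 0) = \<phi>"
    by (auto simp: max_def fun_eq_iff intro: antisym)
  have a: "sup_below ?m \<phi> \<le> sup_below \<nu> \<phi> - \<nu> \<phi>"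
    unfolding sup_below_def[of ?m]
  proof (rule cSUP_least)
    show "nonneg_minorants \<phi> \<noteq> {}" using zero_nonneg_minorant by blast
    show "?m \<psi> \<le> sup_below \<nu> \<phi> - \<nu> \<phi>" if "\<psi> \<in> nonneg_minorants \<phi>" for \<psi>
      using le[OF \<phi>(1) that] unfolding mx .
  qed
  have "sup_below \<nu> \<phi> \<le> sup_below ?m \<phi> + \<nu> \<phi>"
  proof (rule sup_below_least)
    fix \<psi> assume \<psi>: "\<psi> \<in> nonneg_minorants \<phi>"
    have "?m (\<lambda>x. max (\<phi> x) 0 - \<psi> x) \<le> sup_below ?m \<phi>"
      unfolding sup_below_def[of ?m]
    proof (rule cSUP_upper[OF flip[OF \<phi>(1) \<psi>]])
      show "bdd_above (?m ` nonneg_minorants \<phi>)"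
        by (rule bspec[OF conjunct2[OF ob'[unfolded order_bounded_def]] \<phi>(1)])
    qed
    then show "\<nu> \<psi> \<le> sup_below ?m \<phi> + \<nu> \<phi>"
      using linfun_diff[OF order_bounded_linfun \<phi>(1) nonneg_minorantsD(1)[OF \<psi>]] \<phi>(1) nonneg_minorantsD(1)[OF \<psi>]
      by (simp add: max_absorb1 \<phi>(2))
  qed
  with a show "sup_below ?m \<phi> = sup_below \<nu> \<phi> - \<nu> \<phi>" by simp
qed

end

lemma posfun_neg_part:
  fixes \<nu> :: "'b::t2_space functional"
  assumes "order_bounded \<nu>"
  shows "posfun (neg_part \<nu>)"
  unfolding neg_part_def by (rule posfun_pos_part[OF order_bounded_uminus[OF assms]])

lemma jordan_decomposition:
  fixes \<nu> :: "'b::t2_space functional"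
  assumes "order_bounded \<nu>"
  shows "\<nu> = radon_diff (pos_part \<nu>) (neg_part \<nu>)"
proof (rule linfun_eqI_nonneg)
  show "linfun (radon_diff (pos_part \<nu>) (neg_part \<nu>))"
    using posfun_pos_part[OF assms] posfun_neg_part[OF assms] by simp
  fix \<phi> :: "'b \<Rightarrow> real" assume \<phi>: "\<phi> \<in> Cc" "\<And>x. 0 \<le> \<phi> x"
  show "\<nu> \<phi> = radon_diff (pos_part \<nu>) (neg_part \<nu>) \<phi>"
    using pos_part_nonneg_apply[OF assms \<phi>] pos_part_nonneg_apply[OF order_bounded_uminus[OF assms] \<phi>]
      sup_below_uminus[OF assms \<phi>] \<phi>(1) by (simp add: neg_part_def)
qed (rule order_bounded_linfun[OF assms])

text \<open>Minimality of the Jordan decomposition: a nonnegative \<psi> \<le> \<phi> satisfies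
  (\<sigma> - \<tau>) \<psi> \<le> \<sigma> \<psi> \<le> \<sigma> \<phi>.\<close>

lemma order_bounded_radon_diff:
  fixes \<sigma> \<tau> :: "'b::t2_space functional"
  assumes "posfun \<sigma>" "posfun \<tau>"
  shows "order_bounded (radon_diff \<sigma> \<tau>)"
    and "\<phi> \<in> Cc \<Longrightarrow> (\<And>x. 0 \<le> \<phi> x) \<Longrightarrow> pos_part (radon_diff \<sigma> \<tau>) \<phi> \<le> \<sigma> \<phi>"
proof -
  have *: "radon_diff \<sigma> \<tau> \<psi> \<le> \<sigma> (\<lambda>x. max (\<phi> x) 0)" if "\<phi> \<in> Cc" "\<psi> \<in> nonneg_minorants \<phi>" for \<phi> \<psi>
  proof -
    note d = nonneg_minorantsD[OF that(2)]
    have "\<sigma> \<psi> \<le> \<sigma> (\<lambda>x. max (\<phi> x) 0)"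
      using posfun_mono[OF assms(1) d(1) Cc_pos(1)[OF that(1)] d(3)] .
    then show ?thesis
      using posfun_nonneg[OF assms(2) d(1,2)] d(1) by simp
  qed
  show ob: "order_bounded (radon_diff \<sigma> \<tau>)"
    unfolding order_bounded_def
  proof (intro conjI ballI)
    fix \<phi> :: "'b \<Rightarrow> real" assume "\<phi> \<in> Cc"
    then show "bdd_above (radon_diff \<sigma> \<tau> ` nonneg_minorants \<phi>)"
      by (intro bdd_aboveI2[where M = "\<sigma> (\<lambda>x. max (\<phi> x) 0)"] *)
  qed (use assms in simp)
  assume \<phi>: "\<phi> \<in> Cc" "\<And>x. 0 \<le> \<phi> x"
  then have mx: "(\<lambda>x. max (\<phi> x) 0) = \<phi>"
    by (auto simp: max_def fun_eq_iff intro: antisym)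
  show "pos_part (radon_diff \<sigma> \<tau>) \<phi> \<le> \<sigma> \<phi>"
    unfolding pos_part_nonneg_apply[OF ob \<phi>]
    by (rule sup_below_least[OF ob]) (use *[OF \<phi>(1)] mx in simp)
qed

lemma pos_part_posfun:
  fixes \<nu> :: "'b::t2_space functional"
  assumes "posfun \<nu>"
  shows "pos_part \<nu> = \<nu>" "neg_part \<nu> = (\<lambda>\<phi>\<in>Cc. 0)"
proof -
  let ?z = "\<lambda>\<phi>\<in>(Cc :: ('b \<Rightarrow> real) set). 0::real"
  have z: "posfun ?z" by simp
  have "\<nu> = radon_diff \<nu> ?z"
    by (rule linfun_eqI) (use assms in auto)
  then have ob: "order_bounded \<nu>"
    using order_bounded_radon_diff(1)[OF assms z] by simp
  show p: "pos_part \<nu> = \<nu>"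
  proof (rule linfun_eqI_nonneg)
    fix \<phi> :: "'b \<Rightarrow> real" assume \<phi>: "\<phi> \<in> Cc" "\<And>x. 0 \<le> \<phi> x"
    have "\<nu> \<phi> \<le> sup_below \<nu> \<phi>"
      by (rule sup_below_upper[OF ob]) (use \<phi> in \<open>auto simp: nonneg_minorants_def\<close>)
    moreover have "sup_below \<nu> \<phi> \<le> \<nu> \<phi>"
    proof (rule sup_below_least[OF ob])
      fix \<psi> assume "\<psi> \<in> nonneg_minorants \<phi>"
      note d = nonneg_minorantsD[OF this]
      have "\<psi> x \<le> \<phi> x" for x using d(3)[of x] \<phi>(2)[of x] by simp
      then show "\<nu> \<psi> \<le> \<nu> \<phi>" using posfun_mono[OF assms d(1) \<phi>(1)] by simp
    qed
    ultimately show "pos_part \<nu> \<phi> = \<nu> \<phi>"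
      using pos_part_nonneg_apply[OF ob \<phi>] by simp
  qed (use assms posfun_pos_part[OF ob] in auto)
  show "neg_part \<nu> = ?z"
  proof (rule linfun_eqI)
    fix \<phi> :: "'b \<Rightarrow> real" assume "\<phi> \<in> Cc"
    then have "\<nu> \<phi> = \<nu> \<phi> - neg_part \<nu> \<phi>"
      using jordan_decomposition[OF ob] p by (metis radon_ops_apply(2))
    then show "neg_part \<nu> \<phi> = ?z \<phi>" using \<open>\<phi> \<in> Cc\<close> by simp
  qed (use posfun_neg_part[OF ob] in auto)
qed

text \<open>Minorants of \<phi> are supported in the support of \<phi>, so the continuity bound on
  that one compact set serves them all.\<close>

lemma radon_order_bounded:
  fixes \<nu> :: "'b::t2_space functional"
  assumes "\<nu> \<in> radon"
  shows "order_bounded \<nu>"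
  unfolding order_bounded_def
proof (intro conjI ballI)
  show "linfun \<nu>" using radon_linfun[OF assms] .
  fix \<phi> :: "'b \<Rightarrow> real" assume \<phi>: "\<phi> \<in> Cc"
  obtain B where B: "0 \<le> B" "\<And>x. \<bar>\<phi> x\<bar> \<le> B" using Cc_bounded[OF \<phi>] by blast
  obtain M where M: "\<forall>\<psi>\<in>Cc. func_support \<psi> \<subseteq> func_support \<phi> \<longrightarrow> \<bar>\<nu> \<psi>\<bar> \<le> M * (SUP x. \<bar>\<psi> x\<bar>)"
    using radon_bound[OF assms CcD(2)[OF \<phi>]] ..
  have "\<nu> \<psi> \<le> \<bar>M\<bar> * B" if "\<psi> \<in> nonneg_minorants \<phi>" for \<psi>
  proof -
    note d = nonneg_minorantsD[OF that]
    have "func_support \<psi> \<subseteq> func_support \<phi>"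
    proof (rule func_support_subset)
      fix x assume "x \<notin> func_support \<phi>"
      then show "\<psi> x = 0" using d(2,3)[of x] CcD(3)[OF \<phi>] by simp
    qed (simp add: func_support_def)
    then have "\<bar>\<nu> \<psi>\<bar> \<le> M * (SUP x. \<bar>\<psi> x\<bar>)" using M d(1) by simp
    also have "\<dots> \<le> \<bar>M\<bar> * B"
    proof (rule mult_mono)
      have le: "\<bar>\<psi> x\<bar> \<le> B" for x
        using d(2,3)[of x] B(1) B(2)[of x] by (simp add: max_def split: if_splits)
      show "(SUP x. \<bar>\<psi> x\<bar>) \<le> B"
        by (rule cSUP_least) (use le in auto)
      \<comment> \<open>\<open>undefined\<close> stands for some point of the space; any point shows
        that the supremum is not negative.\<close>
      have "\<bar>\<psi> undefined\<bar> \<le> (SUP x. \<bar>\<psi> x\<bar>)"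
        by (rule cSUP_upper) (use le in \<open>auto intro!: bdd_aboveI2\<close>)
      then show "0 \<le> (SUP x. \<bar>\<psi> x\<bar>)"
        by (rule order_trans[OF abs_ge_zero])
    qed auto
    finally show ?thesis by simp
  qed
  then show "bdd_above (\<nu> ` nonneg_minorants \<phi>)" by (rule bdd_aboveI2)
qed

section \<open>Tensor products\<close>

text \<open>The tube lemma; it supplies uniformity over the compact projection of a support.\<close>

lemma tube_nhds:
  assumes "compact K" "open W" "{x0} \<times> K \<subseteq> W"
  shows "\<exists>X0. x0 \<in> X0 \<and> open X0 \<and> X0 \<times> K \<subseteq> W"
proof -
  have "\<forall>y\<in>K. \<exists>U V. open U \<and> open V \<and> x0 \<in> U \<and> y \<in> V \<and> U \<times> V \<subseteq> W"
    using assms(2,3) by (metis mem_Sigma_iff open_prod_elim singletonI subsetD)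
  then obtain U V where UV: "\<forall>y\<in>K. open (U y) \<and> open (V y) \<and> x0 \<in> U y \<and> y \<in> V y \<and> U y \<times> V y \<subseteq> W"
    by metis
  obtain F where F: "F \<subseteq> K" "finite F" "K \<subseteq> (\<Union>y\<in>F. V y)"
    by (rule compactE_image[OF assms(1), of K V]) (use UV in auto)
  show ?thesis
  proof (intro exI conjI)
    show "x0 \<in> (\<Inter>y\<in>F. U y)" "open (\<Inter>y\<in>F. U y)" "(\<Inter>y\<in>F. U y) \<times> K \<subseteq> W"
      using UV F by (auto intro!: open_INT) blast
  qed
qed

lemma Cc_section:
  fixes f :: "'b::t2_space \<times> 'c::t2_space \<Rightarrow> real"
  assumes "f \<in> Cc"
  shows "(\<lambda>y. f (x, y)) \<in> Cc"
proof (rule CcI)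
  show "continuous_on UNIV (\<lambda>y. f (x, y))"
    using CcD(1)[OF assms] by (rule continuous_on_compose2) (auto intro!: continuous_intros)
  show "compact (snd ` func_support f)"
    using CcD(2)[OF assms] by (intro compact_continuous_image continuous_intros)
  show "f (x, y) = 0" if "y \<notin> snd ` func_support f" for y
    using CcD(3)[OF assms] that by force
qed

text \<open>All sections of \<open>f\<close> live on one compact set, and by the tube lemma nearby
  sections are uniformly close there. The bump function \<xi> converts uniform closeness into
  closeness of the integrals.\<close>

lemma Cc_partial_integral:
  fixes f :: "'b::t2_space \<times> 'c::t2_space \<Rightarrow> real"
  assumes lc: "locally_compact_space (euclidean :: 'c topology)" and "f \<in> Cc" "posfun \<tau>"
  shows "(\<lambda>x. \<tau> (\<lambda>y. f (x, y))) \<in> Cc"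
proof (rule CcI)
  let ?K = "snd ` func_support f"
  have K: "compact ?K"
    using CcD(2)[OF assms(2)] by (intro compact_continuous_image continuous_intros)
  obtain \<xi> where \<xi>: "\<xi> \<in> Cc" "\<And>x. 0 \<le> \<xi> x" "\<And>x. x \<in> ?K \<Longrightarrow> \<xi> x = 1"
    using bump_function[OF lc K open_UNIV] by (metis subset_UNIV)
  have t: "0 \<le> \<tau> \<xi>" using posfun_nonneg[OF assms(3) \<xi>(1,2)] .
  have cf: "continuous_on UNIV f" using CcD(1)[OF assms(2)] .
  have "((\<lambda>x. \<tau> (\<lambda>y. f (x, y))) \<longlongrightarrow> \<tau> (\<lambda>y. f (x0, y))) (nhds x0)" for x0
  proof (rule tendstoI)
    fix e :: real assume e: "0 < e"
    \<comment> \<open>The summand 1 covers the case \<open>\<tau> \<xi> = 0\<close>.\<close>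
    define d where "d = e / (\<tau> \<xi> + 1)"
    have d: "0 < d" "d * \<tau> \<xi> < e"
      using e t by (auto simp: d_def field_simps add_nonneg_pos)
    let ?W = "{p. \<bar>f p - f (x0, snd p)\<bar> < d}"
    have "open ?W"
    proof (rule open_Collect_less)
      show "continuous_on UNIV (\<lambda>p. \<bar>f p - f (x0, snd p)\<bar>)"
        by (intro continuous_intros continuous_on_compose2[OF cf]) auto
    qed auto
    moreover have "{x0} \<times> ?K \<subseteq> ?W" using d by auto
    ultimately have "\<exists>X0. x0 \<in> X0 \<and> open X0 \<and> X0 \<times> ?K \<subseteq> ?W"
      by (rule tube_nhds[OF K])
    then obtain X0 where X0: "x0 \<in> X0" "open X0" "X0 \<times> ?K \<subseteq> ?W" by (elim exE conjE)
    have "dist (\<tau> (\<lambda>y. f (x, y))) (\<tau> (\<lambda>y. f (x0, y))) < e" if "x \<in> X0" for x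
    proof -
      have s: "(\<lambda>y. f (x, y)) \<in> Cc" "(\<lambda>y. f (x0, y)) \<in> Cc" using Cc_section[OF assms(2)] by auto
      have "\<bar>f (x, y) - f (x0, y)\<bar> \<le> d * \<xi> y" for y
      proof (cases "y \<in> ?K")
        case True
        then show ?thesis using X0(3) that \<xi>(3)[OF True] by force
      next
        case False
        then have "f (x, y) = 0" "f (x0, y) = 0" using CcD(3)[OF assms(2)] by force+
        then show ?thesis using d \<xi>(2) by simp
      qed
      then have "\<tau> (\<lambda>y. \<bar>f (x, y) - f (x0, y)\<bar>) \<le> \<tau> (\<lambda>y. d * \<xi> y)"
        using posfun_mono[OF assms(3) Cc_pos(3)[OF Cc_ops(2)[OF s]] Cc_cmult[OF \<xi>(1)]] by simp
      then have "\<bar>\<tau> (\<lambda>y. f (x, y) - f (x0, y))\<bar> \<le> d * \<tau> \<xi>"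
        using posfun_abs[OF assms(3) Cc_ops(2)[OF s]] posfun_cmult[OF assms(3) \<xi>(1)] by simp
      then show ?thesis
        using posfun_diff[OF assms(3) s] d(2) by (simp add: dist_real_def)
    qed
    then show "\<forall>\<^sub>F x in nhds x0. dist (\<tau> (\<lambda>y. f (x, y))) (\<tau> (\<lambda>y. f (x0, y))) < e"
      using X0 unfolding eventually_nhds by blast
  qed
  then show "continuous_on UNIV (\<lambda>x. \<tau> (\<lambda>y. f (x, y)))"
    unfolding continuous_on_def using tendsto_mono[OF at_within_le_nhds] by blast
  show "compact (fst ` func_support f)"
    using CcD(2)[OF assms(2)] by (intro compact_continuous_image continuous_intros)
  show "\<tau> (\<lambda>y. f (x, y)) = 0" if "x \<notin> fst ` func_support f" for x
  proof -
    have "(\<lambda>y. f (x, y)) = (\<lambda>y. 0)" using CcD(3)[OF assms(2)] that by force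
    then show ?thesis using posfun_zero[OF assms(3)] by simp
  qed
qed

lemma tensor_apply: "f \<in> Cc \<Longrightarrow> tensor \<sigma> \<tau> f = \<sigma> (\<lambda>x. \<tau> (\<lambda>y. f (x, y)))"
  by (simp add: tensor_def)

lemma posfun_tensor:
  fixes \<sigma> :: "'b::t2_space functional" and \<tau> :: "'c::t2_space functional"
  assumes lc: "locally_compact_space (euclidean :: 'c topology)" and "posfun \<sigma>" "posfun \<tau>"
  shows "posfun (tensor \<sigma> \<tau>)"
proof -
  have l: "linfun \<sigma>" "linfun \<tau>" using assms by simp_all
  note p = Cc_partial_integral[OF lc _ assms(3)]
  have "linfun (tensor \<sigma> \<tau>)"
    unfolding linfun_def
  proof (intro conjI ballI allI)
    show "tensor \<sigma> \<tau> \<in> extensional Cc"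
      unfolding tensor_def by (rule restrict_extensional)
  next
    fix f g :: "'b \<times> 'c \<Rightarrow> real" assume *: "f \<in> Cc" "g \<in> Cc"
    have "\<tau> (\<lambda>y. f (x, y) + g (x, y)) = \<tau> (\<lambda>y. f (x, y)) + \<tau> (\<lambda>y. g (x, y))" for x
      by (rule linfun_add[OF l(2) Cc_section[OF *(1)] Cc_section[OF *(2)]])
    then show "tensor \<sigma> \<tau> (\<lambda>x. f x + g x) = tensor \<sigma> \<tau> f + tensor \<sigma> \<tau> g"
      using linfun_add[OF l(1) p[OF *(1)] p[OF *(2)]] * by (simp add: tensor_apply)
  next
    fix f :: "'b \<times> 'c \<Rightarrow> real" and c :: real assume *: "f \<in> Cc"
    have "\<tau> (\<lambda>y. c * f (x, y)) = c * \<tau> (\<lambda>y. f (x, y))" for x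
      by (rule linfun_cmult[OF l(2) Cc_section[OF *]])
    then show "tensor \<sigma> \<tau> (\<lambda>x. c * f x) = c * tensor \<sigma> \<tau> f"
      using linfun_cmult[OF l(1) p[OF *]] * by (simp add: tensor_apply)
  qed
  moreover have "0 \<le> tensor \<sigma> \<tau> f" if f: "f \<in> Cc" "\<And>z. 0 \<le> f z" for f
    unfolding tensor_apply[OF f(1)]
    by (rule posfun_nonneg[OF assms(2) p[OF f(1)]], rule posfun_nonneg[OF assms(3) Cc_section[OF f(1)]], rule f(2))
  ultimately show ?thesis
    unfolding posfun_def by blast
qed

context
  fixes \<sigma> \<sigma>' :: "'b::t2_space functional" and \<tau> \<tau>' :: "'c::t2_space functional"
  assumes lc: "locally_compact_space (euclidean :: 'c topology)"
    and p: "posfun \<sigma>" "posfun \<sigma>'" "posfun \<tau>" "posfun \<tau>'"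
begin

lemma tensor_add_left: "tensor (radon_add \<sigma> \<sigma>') \<tau> = radon_add (tensor \<sigma> \<tau>) (tensor \<sigma>' \<tau>)"
proof (rule linfun_eqI)
  fix f :: "'b \<times> 'c \<Rightarrow> real" assume f: "f \<in> Cc"
  then show "tensor (radon_add \<sigma> \<sigma>') \<tau> f = radon_add (tensor \<sigma> \<tau>) (tensor \<sigma>' \<tau>) f"
    using Cc_partial_integral[OF lc f p(3)] by (simp add: tensor_apply)
qed (use p in \<open>auto intro!: posfun_linfun posfun_ops posfun_tensor[OF lc] simp del: posfun_linfun\<close>)

lemma tensor_add_right: "tensor \<sigma> (radon_add \<tau> \<tau>') = radon_add (tensor \<sigma> \<tau>) (tensor \<sigma> \<tau>')"
proof (rule linfun_eqI)
  fix f :: "'b \<times> 'c \<Rightarrow> real" assume f: "f \<in> Cc"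
  then show "tensor \<sigma> (radon_add \<tau> \<tau>') f = radon_add (tensor \<sigma> \<tau>) (tensor \<sigma> \<tau>') f"
    using posfun_add[OF p(1) Cc_partial_integral[OF lc f p(3)] Cc_partial_integral[OF lc f p(4)]]
      Cc_section[OF f] by (simp add: tensor_apply)
qed (use p in \<open>auto intro!: posfun_linfun posfun_ops posfun_tensor[OF lc] simp del: posfun_linfun\<close>)

lemma tensor_scale_left: "0 \<le> c \<Longrightarrow> tensor (radon_scale c \<sigma>) \<tau> = radon_scale c (tensor \<sigma> \<tau>)"
proof (rule linfun_eqI)
  fix f :: "'b \<times> 'c \<Rightarrow> real" assume f: "f \<in> Cc"
  then show "tensor (radon_scale c \<sigma>) \<tau> f = radon_scale c (tensor \<sigma> \<tau>) f"
    using Cc_partial_integral[OF lc f p(3)] by (simp add: tensor_apply)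
qed (use p in \<open>auto intro!: posfun_linfun posfun_ops posfun_tensor[OF lc] simp del: posfun_linfun\<close>)

lemma tensor_scale_right: "0 \<le> c \<Longrightarrow> tensor \<sigma> (radon_scale c \<tau>) = radon_scale c (tensor \<sigma> \<tau>)"
proof (rule linfun_eqI)
  fix f :: "'b \<times> 'c \<Rightarrow> real" assume f: "f \<in> Cc"
  then show "tensor \<sigma> (radon_scale c \<tau>) f = radon_scale c (tensor \<sigma> \<tau>) f"
    using posfun_cmult[OF p(1) Cc_partial_integral[OF lc f p(3)]]
      Cc_section[OF f] by (simp add: tensor_apply)
qed (use p in \<open>auto intro!: posfun_linfun posfun_ops posfun_tensor[OF lc] simp del: posfun_linfun\<close>)

text \<open>Reduces tensor squares of signed measures to positive tensors. Equality is checked by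
  extensionality, since linearity of \<open>tensor\<close> products is established for positive
  factors only.\<close>

lemma tensor_diff_diff:
  "tensor (radon_diff \<sigma> \<sigma>') (radon_diff \<tau> \<tau>') =
    radon_diff (radon_add (tensor \<sigma> \<tau>) (tensor \<sigma>' \<tau>')) (radon_add (tensor \<sigma> \<tau>') (tensor \<sigma>' \<tau>))"
proof -
  have "tensor (radon_diff \<sigma> \<sigma>') (radon_diff \<tau> \<tau>') f =
    radon_diff (radon_add (tensor \<sigma> \<tau>) (tensor \<sigma>' \<tau>')) (radon_add (tensor \<sigma> \<tau>') (tensor \<sigma>' \<tau>)) f"
    if f: "f \<in> Cc" for f
    using posfun_diff[OF p(1) Cc_partial_integral[OF lc f p(3)] Cc_partial_integral[OF lc f p(4)]]
      posfun_diff[OF p(2) Cc_partial_integral[OF lc f p(3)] Cc_partial_integral[OF lc f p(4)]]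
      Cc_section[OF f] f
      Cc_ops(2)[OF Cc_partial_integral[OF lc f p(3)] Cc_partial_integral[OF lc f p(4)]]
    by (simp add: tensor_apply)
  then show ?thesis
    by (intro extensionalityI[of _ Cc]) (auto simp: tensor_def radon_diff_def)
qed

end

section \<open>Integration of lower semicontinuous functions\<close>

lemma pos_integral_upper:
  "\<phi> \<in> Cc \<Longrightarrow> (\<And>x. ereal (\<phi> x) \<le> \<psi> x) \<Longrightarrow> ereal (\<nu> \<phi>) \<le> pos_integral \<nu> \<psi>"
  unfolding pos_integral_def by (rule SUP_upper) simp

lemma pos_integral_least:
  "(\<And>\<phi>. \<phi> \<in> Cc \<Longrightarrow> (\<And>x. ereal (\<phi> x) \<le> \<psi> x) \<Longrightarrow> ereal (\<nu> \<phi>) \<le> B) \<Longrightarrow> pos_integral \<nu> \<psi> \<le> B"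
  unfolding pos_integral_def by (rule SUP_least) simp

text \<open>Keeps every integral above -\<infinity>, on which the later case distinctions rely. On a
  compact space finitely many of the open sets where \<psi> > -n form a cover, and constants have
  compact support.\<close>

lemma Phi_minorant:
  fixes \<psi> :: "'b::t2_space \<Rightarrow> ereal"
  assumes "\<psi> \<in> Phi"
  obtains \<phi> where "\<phi> \<in> Cc" "\<And>x. ereal (\<phi> x) \<le> \<psi> x"
proof (cases "compact (UNIV :: 'b set)")
  case False
  then show thesis
    using assms by (intro that[of "\<lambda>x. 0"]) (auto simp: Phi_def zero_ereal_def[symmetric])
next
  case True
  have op: "open {x. ereal (- real n) < \<psi> x}" for n
    using assms by (simp add: Phi_def)
  have cov: "UNIV \<subseteq> (\<Union>n. {x. ereal (- real n) < \<psi> x})"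
  proof
    fix x
    have "\<psi> x \<noteq> -\<infinity>" using assms by (simp add: Phi_def)
    then show "x \<in> (\<Union>n. {x. ereal (- real n) < \<psi> x})"
    proof (cases "\<psi> x")
      case (real r)
      then show ?thesis using reals_Archimedean2[of "- r"] by (auto simp: minus_less_iff)
    qed auto
  qed
  obtain N where N: "finite N" "UNIV \<subseteq> (\<Union>n\<in>N. {x. ereal (- real n) < \<psi> x})"
    by (rule compactE_image[OF True, of UNIV "\<lambda>n. {x. ereal (- real n) < \<psi> x}"]) (use op cov in auto)
  show thesis
  proof (rule that[of "\<lambda>x. - real (Max (insert 0 N))"])
    show "(\<lambda>x::'b. - real (Max (insert 0 N))) \<in> Cc"
      by (rule CcI[OF _ True]) auto
    fix x
    obtain n where n: "n \<in> N" "ereal (- real n) < \<psi> x" using N(2) by auto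
    have "n \<le> Max (insert 0 N)" using n(1) N(1) by simp
    then have "ereal (- real (Max (insert 0 N))) \<le> ereal (- real n)" by simp
    then show "ereal (- real (Max (insert 0 N))) \<le> \<psi> x"
      using n(2) by (metis less_imp_le order_trans)
  qed
qed

lemma pos_integral_not_MInf:
  fixes \<psi> :: "'b::t2_space \<Rightarrow> ereal"
  assumes "\<psi> \<in> Phi"
  shows "pos_integral \<nu> \<psi> \<noteq> -\<infinity>"
proof -
  obtain \<phi> where "\<phi> \<in> Cc" "\<And>x. ereal (\<phi> x) \<le> \<psi> x" by (rule Phi_minorant[OF assms]) blast
  then have "ereal (\<nu> \<phi>) \<le> pos_integral \<nu> \<psi>" by (rule pos_integral_upper)
  then show ?thesis by auto
qed

lemma pos_integral_zero:
  fixes \<psi> :: "'b::t2_space \<Rightarrow> ereal"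
  assumes "\<psi> \<in> Phi"
  shows "pos_integral (\<lambda>\<phi>\<in>Cc. 0) \<psi> = 0"
proof -
  obtain \<phi> where \<phi>: "\<phi> \<in> Cc" "\<And>x. ereal (\<phi> x) \<le> \<psi> x" by (rule Phi_minorant[OF assms]) blast
  show ?thesis
  proof (rule antisym)
    show "pos_integral (\<lambda>\<phi>\<in>Cc. 0) \<psi> \<le> 0" by (rule pos_integral_least) simp
    show "0 \<le> pos_integral (\<lambda>\<phi>\<in>Cc. 0) \<psi>"
      using pos_integral_upper[OF \<phi>, of "\<lambda>\<phi>\<in>Cc. 0"] \<phi>(1) by (simp add: zero_ereal_def)
  qed
qed

text \<open>Different minorants may be good for \<sigma> and for \<tau>; their maximum is again a
  minorant and serves both. The rest is care with infinite values.\<close>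

lemma pos_integral_add:
  fixes \<psi> :: "'b::t2_space \<Rightarrow> ereal"
  assumes "posfun \<sigma>" "posfun \<tau>" "\<psi> \<in> Phi"
  shows "pos_integral (radon_add \<sigma> \<tau>) \<psi> = pos_integral \<sigma> \<psi> + pos_integral \<tau> \<psi>"
proof (rule antisym)
  show "pos_integral (radon_add \<sigma> \<tau>) \<psi> \<le> pos_integral \<sigma> \<psi> + pos_integral \<tau> \<psi>"
  proof (rule pos_integral_least)
    fix \<phi> assume \<phi>: "\<phi> \<in> Cc" "\<And>x. ereal (\<phi> x) \<le> \<psi> x"
    show "ereal (radon_add \<sigma> \<tau> \<phi>) \<le> pos_integral \<sigma> \<psi> + pos_integral \<tau> \<psi>"
      using add_mono[OF pos_integral_upper[OF \<phi>, of \<sigma>] pos_integral_upper[OF \<phi>, of \<tau>]] \<phi>(1) by simp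
  qed
  let ?L = "pos_integral (radon_add \<sigma> \<tau>) \<psi>"
  have *: "ereal (\<sigma> \<phi>) + ereal (\<tau> \<phi>') \<le> ?L"
    if \<phi>: "\<phi> \<in> Cc" "\<And>x. ereal (\<phi> x) \<le> \<psi> x" and \<phi>': "\<phi>' \<in> Cc" "\<And>x. ereal (\<phi>' x) \<le> \<psi> x" for \<phi> \<phi>'
  proof -
    let ?m = "\<lambda>x. max (\<phi> x) (\<phi>' x)"
    have m: "?m \<in> Cc" using \<phi>(1) \<phi>'(1) by simp
    have "\<sigma> \<phi> \<le> \<sigma> ?m" by (rule posfun_mono[OF assms(1) \<phi>(1) m]) simp
    moreover have "\<tau> \<phi>' \<le> \<tau> ?m" by (rule posfun_mono[OF assms(2) \<phi>'(1) m]) simp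
    ultimately have "ereal (\<sigma> \<phi>) + ereal (\<tau> \<phi>') \<le> ereal (radon_add \<sigma> \<tau> ?m)" using m by simp
    also have "\<dots> \<le> ?L"
      by (rule pos_integral_upper[OF m]) (use \<phi>(2) \<phi>'(2) in \<open>simp add: max_def\<close>)
    finally show ?thesis .
  qed
  show "pos_integral \<sigma> \<psi> + pos_integral \<tau> \<psi> \<le> ?L"
  proof (cases "?L = \<infinity>")
    case False
    have 1: "pos_integral \<sigma> \<psi> + ereal (\<tau> \<phi>') \<le> ?L" if \<phi>': "\<phi>' \<in> Cc" "\<And>x. ereal (\<phi>' x) \<le> \<psi> x" for \<phi>'
    proof -
      have "pos_integral \<sigma> \<psi> \<le> ?L - ereal (\<tau> \<phi>')"
        by (rule pos_integral_least) (use *[OF _ _ \<phi>'] in \<open>simp add: ereal_le_minus\<close>)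
      then show ?thesis by (simp add: ereal_le_minus)
    qed
    obtain \<phi> where \<phi>: "\<phi> \<in> Cc" "\<And>x. ereal (\<phi> x) \<le> \<psi> x" by (rule Phi_minorant[OF assms(3)]) blast
    have fin: "\<bar>pos_integral \<sigma> \<psi>\<bar> \<noteq> \<infinity>"
      using 1[OF \<phi>] False pos_integral_not_MInf[OF assms(3), of \<sigma>] by auto
    have "pos_integral \<tau> \<psi> \<le> ?L - pos_integral \<sigma> \<psi>"
      by (rule pos_integral_least) (use 1 fin in \<open>simp add: ereal_le_minus add.commute\<close>)
    then show ?thesis using fin by (simp add: ereal_le_minus add.commute)
  qed simp
qed

lemma pos_integral_scale:
  fixes \<psi> :: "'b::t2_space \<Rightarrow> ereal"
  assumes "0 < c" "\<psi> \<in> Phi"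
  shows "pos_integral (radon_scale c \<sigma>) \<psi> = ereal c * pos_integral \<sigma> \<psi>"
proof (rule antisym)
  show "pos_integral (radon_scale c \<sigma>) \<psi> \<le> ereal c * pos_integral \<sigma> \<psi>"
  proof (rule pos_integral_least)
    fix \<phi> assume \<phi>: "\<phi> \<in> Cc" "\<And>x. ereal (\<phi> x) \<le> \<psi> x"
    show "ereal (radon_scale c \<sigma> \<phi>) \<le> ereal c * pos_integral \<sigma> \<psi>"
      using ereal_mult_left_mono[OF pos_integral_upper[OF \<phi>, of \<sigma>], of "ereal c"] \<phi>(1) assms(1) by simp
  qed
  have "pos_integral \<sigma> \<psi> \<le> pos_integral (radon_scale c \<sigma>) \<psi> / ereal c"
  proof (rule pos_integral_least)
    fix \<phi> assume \<phi>: "\<phi> \<in> Cc" "\<And>x. ereal (\<phi> x) \<le> \<psi> x"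
    have "ereal c * ereal (\<sigma> \<phi>) \<le> pos_integral (radon_scale c \<sigma>) \<psi>"
      using pos_integral_upper[OF \<phi>, of "radon_scale c \<sigma>"] \<phi>(1) by simp
    then show "ereal (\<sigma> \<phi>) \<le> pos_integral (radon_scale c \<sigma>) \<psi> / ereal c"
      using assms(1) by (subst ereal_le_divide_pos) auto
  qed
  then show "ereal c * pos_integral \<sigma> \<psi> \<le> pos_integral (radon_scale c \<sigma>) \<psi>"
    using assms(1) by (subst (asm) ereal_le_divide_pos) auto
qed

text \<open>On a compact space the integrand may be negative, so domination is recorded through the
  complement \<rho>: finiteness always passes to \<sigma>, the inequality of integrals only for
  \<psi> \<ge> 0.\<close>

lemma pos_integral_dominated:
  fixes \<psi> :: "'b::t2_space \<Rightarrow> ereal"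
  assumes "posfun \<sigma>" "posfun \<tau>" "\<psi> \<in> Phi"
    and "\<And>\<phi>. \<phi> \<in> Cc \<Longrightarrow> (\<And>x. 0 \<le> \<phi> x) \<Longrightarrow> \<sigma> \<phi> \<le> \<tau> \<phi>"
  shows "\<exists>\<rho>. posfun \<rho> \<and> \<tau> = radon_add \<sigma> \<rho> \<and> pos_integral \<tau> \<psi> = pos_integral \<sigma> \<psi> + pos_integral \<rho> \<psi>"
proof -
  let ?\<rho> = "radon_diff \<tau> \<sigma>"
  have \<rho>: "posfun ?\<rho>" using assms by (simp add: posfun_def[of ?\<rho>])
  moreover have eq: "\<tau> = radon_add \<sigma> ?\<rho>"
    by (rule linfun_eqI) (use assms \<rho> in auto)
  moreover have "pos_integral (radon_add \<sigma> ?\<rho>) \<psi> = pos_integral \<sigma> \<psi> + pos_integral ?\<rho> \<psi>"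
    by (rule pos_integral_add[OF assms(1) \<rho> assms(3)])
  ultimately show ?thesis by metis
qed

lemma pos_integral_dominated_finite:
  fixes \<psi> :: "'b::t2_space \<Rightarrow> ereal"
  assumes "posfun \<sigma>" "posfun \<tau>" "\<psi> \<in> Phi"
    and "\<And>\<phi>. \<phi> \<in> Cc \<Longrightarrow> (\<And>x. 0 \<le> \<phi> x) \<Longrightarrow> \<sigma> \<phi> \<le> \<tau> \<phi>"
    and "pos_integral \<tau> \<psi> \<noteq> \<infinity>"
  shows "pos_integral \<sigma> \<psi> \<noteq> \<infinity>"
proof -
  obtain \<rho> where \<rho>: "pos_integral \<tau> \<psi> = pos_integral \<sigma> \<psi> + pos_integral \<rho> \<psi>"
    using pos_integral_dominated[OF assms(1-4)] by blast
  show ?thesis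
    using \<rho> assms(5) pos_integral_not_MInf[OF assms(3), of \<rho>] by auto
qed

lemma pos_integral_dominated_mono:
  fixes \<psi> :: "'b::t2_space \<Rightarrow> ereal"
  assumes "posfun \<sigma>" "posfun \<tau>" "\<psi> \<in> Phi" "\<And>x. 0 \<le> \<psi> x"
    and "\<And>\<phi>. \<phi> \<in> Cc \<Longrightarrow> (\<And>x. 0 \<le> \<phi> x) \<Longrightarrow> \<sigma> \<phi> \<le> \<tau> \<phi>"
  shows "pos_integral \<sigma> \<psi> \<le> pos_integral \<tau> \<psi>"
proof -
  obtain \<rho> where \<rho>: "posfun \<rho>" "pos_integral \<tau> \<psi> = pos_integral \<sigma> \<psi> + pos_integral \<rho> \<psi>"
    using pos_integral_dominated[OF assms(1-3,5)] by blast
  have "ereal (\<rho> (\<lambda>x. 0)) \<le> pos_integral \<rho> \<psi>"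
    by (rule pos_integral_upper) (use assms(4) in \<open>auto simp: zero_ereal_def[symmetric]\<close>)
  then have "0 \<le> pos_integral \<rho> \<psi>"
    using linfun_zero[of \<rho>] \<rho>(1) by (simp add: zero_ereal_def)
  then show ?thesis
    using \<rho>(2) by (simp add: add_increasing2)
qed

section \<open>Signed integrals of differences of positive functionals\<close>

context
  fixes \<sigma> \<tau> :: "'b::t2_space functional" and \<psi> :: "'b \<Rightarrow> ereal"
  assumes p: "posfun \<sigma>" "posfun \<tau>" and Phi: "\<psi> \<in> Phi"
begin

text \<open>\<open>T\<^sup>+ + \<tau> = T\<^sup>- + \<sigma>\<close> for \<open>T = \<sigma> - \<tau>\<close>, integrated; no subtraction of infinities occurs.\<close>

lemma jordan_integrals:
  "pos_integral (pos_part (radon_diff \<sigma> \<tau>)) \<psi> + pos_integral \<tau> \<psi> =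
   pos_integral (neg_part (radon_diff \<sigma> \<tau>)) \<psi> + pos_integral \<sigma> \<psi>"
proof -
  let ?T = "radon_diff \<sigma> \<tau>"
  have ob: "order_bounded ?T" by (rule order_bounded_radon_diff(1)[OF p])
  note pp = posfun_pos_part[OF ob] posfun_neg_part[OF ob]
  have "radon_add (pos_part ?T) \<tau> = radon_add (neg_part ?T) \<sigma>"
  proof (rule linfun_eqI)
    fix \<phi> :: "'b \<Rightarrow> real" assume \<phi>: "\<phi> \<in> Cc"
    have "?T \<phi> = radon_diff (pos_part ?T) (neg_part ?T) \<phi>"
      using jordan_decomposition[OF ob] by simp
    then show "radon_add (pos_part ?T) \<tau> \<phi> = radon_add (neg_part ?T) \<sigma> \<phi>"
      using \<phi> by simp
  qed (use p pp in auto)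
  then show ?thesis
    using pos_integral_add[OF pp(1) p(2) Phi] pos_integral_add[OF pp(2) p(1) Phi] by simp
qed

lemma pos_part_integral_finite:
  assumes "pos_integral \<sigma> \<psi> \<noteq> \<infinity>"
  shows "pos_integral (pos_part (radon_diff \<sigma> \<tau>)) \<psi> \<noteq> \<infinity>"
  by (rule pos_integral_dominated_finite[OF posfun_pos_part[OF order_bounded_radon_diff(1)[OF p]] p(1) Phi
        order_bounded_radon_diff(2)[OF p] assms])

text \<open>The value -\<infinity> counts as defined; this is how positive definiteness will exclude
  infinite mutual energies.\<close>

lemma signed_integral_MInf:
  assumes "pos_integral \<sigma> \<psi> \<noteq> \<infinity>" "pos_integral \<tau> \<psi> = \<infinity>"
  shows "integral_defined (radon_diff \<sigma> \<tau>) \<psi>" "signed_integral (radon_diff \<sigma> \<tau>) \<psi> = -\<infinity>"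
  using pos_part_integral_finite[OF assms(1)] jordan_integrals assms
    pos_integral_not_MInf[OF Phi, of "pos_part (radon_diff \<sigma> \<tau>)"]
    pos_integral_not_MInf[OF Phi, of "neg_part (radon_diff \<sigma> \<tau>)"]
  by (cases "pos_integral (pos_part (radon_diff \<sigma> \<tau>)) \<psi>";
      auto simp: integral_defined_def signed_integral_def)+

lemma signed_integral_diff:
  assumes "pos_integral \<sigma> \<psi> \<noteq> \<infinity>" "pos_integral \<tau> \<psi> \<noteq> \<infinity>"
  shows "integral_defined (radon_diff \<sigma> \<tau>) \<psi>"
    "signed_integral (radon_diff \<sigma> \<tau>) \<psi> =
      ereal (real_of_ereal (pos_integral \<sigma> \<psi>) - real_of_ereal (pos_integral \<tau> \<psi>))"
proof -
  show "integral_defined (radon_diff \<sigma> \<tau>) \<psi>"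
    using pos_part_integral_finite[OF assms(1)] by (simp add: integral_defined_def)
  obtain s t where st: "pos_integral \<sigma> \<psi> = ereal s" "pos_integral \<tau> \<psi> = ereal t"
    using assms pos_integral_not_MInf[OF Phi] by (metis ereal_cases)
  obtain u where u: "pos_integral (pos_part (radon_diff \<sigma> \<tau>)) \<psi> = ereal u"
    using pos_part_integral_finite[OF assms(1)] pos_integral_not_MInf[OF Phi] by (metis ereal_cases)
  have eq: "ereal u + ereal t = pos_integral (neg_part (radon_diff \<sigma> \<tau>)) \<psi> + ereal s"
    using jordan_integrals st u by simp
  then obtain v where "pos_integral (neg_part (radon_diff \<sigma> \<tau>)) \<psi> = ereal v" "u + t = v + s"
    by (cases "pos_integral (neg_part (radon_diff \<sigma> \<tau>)) \<psi>") auto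
  then show "signed_integral (radon_diff \<sigma> \<tau>) \<psi> =
      ereal (real_of_ereal (pos_integral \<sigma> \<psi>) - real_of_ereal (pos_integral \<tau> \<psi>))"
    using st u by (simp add: signed_integral_def)
qed

text \<open>The second claim uses that, in \<open>jordan_integrals\<close>, finiteness of three
  integrals forces the fourth to be finite. It will separate the energies of the two charges of a
  condenser.\<close>

lemma finite_signed_integral:
  assumes "integral_defined (radon_diff \<sigma> \<tau>) \<psi>" "\<bar>signed_integral (radon_diff \<sigma> \<tau>) \<psi>\<bar> \<noteq> \<infinity>"
  shows "pos_integral (pos_part (radon_diff \<sigma> \<tau>)) \<psi> \<noteq> \<infinity>"
    and "pos_integral \<tau> \<psi> \<noteq> \<infinity> \<Longrightarrow> pos_integral \<sigma> \<psi> \<noteq> \<infinity>"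
proof -
  let ?p = "pos_integral (pos_part (radon_diff \<sigma> \<tau>)) \<psi>" and ?n = "pos_integral (neg_part (radon_diff \<sigma> \<tau>)) \<psi>"
  have "?p \<noteq> -\<infinity>" "?n \<noteq> -\<infinity>" using pos_integral_not_MInf[OF Phi] by auto
  then have fin: "?p \<noteq> \<infinity>" "?n \<noteq> \<infinity>" "?p \<noteq> -\<infinity>" "?n \<noteq> -\<infinity>"
    using assms unfolding integral_defined_def signed_integral_def by (cases ?p; cases ?n; simp)+
  then show "?p \<noteq> \<infinity>" by simp
  assume "pos_integral \<tau> \<psi> \<noteq> \<infinity>"
  then show "pos_integral \<sigma> \<psi> \<noteq> \<infinity>"
    using jordan_integrals fin by (cases ?p; cases ?n; cases "pos_integral \<tau> \<psi>") auto
qed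

end

section \<open>Continuous minorants of the kernel and integrals of potentials\<close>

lemma kernel_section_minorant:
  fixes \<kappa> :: "'b::t2_space \<times> 'c::t2_space \<Rightarrow> ereal"
  assumes lcb: "locally_compact_space (euclidean :: 'b topology)"
    and lcc: "locally_compact_space (euclidean :: 'c topology)"
    and \<kappa>: "\<kappa> \<in> Phi" "\<And>z. 0 \<le> \<kappa> z" and \<tau>: "posfun \<tau>"
    and c: "ereal c < pos_integral \<tau> (\<lambda>y. \<kappa> (x, y))"
  shows "\<exists>f\<in>Cc. (\<forall>z. 0 \<le> f z \<and> ereal (f z) \<le> \<kappa> z) \<and> c < \<tau> (\<lambda>y. f (x, y))"
proof -
  obtain \<phi>0 where \<phi>0: "\<phi>0 \<in> Cc" "\<And>y. ereal (\<phi>0 y) \<le> \<kappa> (x, y)" "ereal c < ereal (\<tau> \<phi>0)"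
    using c unfolding pos_integral_def less_SUP_iff by auto
  define \<phi> where "\<phi> = (\<lambda>y. max (\<phi>0 y) 0)"
  have \<phi>: "\<phi> \<in> Cc" unfolding \<phi>_def using \<phi>0(1) by simp
  have \<phi>_nonneg: "0 \<le> \<phi> y" for y by (simp add: \<phi>_def)
  have \<phi>_le: "ereal (\<phi> y) \<le> \<kappa> (x, y)" for y
    unfolding \<phi>_def using \<phi>0(2)[of y] \<kappa>(2)[of "(x, y)"] by (simp add: max_def zero_ereal_def)
  have "\<tau> \<phi>0 \<le> \<tau> \<phi>" by (rule posfun_mono[OF \<tau> \<phi>0(1) \<phi>]) (simp add: \<phi>_def)
  then have c\<phi>: "c < \<tau> \<phi>" using \<phi>0(3) by simp
  let ?S = "func_support \<phi>"
  have S: "compact ?S" using CcD(2)[OF \<phi>] .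
  obtain \<xi> where \<xi>: "\<xi> \<in> Cc" "\<And>y. 0 \<le> \<xi> y" "\<And>y. y \<in> ?S \<Longrightarrow> \<xi> y = 1"
    using bump_function[OF lcc S open_UNIV] by (metis subset_UNIV)
  have \<tau>\<xi>: "0 \<le> \<tau> \<xi>" by (rule posfun_nonneg[OF \<tau> \<xi>(1,2)])
  \<comment> \<open>Lowering \<phi> by \<open>d\<close> costs at most
    \<open>d * \<tau> \<xi>\<close>, which is less than the margin \<tau> \<phi> - c.\<close>
  define d where "d = (\<tau> \<phi> - c) / (\<tau> \<xi> + 1)"
  have d: "0 < d" using c\<phi> \<tau>\<xi> by (simp add: d_def add_nonneg_pos)
  have d\<xi>: "d * \<tau> \<xi> < \<tau> \<phi> - c"
  proof -
    have "d * \<tau> \<xi> < d * (\<tau> \<xi> + 1)" using d by simp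
    also have "\<dots> = \<tau> \<phi> - c" using \<tau>\<xi> by (simp add: d_def add_nonneg_pos)
    finally show ?thesis .
  qed
  \<comment> \<open>The set where \<phi> - d lies below \<kappa>, split over real levels
    \<open>r\<close> because \<open>Phi\<close> provides openness for constant levels.\<close>
  define W where "W = (\<Union>r. {z. ereal r < \<kappa> z} \<inter> {z. \<phi> (snd z) - d < r})"
  have "open W"
    unfolding W_def
  proof (intro open_UN ballI open_Int)
    fix r :: real
    show "open {z. ereal r < \<kappa> z}" using \<kappa>(1) by (simp add: Phi_def)
    show "open {z :: 'b \<times> 'c. \<phi> (snd z) - d < r}"
      by (intro open_Collect_less continuous_intros continuous_on_compose2[OF CcD(1)[OF \<phi>]]) auto
  qed
  moreover have "{x} \<times> ?S \<subseteq> W"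
  proof
    fix z assume z: "z \<in> {x} \<times> ?S"
    have "ereal (\<phi> (snd z) - d / 2) < ereal (\<phi> (snd z))" using d by simp
    also have "\<dots> \<le> \<kappa> z" using \<phi>_le[of "snd z"] z by auto
    finally have "ereal (\<phi> (snd z) - d / 2) < \<kappa> z" .
    then show "z \<in> W" unfolding W_def using d by (auto intro!: exI[of _ "\<phi> (snd z) - d / 2"])
  qed
  ultimately have "\<exists>X0. x \<in> X0 \<and> open X0 \<and> X0 \<times> ?S \<subseteq> W" by (rule tube_nhds[OF S])
  then obtain U where U: "x \<in> U" "open U" "U \<times> ?S \<subseteq> W" by (elim exE conjE)
  have sU: "{x} \<subseteq> U" using U by simp
  obtain \<eta> where \<eta>: "\<eta> \<in> Cc" "\<And>x. 0 \<le> \<eta> x" "\<And>x. \<eta> x \<le> 1" "\<eta> x = 1" "func_support \<eta> \<subseteq> U"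
    using bump_function[OF lcb compact_sing U(2) sU] by (metis singletonI)
  \<comment> \<open>Over \<open>U\<close> and the support of \<phi> the kernel exceeds \<phi> - d;
    the factor \<eta> confines the function to \<open>U\<close> and is 1 at
    \<open>x\<close>.\<close>
  define f where "f = (\<lambda>z. \<eta> (fst z) * max (\<phi> (snd z) - d) 0)"
  have f: "f \<in> Cc"
  proof (rule CcI)
    show "continuous_on UNIV f"
      unfolding f_def
      by (intro continuous_intros continuous_on_compose2[OF CcD(1)[OF \<phi>]] continuous_on_compose2[OF CcD(1)[OF \<eta>(1)]]) auto
    show "compact (func_support \<eta> \<times> ?S)" by (intro compact_Times CcD(2) \<eta>(1) \<phi>)
    show "f z = 0" if "z \<notin> func_support \<eta> \<times> ?S" for z
      using that CcD(3)[OF \<phi>, of "snd z"] CcD(3)[OF \<eta>(1), of "fst z"] d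
      by (cases z) (auto simp: f_def)
  qed
  have f0: "0 \<le> f z" for z unfolding f_def using \<eta>(2) by simp
  have f\<kappa>: "ereal (f z) \<le> \<kappa> z" for z
  proof (cases "f z = 0")
    case True
    then show ?thesis using \<kappa>(2) by (simp add: zero_ereal_def)
  next
    case False
    then have nz: "\<eta> (fst z) \<noteq> 0" "0 < \<phi> (snd z) - d" by (auto simp: f_def max_def split: if_splits)
    have "fst z \<in> U" using nz(1) CcD(3)[OF \<eta>(1), of "fst z"] \<eta>(5) by auto
    moreover have "snd z \<in> ?S" using nz(2) d CcD(3)[OF \<phi>, of "snd z"] by auto
    ultimately have "z \<in> W" using U(3) by (cases z) auto
    then obtain r where r: "ereal r < \<kappa> z" "\<phi> (snd z) - d < r" unfolding W_def by auto
    have "f z \<le> \<phi> (snd z) - d"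
      unfolding f_def using nz(2) \<eta>(2,3)[of "fst z"] by (simp add: max_def mult_left_le_one_le)
    then have "ereal (f z) \<le> ereal r" using r(2) by simp
    then show ?thesis using r(1) by (metis less_imp_le order_trans)
  qed
  have "\<tau> (\<lambda>y. \<phi> y - d * \<xi> y) \<le> \<tau> (\<lambda>y. f (x, y))"
  proof (rule posfun_mono[OF \<tau> _ Cc_section[OF f]])
    show "(\<lambda>y. \<phi> y - d * \<xi> y) \<in> Cc" using \<phi> \<xi>(1) by simp
    fix y show "\<phi> y - d * \<xi> y \<le> f (x, y)"
      using CcD(3)[OF \<phi>, of y] \<xi>(2,3)[of y] d \<eta>(4) f0[of "(x, y)"]
      by (cases "y \<in> ?S") (auto simp: f_def)
  qed
  moreover have "\<tau> (\<lambda>y. \<phi> y - d * \<xi> y) = \<tau> \<phi> - d * \<tau> \<xi>"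
    using posfun_diff[OF \<tau> \<phi> Cc_cmult[OF \<xi>(1)]] posfun_cmult[OF \<tau> \<xi>(1)] by simp
  ultimately have "c < \<tau> (\<lambda>y. f (x, y))" using d\<xi> by simp
  then show ?thesis using f f0 f\<kappa> by blast
qed

text \<open>Lower semicontinuity of the potential against a moving level: near \<open>x\<close> it
  is bounded below by the partial integral of a minorant, which is continuous. The level varies
  because potentials will be compared with powers of g.\<close>

lemma open_potential_greater:
  fixes \<kappa> :: "'b::t2_space \<times> 'c::t2_space \<Rightarrow> ereal"
  assumes lcb: "locally_compact_space (euclidean :: 'b topology)"
    and lcc: "locally_compact_space (euclidean :: 'c topology)"
    and \<kappa>: "\<kappa> \<in> Phi" "\<And>z. 0 \<le> \<kappa> z" and \<tau>: "posfun \<tau>" and h: "continuous_on UNIV h"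
  shows "open {x. ereal (h x) < pos_integral \<tau> (\<lambda>y. \<kappa> (x, y))}"
proof (subst open_subopen, safe)
  fix x assume "ereal (h x) < pos_integral \<tau> (\<lambda>y. \<kappa> (x, y))"
  from kernel_section_minorant[OF lcb lcc \<kappa> \<tau> this]
  obtain f where f: "f \<in> Cc" "\<And>z. ereal (f z) \<le> \<kappa> z" "h x < \<tau> (\<lambda>y. f (x, y))" by blast
  let ?U = "{x. h x < \<tau> (\<lambda>y. f (x, y))}"
  have "open ?U"
    by (rule open_Collect_less[OF h CcD(1)[OF Cc_partial_integral[OF lcc f(1) \<tau>]]])
  moreover have "?U \<subseteq> {x. ereal (h x) < pos_integral \<tau> (\<lambda>y. \<kappa> (x, y))}"
  proof safe
    fix x' assume "h x' < \<tau> (\<lambda>y. f (x', y))"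
    then have "ereal (h x') < ereal (\<tau> (\<lambda>y. f (x', y)))" by simp
    also have "\<dots> \<le> pos_integral \<tau> (\<lambda>y. \<kappa> (x', y))"
      by (rule pos_integral_upper[OF Cc_section[OF f(1)] f(2)])
    finally show "ereal (h x') < pos_integral \<tau> (\<lambda>y. \<kappa> (x', y))" .
  qed
  ultimately show "\<exists>T. open T \<and> x \<in> T \<and> T \<subseteq> {x. ereal (h x) < pos_integral \<tau> (\<lambda>y. \<kappa> (x, y))}"
    using f(3) by blast
qed

text \<open>One half of Tonelli's theorem, by a Dini argument on the compact support of \<open>\<phi>\<close>.\<close>

lemma integral_potential_le:
  fixes \<kappa> :: "'b::t2_space \<times> 'c::t2_space \<Rightarrow> ereal"
  assumes lcb: "locally_compact_space (euclidean :: 'b topology)"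
    and lcc: "locally_compact_space (euclidean :: 'c topology)"
    and \<kappa>: "\<kappa> \<in> Phi" "\<And>z. 0 \<le> \<kappa> z" and \<tau>: "posfun \<tau>"
    and \<sigma>: "posfun \<sigma>" "meas_support \<sigma> \<subseteq> E" "closed E"
    and \<phi>: "\<phi> \<in> Cc" "\<And>x. x \<in> E \<Longrightarrow> ereal (\<phi> x) \<le> pos_integral \<tau> (\<lambda>y. \<kappa> (x, y))"
  shows "ereal (\<sigma> \<phi>) \<le> pos_integral (tensor \<sigma> \<tau>) \<kappa>"
proof -
  let ?I = "pos_integral (tensor \<sigma> \<tau>) \<kappa>"
  let ?S = "func_support \<phi>"
  obtain \<xi> where \<xi>: "\<xi> \<in> Cc" "\<And>y. 0 \<le> \<xi> y" "\<And>y. y \<in> ?S \<Longrightarrow> \<xi> y = 1"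
    using bump_function[OF lcb CcD(2)[OF \<phi>(1)] open_UNIV] by (metis subset_UNIV)
  have *: "ereal (\<sigma> \<phi> - e * \<sigma> \<xi>) \<le> ?I" if e: "0 < e" for e
  proof -
    define good where "good = (\<lambda>f. f \<in> Cc \<and> (\<forall>z. 0 \<le> f z \<and> ereal (f z) \<le> \<kappa> z))"
    have "\<forall>x\<in>?S \<inter> E. \<exists>f. good f \<and> \<phi> x - e < \<tau> (\<lambda>y. f (x, y))"
    proof
      fix x assume "x \<in> ?S \<inter> E"
      then have "ereal (\<phi> x - e) < pos_integral \<tau> (\<lambda>y. \<kappa> (x, y))"
        using \<phi>(2)[of x] e by (metis IntD2 diff_less_eq ereal_less(2) less_add_same_cancel1 less_ereal.simps(1) order_less_le_trans)
      from kernel_section_minorant[OF lcb lcc \<kappa> \<tau> this]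
      show "\<exists>f. good f \<and> \<phi> x - e < \<tau> (\<lambda>y. f (x, y))" unfolding good_def by blast
    qed
    then obtain f where f: "\<forall>x\<in>?S \<inter> E. good (f x) \<and> \<phi> x - e < \<tau> (\<lambda>y. f x (x, y))"
      by (rule bchoice[THEN exE])
    let ?U = "\<lambda>x. {x'. \<phi> x' - e < \<tau> (\<lambda>y. f x (x', y))}"
    have op: "open (?U x)" if "x \<in> ?S \<inter> E" for x
    proof -
      have "f x \<in> Cc" using f that unfolding good_def by blast
      from CcD(1)[OF Cc_partial_integral[OF lcc this \<tau>]] show ?thesis
        by (intro open_Collect_less) (use CcD(1)[OF \<phi>(1)] in \<open>auto intro!: continuous_intros\<close>)
    qed
    have cK: "compact (?S \<inter> E)" using CcD(2)[OF \<phi>(1)] \<sigma>(3) by (rule compact_Int_closed)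
    obtain F where F: "F \<subseteq> ?S \<inter> E" "finite F" "?S \<inter> E \<subseteq> (\<Union>x\<in>F. ?U x)"
      by (rule compactE_image[OF cK, of "?S \<inter> E" ?U]) (use op f in auto)
    \<comment> \<open>Minorants are closed under maxima, so the finitely many local ones merge into
      a single \<open>g\<close>.\<close>
    have "\<exists>g. good g \<and> (\<forall>x\<in>F'. \<forall>z. f x z \<le> g z)" if "F' \<subseteq> ?S \<inter> E" "finite F'" for F'
      using that(2,1)
    proof (induction F')
      case empty
      have "good (\<lambda>z. 0)" using \<kappa>(2) by (simp add: good_def zero_ereal_def[symmetric])
      then show ?case by blast
    next
      case (insert x F')
      then obtain g where g: "good g" "\<forall>x\<in>F'. \<forall>z. f x z \<le> g z" by auto
      have fx: "good (f x)" using insert f by blast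
      have "good (\<lambda>z. max (f x z) (g z))"
        using g(1) fx Cc_ops(4)[of "f x" g] unfolding good_def by (simp add: max_def)
      moreover have "\<forall>x'\<in>insert x F'. \<forall>z. f x' z \<le> max (f x z) (g z)"
        using g(2) by (auto simp: le_max_iff_disj)
      ultimately show ?case by blast
    qed
    from this[OF F(1,2)] obtain g where g: "good g" "\<forall>x\<in>F. \<forall>z. f x z \<le> g z" by blast
    have gC: "g \<in> Cc" "\<And>z. 0 \<le> g z" "\<And>z. ereal (g z) \<le> \<kappa> z" using g(1) by (auto simp: good_def)
    have "\<sigma> (\<lambda>x. \<phi> x - e * \<xi> x) \<le> \<sigma> (\<lambda>x. \<tau> (\<lambda>y. g (x, y)))"
    proof (rule posfun_mono_on_support[OF lcb \<sigma>(1,2) _ Cc_partial_integral[OF lcc gC(1) \<tau>]])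
      show "(\<lambda>x. \<phi> x - e * \<xi> x) \<in> Cc" using \<phi>(1) \<xi>(1) by simp
      fix x assume x: "x \<in> E"
      show "\<phi> x - e * \<xi> x \<le> \<tau> (\<lambda>y. g (x, y))"
      proof (cases "x \<in> ?S")
        case True
        then obtain x' where x': "x' \<in> F" "\<phi> x - e < \<tau> (\<lambda>y. f x' (x, y))" using F(3) x by auto
        have "f x' \<in> Cc" using x' F(1) f unfolding good_def by blast
        then have "\<tau> (\<lambda>y. f x' (x, y)) \<le> \<tau> (\<lambda>y. g (x, y))"
          using posfun_mono[OF \<tau> Cc_section Cc_section[OF gC(1)], of "f x'" x x] g(2) x'(1) by simp
        then show ?thesis using x' \<xi>(3)[OF True] by simp
      next
        case False
        have "0 \<le> \<tau> (\<lambda>y. g (x, y))" by (rule posfun_nonneg[OF \<tau> Cc_section[OF gC(1)] gC(2)])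
        moreover have "0 \<le> e * \<xi> x" using e \<xi>(2)[of x] by simp
        ultimately show ?thesis using CcD(3)[OF \<phi>(1) False] by simp
      qed
    qed
    also have "\<dots> = tensor \<sigma> \<tau> g" using gC(1) by (simp add: tensor_apply)
    finally have "\<sigma> \<phi> - e * \<sigma> \<xi> \<le> tensor \<sigma> \<tau> g"
      using posfun_diff[OF \<sigma>(1) \<phi>(1) Cc_cmult[OF \<xi>(1)]]
        posfun_cmult[OF \<sigma>(1) \<xi>(1)] by simp
    then have "ereal (\<sigma> \<phi> - e * \<sigma> \<xi>) \<le> ereal (tensor \<sigma> \<tau> g)" by simp
    also have "\<dots> \<le> ?I" by (rule pos_integral_upper[OF gC(1,3)])
    finally show ?thesis .
  qed
  show ?thesis
  proof (cases ?I)
    case (real r)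
    have "\<sigma> \<phi> \<le> r + e * \<sigma> \<xi>" if "0 < e" for e using *[OF that] real by simp
    then have "\<sigma> \<phi> \<le> r" using le_of_le_add_epsilon[of "\<sigma> \<phi>" r "\<sigma> \<xi>"] posfun_nonneg[OF \<sigma>(1) \<xi>(1,2)] by blast
    then show ?thesis using real by simp
  next
    case MInf
    then show ?thesis using *[of 1] by simp
  qed simp
qed

section \<open>The energy form\<close>

definition radon_mid ::
  "'b::topological_space functional \<Rightarrow> 'b functional \<Rightarrow> 'b functional" where
  "radon_mid \<sigma> \<tau> = radon_scale (1/2) (radon_add \<sigma> \<tau>)"

lemma radon_mid_apply [simp]: "\<phi> \<in> Cc \<Longrightarrow> radon_mid \<sigma> \<tau> \<phi> = (\<sigma> \<phi> + \<tau> \<phi>) / 2"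
  by (simp add: radon_mid_def)

lemma posfun_mid [simp]:
  fixes \<sigma> \<tau> :: "'b::t2_space functional"
  shows "posfun \<sigma> \<Longrightarrow> posfun \<tau> \<Longrightarrow> posfun (radon_mid \<sigma> \<tau>)"
  by (simp add: radon_mid_def)

locale pd_kernel =
  fixes \<kappa> :: "'a::t2_space \<times> 'a \<Rightarrow> ereal"
  assumes lc: "locally_compact_space (euclidean :: 'a topology)"
    and Phi: "\<kappa> \<in> Phi"
    and pd: "positive_definite \<kappa>"
begin

abbreviation Eplus :: "'a functional set" where
  "Eplus \<equiv> finite_energy_pos \<kappa>"

text \<open>Real-valued; by \<open>mut_eq\<close> nothing is lost between members of
  \<open>Eplus\<close>.\<close>

definition mut :: "'a functional \<Rightarrow> 'a functional \<Rightarrow> real" where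
  "mut \<sigma> \<tau> = real_of_ereal (pos_integral (tensor \<sigma> \<tau>) \<kappa>)"

text \<open>The squared seminorm of \<sigma> - \<tau>. The two mixed terms are kept apart:
  identifying them would take Fubini's theorem, and the quadratic identities below hold without
  it.\<close>

definition dist2 :: "'a functional \<Rightarrow> 'a functional \<Rightarrow> real" where
  "dist2 \<sigma> \<tau> = mut \<sigma> \<sigma> + mut \<tau> \<tau> - mut \<sigma> \<tau> - mut \<tau> \<sigma>"

lemma tensor_pos: "posfun \<sigma> \<Longrightarrow> posfun \<tau> \<Longrightarrow> posfun (tensor \<sigma> \<tau>)" for \<sigma> \<tau> :: "'a functional"
  by (rule posfun_tensor[OF lc])

lemma energy_posfun:
  assumes "posfun \<sigma>" "posfun \<tau>"
  shows "energy_defined \<kappa> \<sigma> \<tau>" "energy \<kappa> \<sigma> \<tau> = pos_integral (tensor \<sigma> \<tau>) \<kappa>"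
  using pos_part_posfun[OF tensor_pos[OF assms]] pos_integral_zero[OF Phi]
  by (simp_all add: energy_defined_def energy_def integral_defined_def signed_integral_def)

lemma Eplus_iff: "\<sigma> \<in> Eplus \<longleftrightarrow> posfun \<sigma> \<and> pos_integral (tensor \<sigma> \<sigma>) \<kappa> \<noteq> \<infinity>"
proof -
  have "\<bar>pos_integral (tensor \<sigma> \<sigma>) \<kappa>\<bar> \<noteq> \<infinity> \<longleftrightarrow> pos_integral (tensor \<sigma> \<sigma>) \<kappa> \<noteq> \<infinity>"
    using pos_integral_not_MInf[OF Phi, of "tensor \<sigma> \<sigma>"] by auto
  then show ?thesis
    using energy_posfun[of \<sigma> \<sigma>] posfun_radon[OF lc, of \<sigma>]
    unfolding finite_energy_pos_def finite_energy_def radon_pos_UNIV[OF lc] Int_iff mem_Collect_eq by auto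
qed

lemma EplusD: "\<sigma> \<in> Eplus \<Longrightarrow> posfun \<sigma>"
  by (simp add: Eplus_iff)

lemma tensor_radon_diff:
  fixes \<sigma> \<tau> :: "'a functional"
  assumes "posfun \<sigma>" "posfun \<tau>"
  shows "tensor (radon_diff \<sigma> \<tau>) (radon_diff \<sigma> \<tau>) =
    radon_diff (radon_add (tensor \<sigma> \<sigma>) (tensor \<tau> \<tau>)) (radon_add (tensor \<sigma> \<tau>) (tensor \<tau> \<sigma>))"
  by (rule tensor_diff_diff[OF lc assms(1) assms(2) assms(1) assms(2)])

text \<open>Otherwise the energy of \<sigma> - \<tau> would be defined and equal to -\<infinity>,
  against positive definiteness.\<close>

lemma mutual_finite:
  assumes "\<sigma> \<in> Eplus" "\<tau> \<in> Eplus"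
  shows "pos_integral (tensor \<sigma> \<tau>) \<kappa> \<noteq> \<infinity>"
proof
  assume inf: "pos_integral (tensor \<sigma> \<tau>) \<kappa> = \<infinity>"
  have p: "posfun \<sigma>" "posfun \<tau>" using assms by (auto simp: Eplus_iff)
  note t = tensor_pos[OF p(1) p(1)] tensor_pos[OF p(2) p(2)] tensor_pos[OF p] tensor_pos[OF p(2) p(1)]
  let ?m1 = "radon_add (tensor \<sigma> \<sigma>) (tensor \<tau> \<tau>)" and ?m2 = "radon_add (tensor \<sigma> \<tau>) (tensor \<tau> \<sigma>)"
  have "pos_integral ?m1 \<kappa> \<noteq> \<infinity>"
    using pos_integral_add[OF t(1,2) Phi] assms by (auto simp: Eplus_iff)
  moreover have "pos_integral ?m2 \<kappa> = \<infinity>"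
    using pos_integral_add[OF t(3,4) Phi] inf pos_integral_not_MInf[OF Phi] by auto
  ultimately have "energy_defined \<kappa> (radon_diff \<sigma> \<tau>) (radon_diff \<sigma> \<tau>)"
    "energy \<kappa> (radon_diff \<sigma> \<tau>) (radon_diff \<sigma> \<tau>) = -\<infinity>"
    unfolding energy_defined_def energy_def tensor_radon_diff[OF p]
    using signed_integral_MInf[OF posfun_ops(1)[OF t(1,2)] posfun_ops(1)[OF t(3,4)] Phi] by auto
  moreover have "radon_diff \<sigma> \<tau> \<in> radon"
    by (rule radon_radon_diff[OF posfun_radon[OF lc p(1)] posfun_radon[OF lc p(2)]])
  ultimately show False
    using pd unfolding positive_definite_def by fastforce
qed

lemma mut_eq:
  assumes "\<sigma> \<in> Eplus" "\<tau> \<in> Eplus"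
  shows "pos_integral (tensor \<sigma> \<tau>) \<kappa> = ereal (mut \<sigma> \<tau>)"
  using mutual_finite[OF assms] pos_integral_not_MInf[OF Phi, of "tensor \<sigma> \<tau>"]
  by (cases "pos_integral (tensor \<sigma> \<tau>) \<kappa>") (auto simp: mut_def)

lemma energy_radon_diff:
  assumes "\<sigma> \<in> Eplus" "\<tau> \<in> Eplus"
  shows "energy \<kappa> (radon_diff \<sigma> \<tau>) (radon_diff \<sigma> \<tau>) = ereal (dist2 \<sigma> \<tau>)"
    "radon_diff \<sigma> \<tau> \<in> finite_energy \<kappa>" "0 \<le> dist2 \<sigma> \<tau>"
proof -
  have p: "posfun \<sigma>" "posfun \<tau>" using assms by (auto simp: Eplus_iff)
  note t = tensor_pos[OF p(1) p(1)] tensor_pos[OF p(2) p(2)] tensor_pos[OF p] tensor_pos[OF p(2) p(1)]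
  let ?m1 = "radon_add (tensor \<sigma> \<sigma>) (tensor \<tau> \<tau>)" and ?m2 = "radon_add (tensor \<sigma> \<tau>) (tensor \<tau> \<sigma>)"
  have 1: "pos_integral ?m1 \<kappa> = ereal (mut \<sigma> \<sigma> + mut \<tau> \<tau>)"
    using pos_integral_add[OF t(1,2) Phi] assms by (simp add: mut_eq)
  have 2: "pos_integral ?m2 \<kappa> = ereal (mut \<sigma> \<tau> + mut \<tau> \<sigma>)"
    using pos_integral_add[OF t(3,4) Phi] assms by (simp add: mut_eq)
  have f: "pos_integral ?m1 \<kappa> \<noteq> \<infinity>" "pos_integral ?m2 \<kappa> \<noteq> \<infinity>" using 1 2 by auto
  note s = signed_integral_diff[OF posfun_ops(1)[OF t(1,2)] posfun_ops(1)[OF t(3,4)] Phi f]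
  have d: "energy_defined \<kappa> (radon_diff \<sigma> \<tau>) (radon_diff \<sigma> \<tau>)"
    unfolding energy_defined_def tensor_radon_diff[OF p] by (rule s(1))
  show e: "energy \<kappa> (radon_diff \<sigma> \<tau>) (radon_diff \<sigma> \<tau>) = ereal (dist2 \<sigma> \<tau>)"
    unfolding energy_def tensor_radon_diff[OF p] s(2) using 1 2 by (simp add: dist2_def)
  have r: "radon_diff \<sigma> \<tau> \<in> radon"
    by (rule radon_radon_diff[OF posfun_radon[OF lc p(1)] posfun_radon[OF lc p(2)]])
  show "radon_diff \<sigma> \<tau> \<in> finite_energy \<kappa>" using r d e by (simp add: finite_energy_def)
  have "0 \<le> energy \<kappa> (radon_diff \<sigma> \<tau>) (radon_diff \<sigma> \<tau>)"
    using pd r d unfolding positive_definite_def by blast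
  then show "0 \<le> dist2 \<sigma> \<tau>" using e by simp
qed

lemma strong_norm_radon_diff:
  assumes "\<sigma> \<in> Eplus" "\<tau> \<in> Eplus"
  shows "strong_norm \<kappa> (radon_diff \<sigma> \<tau>) = sqrt (dist2 \<sigma> \<tau>)"
  by (simp add: strong_norm_def energy_radon_diff[OF assms])

lemma zero_Eplus: "(\<lambda>\<phi>\<in>Cc. 0) \<in> Eplus"
proof -
  have "tensor (\<lambda>\<phi>\<in>Cc. 0) (\<lambda>\<phi>\<in>Cc. 0) = (\<lambda>f\<in>(Cc :: ('a \<times> 'a \<Rightarrow> real) set). 0)"
    by (auto simp: tensor_def Cc_section restrict_def)
  then show ?thesis using pos_integral_zero[OF Phi] by (simp add: Eplus_iff)
qed

lemma Eplus_scale: "\<sigma> \<in> Eplus \<Longrightarrow> 0 < c \<Longrightarrow> radon_scale c \<sigma> \<in> Eplus"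
  and mut_scale_left: "\<sigma> \<in> Eplus \<Longrightarrow> \<tau> \<in> Eplus \<Longrightarrow> 0 < c \<Longrightarrow> mut (radon_scale c \<sigma>) \<tau> = c * mut \<sigma> \<tau>"
  and mut_scale_right: "\<sigma> \<in> Eplus \<Longrightarrow> \<tau> \<in> Eplus \<Longrightarrow> 0 < c \<Longrightarrow> mut \<sigma> (radon_scale c \<tau>) = c * mut \<sigma> \<tau>"
proof -
  have L: "pos_integral (tensor (radon_scale c \<sigma>) \<tau>) \<kappa> = ereal c * pos_integral (tensor \<sigma> \<tau>) \<kappa>"
    if "posfun \<sigma>" "posfun \<tau>" "0 < c" for \<sigma> \<tau> c
    using tensor_scale_left[OF lc that(1) that(1) that(2) that(2), of c] pos_integral_scale[OF that(3) Phi] that(3) by simp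
  have R: "pos_integral (tensor \<sigma> (radon_scale c \<tau>)) \<kappa> = ereal c * pos_integral (tensor \<sigma> \<tau>) \<kappa>"
    if "posfun \<sigma>" "posfun \<tau>" "0 < c" for \<sigma> \<tau> c
    using tensor_scale_right[OF lc that(1) that(1) that(2) that(2), of c] pos_integral_scale[OF that(3) Phi] that(3) by simp
  show "\<sigma> \<in> Eplus \<Longrightarrow> \<tau> \<in> Eplus \<Longrightarrow> 0 < c \<Longrightarrow> mut (radon_scale c \<sigma>) \<tau> = c * mut \<sigma> \<tau>"
    unfolding mut_def[of "radon_scale c \<sigma>"] using L[of \<sigma> \<tau> c] mut_eq[of \<sigma> \<tau>] by (simp add: EplusD)
  show "\<sigma> \<in> Eplus \<Longrightarrow> \<tau> \<in> Eplus \<Longrightarrow> 0 < c \<Longrightarrow> mut \<sigma> (radon_scale c \<tau>) = c * mut \<sigma> \<tau>"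
    unfolding mut_def[of _ "radon_scale c \<tau>"] using R[of \<sigma> \<tau> c] mut_eq[of \<sigma> \<tau>] by (simp add: EplusD)
  assume *: "\<sigma> \<in> Eplus" "0 < c"
  have "pos_integral (tensor (radon_scale c \<sigma>) (radon_scale c \<sigma>)) \<kappa> = ereal c * (ereal c * ereal (mut \<sigma> \<sigma>))"
    using L[of \<sigma> "radon_scale c \<sigma>" c] R[of \<sigma> \<sigma> c] * mut_eq[of \<sigma> \<sigma>] by (simp add: EplusD)
  then show "radon_scale c \<sigma> \<in> Eplus" using * by (simp add: Eplus_iff)
qed

lemma Eplus_add: "\<sigma> \<in> Eplus \<Longrightarrow> \<tau> \<in> Eplus \<Longrightarrow> radon_add \<sigma> \<tau> \<in> Eplus"
  and mut_add_left: "\<sigma> \<in> Eplus \<Longrightarrow> \<sigma>' \<in> Eplus \<Longrightarrow> \<tau> \<in> Eplus \<Longrightarrow> mut (radon_add \<sigma> \<sigma>') \<tau> = mut \<sigma> \<tau> + mut \<sigma>' \<tau>"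
  and mut_add_right: "\<sigma> \<in> Eplus \<Longrightarrow> \<tau> \<in> Eplus \<Longrightarrow> \<tau>' \<in> Eplus \<Longrightarrow> mut \<sigma> (radon_add \<tau> \<tau>') = mut \<sigma> \<tau> + mut \<sigma> \<tau>'"
proof -
  have L: "pos_integral (tensor (radon_add \<sigma> \<sigma>') \<tau>) \<kappa> = pos_integral (tensor \<sigma> \<tau>) \<kappa> + pos_integral (tensor \<sigma>' \<tau>) \<kappa>"
    if "posfun \<sigma>" "posfun \<sigma>'" "posfun \<tau>" for \<sigma> \<sigma>' \<tau>
    using tensor_add_left[OF lc that(1) that(2) that(3) that(3)]
      pos_integral_add[OF tensor_pos[OF that(1,3)] tensor_pos[OF that(2,3)] Phi] by simp
  have R: "pos_integral (tensor \<sigma> (radon_add \<tau> \<tau>')) \<kappa> = pos_integral (tensor \<sigma> \<tau>) \<kappa> + pos_integral (tensor \<sigma> \<tau>') \<kappa>"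
    if "posfun \<sigma>" "posfun \<tau>" "posfun \<tau>'" for \<sigma> \<tau> \<tau>'
    using tensor_add_right[OF lc that(1) that(1) that(2) that(3)]
      pos_integral_add[OF tensor_pos[OF that(1,2)] tensor_pos[OF that(1,3)] Phi] by simp
  show "\<sigma> \<in> Eplus \<Longrightarrow> \<sigma>' \<in> Eplus \<Longrightarrow> \<tau> \<in> Eplus \<Longrightarrow> mut (radon_add \<sigma> \<sigma>') \<tau> = mut \<sigma> \<tau> + mut \<sigma>' \<tau>"
    unfolding mut_def[of "radon_add \<sigma> \<sigma>'"]
    using L[of \<sigma> \<sigma>' \<tau>] mut_eq[of \<sigma> \<tau>] mut_eq[of \<sigma>' \<tau>] by (simp add: EplusD)
  show "\<sigma> \<in> Eplus \<Longrightarrow> \<tau> \<in> Eplus \<Longrightarrow> \<tau>' \<in> Eplus \<Longrightarrow> mut \<sigma> (radon_add \<tau> \<tau>') = mut \<sigma> \<tau> + mut \<sigma> \<tau>'"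
    unfolding mut_def[of _ "radon_add \<tau> \<tau>'"]
    using R[of \<sigma> \<tau> \<tau>'] mut_eq[of \<sigma> \<tau>] mut_eq[of \<sigma> \<tau>'] by (simp add: EplusD)
  assume *: "\<sigma> \<in> Eplus" "\<tau> \<in> Eplus"
  have "pos_integral (tensor (radon_add \<sigma> \<tau>) (radon_add \<sigma> \<tau>)) \<kappa> =
      (ereal (mut \<sigma> \<sigma>) + ereal (mut \<sigma> \<tau>)) + (ereal (mut \<tau> \<sigma>) + ereal (mut \<tau> \<tau>))"
    using L[of \<sigma> \<tau> "radon_add \<sigma> \<tau>"] R[of \<sigma> \<sigma> \<tau>] R[of \<tau> \<sigma> \<tau>] * by (simp add: EplusD mut_eq)
  then show "radon_add \<sigma> \<tau> \<in> Eplus" using * by (simp add: Eplus_iff)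
qed

lemma Eplus_mid: "\<sigma> \<in> Eplus \<Longrightarrow> \<tau> \<in> Eplus \<Longrightarrow> radon_mid \<sigma> \<tau> \<in> Eplus"
  by (simp add: radon_mid_def Eplus_scale Eplus_add)

lemmas mut_simps = mut_scale_left mut_scale_right mut_add_left mut_add_right Eplus_add Eplus_scale

text \<open>The parallelogram identity, solved for the midpoint: the form in which uniform convexity
  is used.\<close>

lemma mut_mid:
  assumes "\<sigma> \<in> Eplus" "\<tau> \<in> Eplus"
  shows "mut (radon_mid \<sigma> \<tau>) (radon_mid \<sigma> \<tau>) = (mut \<sigma> \<sigma> + mut \<tau> \<tau>) / 2 - dist2 \<sigma> \<tau> / 4"
  using assms by (simp add: radon_mid_def dist2_def mut_simps field_simps)

text \<open>Convexity of the squared seminorm, from nonnegativity of the energy of (\<sigma>1 -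
  \<tau>1) - (\<sigma>2 - \<tau>2), regrouped as a difference of two nonnegative measures.\<close>

lemma dist2_mid:
  assumes "\<sigma>1 \<in> Eplus" "\<sigma>2 \<in> Eplus" "\<tau>1 \<in> Eplus" "\<tau>2 \<in> Eplus"
  shows "dist2 (radon_mid \<sigma>1 \<sigma>2) (radon_mid \<tau>1 \<tau>2) \<le> (dist2 \<sigma>1 \<tau>1 + dist2 \<sigma>2 \<tau>2) / 2"
  using energy_radon_diff(3)[OF Eplus_add[OF assms(1) assms(4)] Eplus_add[OF assms(2) assms(3)]] assms
  by (simp add: radon_mid_def dist2_def mut_simps field_simps)

lemma mut_nonneg: "\<sigma> \<in> Eplus \<Longrightarrow> 0 \<le> mut \<sigma> \<sigma>"
  and dist2_zero: "\<sigma> \<in> Eplus \<Longrightarrow> dist2 \<sigma> (\<lambda>\<phi>\<in>Cc. 0) = mut \<sigma> \<sigma>"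
proof -
  assume s: "\<sigma> \<in> Eplus"
  let ?z = "\<lambda>\<phi>\<in>(Cc :: ('a \<Rightarrow> real) set). 0 :: real"
  have d: "radon_diff \<sigma> ?z = \<sigma>"
    by (rule linfun_eqI) (use EplusD[OF s] in auto)
  have "energy \<kappa> \<sigma> \<sigma> = ereal (mut \<sigma> \<sigma>)"
    using energy_posfun[OF EplusD[OF s] EplusD[OF s]] mut_eq[OF s s] by simp
  then show "dist2 \<sigma> ?z = mut \<sigma> \<sigma>"
    using energy_radon_diff(1)[OF s zero_Eplus] d by simp
  then show "0 \<le> mut \<sigma> \<sigma>"
    using energy_radon_diff(3)[OF s zero_Eplus] by simp
qed

lemma mut_sum_le: "\<sigma> \<in> Eplus \<Longrightarrow> \<tau> \<in> Eplus \<Longrightarrow> mut \<sigma> \<tau> + mut \<tau> \<sigma> \<le> mut \<sigma> \<sigma> + mut \<tau> \<tau>"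
  using energy_radon_diff(3)[of \<sigma> \<tau>] by (simp add: dist2_def)

text \<open>Young's form of the triangle inequality for \<open>\<sigma>1 - \<tau>1 = (\<sigma>2 - \<tau>2) + z\<close>.\<close>

lemma dist2_approx:
  assumes E: "\<sigma>1 \<in> Eplus" "\<sigma>2 \<in> Eplus" "\<tau>1 \<in> Eplus" "\<tau>2 \<in> Eplus" and t: "0 < t"
  shows "dist2 \<sigma>1 \<tau>1 \<le> (1 + t) * dist2 \<sigma>2 \<tau>2 + (1 + 1 / t) * (2 * dist2 \<sigma>1 \<sigma>2 + 2 * dist2 \<tau>1 \<tau>2)"
proof -
  let ?z = "dist2 (radon_add \<sigma>1 \<tau>2) (radon_add \<tau>1 \<sigma>2)"
  \<comment> \<open>Nonnegativity of the energy of (\<sigma>1 - \<sigma>2) + (\<tau>1 - \<tau>2)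
    bounds that of the difference of the two brackets.\<close>
  have 1: "?z \<le> 2 * dist2 \<sigma>1 \<sigma>2 + 2 * dist2 \<tau>1 \<tau>2"
    using energy_radon_diff(3)[OF Eplus_add[OF E(1) E(3)] Eplus_add[OF E(2) E(4)]] E
    by (simp add: dist2_def mut_simps)
  \<comment> \<open>This is the energy of t (\<sigma>2 - \<tau>2) - z, with terms moved across so
    that both arguments are nonnegative measures.\<close>
  have "0 \<le> dist2 (radon_add (radon_scale t \<sigma>2) (radon_add \<tau>1 \<sigma>2)) (radon_add (radon_scale t \<tau>2) (radon_add \<sigma>1 \<tau>2))"
    using E t by (intro energy_radon_diff(3) Eplus_add Eplus_scale)
  then have "t * dist2 \<sigma>1 \<tau>1 \<le> t * ((1 + t) * dist2 \<sigma>2 \<tau>2) + (t + 1) * ?z"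
    using E t by (simp add: dist2_def mut_simps algebra_simps)
  then have "dist2 \<sigma>1 \<tau>1 \<le> (1 + t) * dist2 \<sigma>2 \<tau>2 + (1 + 1 / t) * ?z"
    using t by (simp add: field_simps)
  also have "\<dots> \<le> (1 + t) * dist2 \<sigma>2 \<tau>2 + (1 + 1 / t) * (2 * dist2 \<sigma>1 \<sigma>2 + 2 * dist2 \<tau>1 \<tau>2)"
    using 1 t by (intro add_left_mono mult_left_mono) auto
  finally show ?thesis .
qed

end

section \<open>Cauchy filters from uniform convexity\<close>

text \<open>
  Along a directed family of convex sets the almost-minimizers of a quadratic functional form a
  Cauchy filter; this replaces weak compactness and Mazur's theorem in the completion.
\<close>

lemma cauchy_filter_of_convex_sets:
  fixes f :: "'x \<Rightarrow> real" and D :: "'x \<Rightarrow> 'x \<Rightarrow> real"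
  assumes ne: "\<W> \<noteq> {}"
    and dir: "\<And>V W. V \<in> \<W> \<Longrightarrow> W \<in> \<W> \<Longrightarrow> \<exists>U\<in>\<W>. U \<subseteq> V \<inter> W"
    and bnd: "\<And>W. W \<in> \<W> \<Longrightarrow> \<exists>x\<in>W. f x \<le> C"
    and nn: "\<And>W x. W \<in> \<W> \<Longrightarrow> x \<in> W \<Longrightarrow> 0 \<le> f x"
    and mid: "\<And>W x y. W \<in> \<W> \<Longrightarrow> x \<in> W \<Longrightarrow> y \<in> W \<Longrightarrow> \<exists>z\<in>W. f z \<le> (f x + f y) / 2 - D x y / 4"
  shows "\<exists>F. F \<noteq> bot \<and> (\<forall>W\<in>\<W>. eventually (\<lambda>x. x \<in> W) F) \<and>
    (\<forall>e>0. \<exists>Z. eventually (\<lambda>x. x \<in> Z) F \<and> (\<forall>x\<in>Z. \<forall>y\<in>Z. D x y < e))"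
proof -
  define n where "n W = (INF x\<in>W. f x)" for W
  have bb: "bdd_below (f ` W)" if "W \<in> \<W>" for W
    using nn[OF that] by (intro bdd_belowI2[where m = 0])
  have n_le: "n W \<le> f x" if "W \<in> \<W>" "x \<in> W" for W x
    unfolding n_def using bb[OF that(1)] that(2) by (rule cINF_lower)
  have nC: "n W \<le> C" if "W \<in> \<W>" for W
    using bnd[OF that] n_le[OF that] order_trans by blast
  \<comment> \<open>Near-minimality is measured against the supremum of all the infima, not against
    the infimum on each set; this makes the sets \<open>Z\<close> a filter base.\<close>
  define n0 where "n0 = (SUP W\<in>\<W>. n W)"
  have ba: "bdd_above (n ` \<W>)" using nC by (intro bdd_aboveI2[where M = C])
  have n0: "n W \<le> n0" if "W \<in> \<W>" for W
    unfolding n0_def using that ba by (rule cSUP_upper)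
  define Z where "Z = (\<lambda>(W, e). {x \<in> W. f x < n0 + e})"
  let ?B = "\<W> \<times> {0::real<..}"
  define F where "F = (INF b\<in>?B. principal (Z b))"
  have Bne: "?B \<noteq> {}" using ne by (auto intro: exI[of _ 1])
  have ev: "eventually P F \<longleftrightarrow> (\<exists>b\<in>?B. \<forall>x\<in>Z b. P x)" for P
    unfolding F_def
  proof (subst eventually_INF_base[OF Bne])
    fix a b assume ab: "a \<in> ?B" "b \<in> ?B"
    obtain V d W e where [simp]: "a = (V, d)" "b = (W, e)" by (cases a; cases b)
    obtain U where U: "U \<in> \<W>" "U \<subseteq> V \<inter> W" using dir[of V W] ab by auto
    show "\<exists>x\<in>?B. principal (Z x) \<le> inf (principal (Z a)) (principal (Z b))"
      by (rule bexI[of _ "(U, min d e)"]) (use U ab in \<open>auto simp: Z_def\<close>)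
  qed (simp add: eventually_principal)
  have Zne: "Z b \<noteq> {}" if "b \<in> ?B" for b
  proof -
    obtain W e where b: "b = (W, e)" "W \<in> \<W>" "0 < e" using \<open>b \<in> ?B\<close> by auto
    have "n W < n0 + e" using n0[OF b(2)] b(3) by simp
    moreover have "W \<noteq> {}" using bnd[OF b(2)] by auto
    ultimately obtain x where "x \<in> W" "f x < n0 + e"
      unfolding n_def using cINF_less_iff[OF _ bb[OF b(2)]] by auto
    then show ?thesis by (auto simp: b(1) Z_def)
  qed
  have 1: "F \<noteq> bot"
    unfolding trivial_limit_def ev using Zne by auto
  have 2: "eventually (\<lambda>x. x \<in> W) F" if "W \<in> \<W>" for W
    unfolding ev by (rule bexI[of _ "(W, 1)"]) (use that in \<open>auto simp: Z_def\<close>)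
  have 3: "\<exists>Z. eventually (\<lambda>x. x \<in> Z) F \<and> (\<forall>x\<in>Z. \<forall>y\<in>Z. D x y < e)" if e: "0 < e" for e
  proof -
    \<comment> \<open>Once n W > n0 - e/8, the midpoint estimate gives D x y \<le> 4 ((f x + f y) /
      2 - n W) < 4 (e/8 + e/8) = e.\<close>
    have "n0 - e / 8 < (SUP W\<in>\<W>. n W)" unfolding n0_def[symmetric] using e by simp
    then obtain W where W: "W \<in> \<W>" "n0 - e / 8 < n W"
      using less_cSUP_iff[OF ne ba] by blast
    have "D x y < e" if "x \<in> Z (W, e / 8)" "y \<in> Z (W, e / 8)" for x y
    proof -
      have xy: "x \<in> W" "f x < n0 + e / 8" "y \<in> W" "f y < n0 + e / 8" using that by (auto simp: Z_def)
      obtain z where z: "z \<in> W" "f z \<le> (f x + f y) / 2 - D x y / 4" using mid[OF W(1) xy(1,3)] by blast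
      have "n W \<le> f z" using n_le[OF W(1) z(1)] .
      with z(2) W(2) xy(2,4) show ?thesis by argo
    qed
    moreover have "eventually (\<lambda>x. x \<in> Z (W, e / 8)) F"
      unfolding ev by (rule bexI[of _ "(W, e / 8)"]) (use W e in auto)
    ultimately show ?thesis by blast
  qed
  show ?thesis using 1 2 3 by blast
qed

section \<open>Vague compactness\<close>

text \<open>Tychonoff's theorem for the pointwise bounds. Linearity, positivity and support in
  \<open>E\<close> are expressed by closed conditions on finitely many evaluations each, and
  continuity of the limit functional is automatic.\<close>

lemma compactin_vague_bounded:
  fixes E :: "'b::t2_space set"
  assumes lc: "locally_compact_space (euclidean :: 'b topology)" and E: "closed E"
  shows "compactin vague {\<nu> \<in> radon_pos E. \<forall>\<phi>\<in>Cc. \<bar>\<nu> \<phi>\<bar> \<le> c \<phi>}" (is "compactin vague ?B")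
proof -
  let ?X = "powertop_real (Cc :: ('b \<Rightarrow> real) set)"
  let ?S = "\<Pi>\<^sub>E \<phi>\<in>(Cc :: ('b \<Rightarrow> real) set). {- c \<phi>..c \<phi>}"
  let ?cl = "\<lambda>h C. {\<nu> \<in> topspace ?X. h \<nu> \<in> C}"
  have S: "compactin ?X ?S" by (simp add: compactin_PiE)
  have pr: "continuous_map ?X euclideanreal (\<lambda>\<nu>. \<nu> \<phi>)" if "\<phi> \<in> Cc" for \<phi> :: "'b \<Rightarrow> real"
    using continuous_map_product_projection[OF that, of "\<lambda>_. euclideanreal"] by simp
  have cl: "closedin ?X (?cl h C)" if "continuous_map ?X euclideanreal h" "closed C" for h and C :: "real set"
    using that closedin_continuous_map_preimage[of ?X euclideanreal h C] by simp
  define \<C> where "\<C> =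
     {?cl (\<lambda>\<nu>. \<nu> (\<lambda>x. \<phi> x + \<psi> x) - (\<nu> \<phi> + \<nu> \<psi>)) {0} |\<phi> \<psi>. \<phi> \<in> Cc \<and> \<psi> \<in> Cc} \<union>
     {?cl (\<lambda>\<nu>. \<nu> (\<lambda>x. k * \<phi> x) - k * \<nu> \<phi>) {0} |\<phi> k. \<phi> \<in> Cc} \<union>
     {?cl (\<lambda>\<nu>. \<nu> \<phi>) {0..} |\<phi>. \<phi> \<in> Cc \<and> (\<forall>x. 0 \<le> \<phi> x)} \<union>
     {?cl (\<lambda>\<nu>. \<nu> \<phi>) {0} |\<phi>. \<phi> \<in> Cc \<and> func_support \<phi> \<inter> E = {}}"
  have k1: "closedin ?X (?cl (\<lambda>\<nu>. \<nu> (\<lambda>x. \<phi> x + \<psi> x) - (\<nu> \<phi> + \<nu> \<psi>)) {0})"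
    if "\<phi> \<in> Cc" "\<psi> \<in> Cc" for \<phi> \<psi> :: "'b \<Rightarrow> real"
    by (rule cl[OF continuous_map_diff[OF pr[OF Cc_ops(1)[OF that]] continuous_map_add[OF pr[OF that(1)] pr[OF that(2)]]]]) simp
  have k2: "closedin ?X (?cl (\<lambda>\<nu>. \<nu> (\<lambda>x. k * \<phi> x) - k * \<nu> \<phi>) {0})"
    if "\<phi> \<in> Cc" for \<phi> :: "'b \<Rightarrow> real" and k
    by (rule cl[OF continuous_map_diff[OF pr[OF Cc_cmult[OF that]] continuous_map_real_mult_left[OF pr[OF that]]]]) simp
  have k3: "closedin ?X (?cl (\<lambda>\<nu>. \<nu> \<phi>) {0})" "closedin ?X (?cl (\<lambda>\<nu>. \<nu> \<phi>) {0..})"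
    if "\<phi> \<in> Cc" for \<phi> :: "'b \<Rightarrow> real"
    by (rule cl[OF pr[OF that]]; simp)+
  have "closedin ?X C" if "C \<in> \<C>" for C
    using that unfolding \<C>_def
    by (elim UnE CollectE exE conjE) (simp_all only: k1 k2 k3)
  moreover have "\<C> \<noteq> {}" unfolding \<C>_def using Cc_zero by blast
  ultimately have "closedin ?X (\<Inter>\<C>)" by (intro closedin_Inter)
  with S have "compactin ?X (?S \<inter> \<Inter>\<C>)" by (rule compact_Int_closedin)
  moreover have "?B = ?S \<inter> \<Inter>\<C>"
  proof
    show "?B \<subseteq> ?S \<inter> \<Inter>\<C>"
    proof
      fix \<nu> assume \<nu>: "\<nu> \<in> ?B"
      then have p: "posfun \<nu>" and s: "meas_support \<nu> \<subseteq> E" and b: "\<And>\<phi>. \<phi> \<in> Cc \<Longrightarrow> \<bar>\<nu> \<phi>\<bar> \<le> c \<phi>"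
        using radon_pos_UNIV[OF lc] by auto
      have l: "linfun \<nu>" using p by simp
      have x: "\<nu> \<in> extensional Cc" using l by (simp add: linfun_def)
      have "\<nu> \<in> ?S" using x b by (auto simp: PiE_iff abs_le_iff minus_le_iff)
      moreover have "\<nu> \<in> topspace ?X" using x by (simp add: PiE_UNIV_domain PiE_iff)
      ultimately show "\<nu> \<in> ?S \<inter> \<Inter>\<C>"
        unfolding \<C>_def
        using linfun_add[OF l] linfun_cmult[OF l] posfun_nonneg[OF p] posfun_eq_0_off_support[OF lc p s] by auto
    qed
    show "?S \<inter> \<Inter>\<C> \<subseteq> ?B"
    proof
      fix \<nu> assume \<nu>: "\<nu> \<in> ?S \<inter> \<Inter>\<C>"
      have "\<nu> (\<lambda>x. \<phi> x + \<psi> x) = \<nu> \<phi> + \<nu> \<psi>" if "\<phi> \<in> Cc" "\<psi> \<in> Cc" for \<phi> \<psi>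
      proof -
        have "?cl (\<lambda>\<nu>. \<nu> (\<lambda>x. \<phi> x + \<psi> x) - (\<nu> \<phi> + \<nu> \<psi>)) {0} \<in> \<C>" unfolding \<C>_def using that by blast
        then show ?thesis using \<nu> by auto
      qed
      moreover have "\<nu> (\<lambda>x. k * \<phi> x) = k * \<nu> \<phi>" if "\<phi> \<in> Cc" for \<phi> k
      proof -
        have "?cl (\<lambda>\<nu>. \<nu> (\<lambda>x. k * \<phi> x) - k * \<nu> \<phi>) {0} \<in> \<C>" unfolding \<C>_def using that by blast
        then show ?thesis using \<nu> by auto
      qed
      moreover have "0 \<le> \<nu> \<phi>" if "\<phi> \<in> Cc" "\<forall>x. 0 \<le> \<phi> x" for \<phi>
      proof -
        have "?cl (\<lambda>\<nu>. \<nu> \<phi>) {0..} \<in> \<C>" unfolding \<C>_def using that by blast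
        then show ?thesis using \<nu> by auto
      qed
      moreover have "\<nu> \<in> extensional Cc" using \<nu> by (auto simp: PiE_def)
      ultimately have p: "posfun \<nu>" by (auto simp: posfun_def linfun_def)
      moreover have "\<nu> \<phi> = 0" if "\<phi> \<in> Cc" "func_support \<phi> \<inter> E = {}" for \<phi>
      proof -
        have "?cl (\<lambda>\<nu>. \<nu> \<phi>) {0} \<in> \<C>" unfolding \<C>_def using that by blast
        then show ?thesis using \<nu> by auto
      qed
      then have "meas_support \<nu> \<subseteq> E" using meas_support_subset_iff[OF lc p E] by blast
      moreover have "\<bar>\<nu> \<phi>\<bar> \<le> c \<phi>" if "\<phi> \<in> Cc" for \<phi>
        using \<nu> that by (auto simp: PiE_iff abs_le_iff minus_le_iff)
      ultimately show "\<nu> \<in> ?B" using radon_pos_UNIV[OF lc] by auto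
    qed
  qed
  moreover have "?B \<subseteq> radon" by (auto simp: radon_pos_def)
  ultimately show ?thesis unfolding vague_def compactin_subtopology by simp
qed

lemma radon_topspace: "\<nu> \<in> radon \<Longrightarrow> \<nu> \<in> topspace (powertop_real Cc)"
  using radon_linfun[of \<nu>] by (simp add: PiE_iff linfun_def)

lemma limitin_vague:
  fixes T :: "'x \<Rightarrow> 'b::t2_space functional"
  assumes "\<nu> \<in> radon" "\<forall>\<^sub>F x in F. T x \<in> radon" "\<And>\<phi>. \<phi> \<in> Cc \<Longrightarrow> ((\<lambda>x. T x \<phi>) \<longlongrightarrow> \<nu> \<phi>) F"
  shows "limitin vague T \<nu> F"
proof -
  have 1: "\<forall>\<^sub>F x in F. T x \<in> topspace (powertop_real (Cc :: ('b \<Rightarrow> real) set))"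
    by (rule eventually_mono[OF assms(2) radon_topspace])
  have 2: "\<nu> \<in> extensional Cc"
    using radon_linfun[OF assms(1)] by (simp add: linfun_def)
  show ?thesis
    unfolding vague_def limitin_subtopology limitin_componentwise
    using 1 2 assms by (intro conjI ballI) (simp_all only: limitin_canonical_iff)
qed

section \<open>Supports\<close>

lemma meas_support_add:
  fixes \<sigma> \<tau> :: "'b::t2_space functional"
  assumes lc: "locally_compact_space (euclidean :: 'b topology)" and p: "posfun \<sigma>" "posfun \<tau>"
  shows "meas_support (radon_add \<sigma> \<tau>) \<subseteq> meas_support \<sigma> \<union> meas_support \<tau>"
  unfolding meas_support_subset_iff[OF lc posfun_ops(1)[OF p] closed_Un[OF closed_meas_support closed_meas_support]]
  using posfun_eq_0_off_support[OF lc p(1) order_refl] posfun_eq_0_off_support[OF lc p(2) order_refl]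
  by (simp add: Int_Un_distrib)

lemma meas_support_scale:
  fixes \<sigma> :: "'b::t2_space functional"
  assumes lc: "locally_compact_space (euclidean :: 'b topology)" and p: "posfun \<sigma>" "0 \<le> c"
  shows "meas_support (radon_scale c \<sigma>) \<subseteq> meas_support \<sigma>"
  unfolding meas_support_subset_iff[OF lc posfun_ops(2)[OF p(2,1)] closed_meas_support]
  using posfun_eq_0_off_support[OF lc p(1) order_refl] by simp

lemma meas_support_mid:
  fixes \<sigma> \<tau> :: "'b::t2_space functional"
  assumes lc: "locally_compact_space (euclidean :: 'b topology)" and p: "posfun \<sigma>" "posfun \<tau>"
  shows "meas_support (radon_mid \<sigma> \<tau>) \<subseteq> meas_support \<sigma> \<union> meas_support \<tau>"
  using meas_support_scale[OF lc posfun_ops(1)[OF p], of "1/2"] meas_support_add[OF lc p]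
  by (simp add: radon_mid_def subset_trans)

lemma meas_support_mult:
  fixes \<sigma> :: "'b::t2_space functional"
  assumes lc: "locally_compact_space (euclidean :: 'b topology)" and p: "posfun \<sigma>"
    and h: "h \<in> Cc" "\<And>x. 0 \<le> h x"
  shows "meas_support (radon_mult h \<sigma>) \<subseteq> meas_support \<sigma> \<inter> func_support h"
proof -
  have c: "closed (meas_support \<sigma> \<inter> func_support h)"
    by (simp add: closed_Int closed_meas_support func_support_def)
  have "radon_mult h \<sigma> \<phi> = 0" if \<phi>: "\<phi> \<in> Cc" "func_support \<phi> \<inter> (meas_support \<sigma> \<inter> func_support h) = {}" for \<phi>
  proof -
    have "func_support (\<lambda>x. h x * \<phi> x) \<subseteq> func_support \<phi> \<inter> func_support h"
    proof (intro Int_greatest func_support_subset)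
      show "closed (func_support \<phi>)" "closed (func_support h)" by (simp_all add: func_support_def)
      show "h x * \<phi> x = 0" if "x \<notin> func_support \<phi>" for x using CcD(3)[OF \<phi>(1) that] by simp
      show "h x * \<phi> x = 0" if "x \<notin> func_support h" for x using CcD(3)[OF h(1) that] by simp
    qed
    then have "func_support (\<lambda>x. h x * \<phi> x) \<inter> meas_support \<sigma> = {}" using \<phi>(2) by blast
    then show ?thesis
      using posfun_eq_0_off_support[OF lc p order_refl Cc_ops(3)[OF h(1) \<phi>(1)]] \<phi>(1) by simp
  qed
  then show ?thesis
    using meas_support_subset_iff[OF lc posfun_mult[OF p CcD(1)[OF h(1)] h(2)] c] by blast
qed

lemma compact_meas_support_subset: "meas_support \<nu> \<subseteq> K \<Longrightarrow> compact K \<Longrightarrow> compact (meas_support \<nu>)"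
  for \<nu> :: "'b::t2_space functional"
  using compact_Int_closed[OF _ closed_meas_support, of K \<nu>] by (simp add: inf.absorb2)

lemma one_Phi: "(\<lambda>_. 1) \<in> Phi"
  by (simp add: Phi_def)

text \<open>The constant 1 is in general no test function; on a measure supported in
  \<open>K\<close>, any cutoff equal to 1 there computes the total mass.\<close>

lemma mass_compact_support:
  fixes \<nu> :: "'b::t2_space functional"
  assumes lc: "locally_compact_space (euclidean :: 'b topology)" and p: "posfun \<nu>" "meas_support \<nu> \<subseteq> K"
    and \<eta>: "\<eta> \<in> Cc" "\<And>x. \<eta> x \<le> 1" "\<And>x. x \<in> K \<Longrightarrow> \<eta> x = 1"
  shows "pos_integral \<nu> (\<lambda>_. 1) = ereal (\<nu> \<eta>)"
proof (rule antisym)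
  show "pos_integral \<nu> (\<lambda>_. 1) \<le> ereal (\<nu> \<eta>)"
  proof (rule pos_integral_least)
    fix \<phi> :: "'b \<Rightarrow> real" assume \<phi>: "\<phi> \<in> Cc" "\<And>x. ereal (\<phi> x) \<le> 1"
    have "\<nu> \<phi> \<le> \<nu> \<eta>"
      by (rule posfun_mono_on_support[OF lc p \<phi>(1) \<eta>(1)]) (use \<eta>(3) \<phi>(2) in \<open>simp add: one_ereal_def\<close>)
    then show "ereal (\<nu> \<phi>) \<le> ereal (\<nu> \<eta>)" by simp
  qed
  show "ereal (\<nu> \<eta>) \<le> pos_integral \<nu> (\<lambda>_. 1)"
    by (rule pos_integral_upper[OF \<eta>(1)]) (use \<eta>(2) in \<open>simp add: one_ereal_def\<close>)
qed

section \<open>Domination of energies\<close>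

lemma Cc_product:
  fixes a :: "'b::t2_space \<Rightarrow> real" and b :: "'c::t2_space \<Rightarrow> real"
  assumes "a \<in> Cc" "b \<in> Cc"
  shows "(\<lambda>z. a (fst z) * b (snd z)) \<in> Cc"
proof (rule CcI)
  show "continuous_on UNIV (\<lambda>z. a (fst z) * b (snd z))"
    by (intro continuous_intros continuous_on_compose2[OF CcD(1)[OF assms(1)]]
        continuous_on_compose2[OF CcD(1)[OF assms(2)]]) auto
  show "compact (func_support a \<times> func_support b)"
    by (intro compact_Times CcD(2) assms)
  show "a (fst z) * b (snd z) = 0" if "z \<notin> func_support a \<times> func_support b" for z
    using that CcD(3)[OF assms(1), of "fst z"] CcD(3)[OF assms(2), of "snd z"] by (cases z) auto
qed

lemma tensor_product_fun:
  fixes a :: "'b::t2_space \<Rightarrow> real" and b :: "'c::t2_space \<Rightarrow> real"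
  assumes "a \<in> Cc" "b \<in> Cc" "linfun \<sigma>" "linfun \<tau>"
  shows "tensor \<sigma> \<tau> (\<lambda>z. a (fst z) * b (snd z)) = \<sigma> a * \<tau> b"
proof -
  have "\<tau> (\<lambda>y. a x * b y) = \<tau> b * a x" for x
    using linfun_cmult[OF assms(4,2)] by simp
  then show ?thesis
    using linfun_cmult[OF assms(3,1)] Cc_product[OF assms(1,2)] by (simp add: tensor_apply)
qed

lemma tensor_mono:
  fixes \<sigma> \<sigma>' :: "'b::t2_space functional" and \<tau> \<tau>' :: "'c::t2_space functional"
  assumes lc: "locally_compact_space (euclidean :: 'c topology)"
    and p: "posfun \<sigma>" "posfun \<sigma>'" "posfun \<tau>" "posfun \<tau>'"
    and le: "\<And>\<phi>. \<phi> \<in> Cc \<Longrightarrow> (\<And>x. 0 \<le> \<phi> x) \<Longrightarrow> \<sigma> \<phi> \<le> \<sigma>' \<phi>"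
      "\<And>\<phi>. \<phi> \<in> Cc \<Longrightarrow> (\<And>x. 0 \<le> \<phi> x) \<Longrightarrow> \<tau> \<phi> \<le> \<tau>' \<phi>"
    and f: "f \<in> Cc" "\<And>z. 0 \<le> f z"
  shows "tensor \<sigma> \<tau> f \<le> tensor \<sigma>' \<tau>' f"
proof -
  have "\<sigma> (\<lambda>x. \<tau> (\<lambda>y. f (x, y))) \<le> \<sigma> (\<lambda>x. \<tau>' (\<lambda>y. f (x, y)))"
    by (rule posfun_mono[OF p(1) Cc_partial_integral[OF lc f(1) p(3)] Cc_partial_integral[OF lc f(1) p(4)]])
       (rule le(2)[OF Cc_section[OF f(1)] f(2)])
  also have "\<dots> \<le> \<sigma>' (\<lambda>x. \<tau>' (\<lambda>y. f (x, y)))"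
    by (rule le(1)[OF Cc_partial_integral[OF lc f(1) p(4)]], rule posfun_nonneg[OF p(4) Cc_section[OF f(1)] f(2)])
  finally show ?thesis using f(1) by (simp add: tensor_apply)
qed

text \<open>A function in place of a Hahn set: let \<psi> almost attain the supremum defining
  \<open>\<nu>\<^sup>+ \<xi>\<close>. The deficit bounds both \<open>\<nu>\<^sup>- \<psi>\<close>
  and \<open>\<nu>\<^sup>+ (\<xi> - \<psi>)\<close>.\<close>

lemma approximate_hahn_set:
  fixes \<nu> :: "'b::t2_space functional"
  assumes ob: "order_bounded \<nu>" and \<xi>: "\<xi> \<in> Cc" "\<And>x. 0 \<le> \<xi> x" and e: "0 < e"
  obtains \<psi> where "\<psi> \<in> Cc" "\<And>x. 0 \<le> \<psi> x" "\<And>x. \<psi> x \<le> \<xi> x" "neg_part \<nu> \<psi> \<le> e"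
    "pos_part \<nu> \<xi> - pos_part \<nu> \<psi> \<le> e"
proof -
  note pp = posfun_pos_part[OF ob] posfun_neg_part[OF ob]
  have "pos_part \<nu> \<xi> - e < sup_below \<nu> \<xi>"
    using pos_part_nonneg_apply[OF ob \<xi>] e by simp
  moreover have "sup_below \<nu> \<xi> \<le> pos_part \<nu> \<xi> - e" if "\<And>\<psi>. \<psi> \<in> nonneg_minorants \<xi> \<Longrightarrow> \<nu> \<psi> \<le> pos_part \<nu> \<xi> - e"
    by (rule sup_below_least[OF ob that])
  ultimately obtain \<psi> where \<psi>: "\<psi> \<in> nonneg_minorants \<xi>" "pos_part \<nu> \<xi> - e < \<nu> \<psi>"
    by (meson not_le)
  note d = nonneg_minorantsD[OF \<psi>(1)]
  have le: "\<psi> x \<le> \<xi> x" for x using d(3)[of x] \<xi>(2)[of x] by simp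
  have "\<nu> \<psi> = pos_part \<nu> \<psi> - neg_part \<nu> \<psi>"
    using jordan_decomposition[OF ob] d(1) by (metis radon_ops_apply(2))
  moreover have "pos_part \<nu> \<psi> \<le> pos_part \<nu> \<xi>" by (rule posfun_mono[OF pp(1) d(1) \<xi>(1) le])
  moreover have "0 \<le> neg_part \<nu> \<psi>" by (rule posfun_nonneg[OF pp(2) d(1,2)])
  ultimately show thesis using \<psi>(2) by (intro that[OF d(1,2) le]) auto
qed

context pd_kernel
begin

text \<open>
  \<open>\<omega>\<^sup>+ \<otimes> \<omega>\<^sup>+ \<le> (\<omega> \<otimes> \<omega>)\<^sup>+\<close>, because \<open>\<omega>\<^sup>+\<close> and \<open>\<omega>\<^sup>-\<close> are almost carried by
  \<open>\<psi>\<close> and \<open>\<xi> - \<psi>\<close> respectively.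
\<close>

lemma tensor_pos_part_le:
  fixes \<omega> :: "'a functional"
  assumes ob: "order_bounded \<omega>" and f: "f \<in> Cc" "\<And>z. 0 \<le> f z"
  shows "tensor (pos_part \<omega>) (pos_part \<omega>) f \<le> pos_part (tensor \<omega> \<omega>) f"
proof -
  let ?p = "pos_part \<omega>" and ?n = "neg_part \<omega>"
  note pp = posfun_pos_part[OF ob] posfun_neg_part[OF ob]
  note t = tensor_pos[OF pp(1) pp(1)] tensor_pos[OF pp(2) pp(2)] tensor_pos[OF pp] tensor_pos[OF pp(2) pp(1)]
  let ?T = "radon_diff (radon_add (tensor ?p ?p) (tensor ?n ?n)) (radon_add (tensor ?p ?n) (tensor ?n ?p))"
  have T: "tensor \<omega> \<omega> = ?T"
    using tensor_radon_diff[OF pp] jordan_decomposition[OF ob] by simp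
  have obT: "order_bounded ?T"
    by (rule order_bounded_radon_diff(1)[OF posfun_ops(1)[OF t(1,2)] posfun_ops(1)[OF t(3,4)]])
  let ?K = "fst ` func_support f \<union> snd ` func_support f"
  have K: "compact ?K"
    using CcD(2)[OF f(1)] by (intro compact_Un compact_continuous_image continuous_intros)
  obtain \<xi> where \<xi>: "\<xi> \<in> Cc" "\<And>x. 0 \<le> \<xi> x" "\<And>x. \<xi> x \<le> 1" "\<And>x. x \<in> ?K \<Longrightarrow> \<xi> x = 1"
    using bump_function[OF lc K open_UNIV] by (metis subset_UNIV)
  obtain B where B: "0 \<le> B" "\<And>z. \<bar>f z\<bar> \<le> B" using Cc_bounded[OF f(1)] by blast
  \<comment> \<open>Two mixed terms and two terms from replacing \<open>f\<close> by
    \<open>h\<close> contribute at most \<open>e * B * ?p \<xi>\<close> each, whence the factor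
    4.\<close>
  have *: "tensor ?p ?p f \<le> pos_part ?T f + e * (4 * B * ?p \<xi>)" if e: "0 < e" for e
  proof -
    obtain \<psi> where \<psi>: "\<psi> \<in> Cc" "\<And>x. 0 \<le> \<psi> x" "\<And>x. \<psi> x \<le> \<xi> x" "?n \<psi> \<le> e" "?p \<xi> - ?p \<psi> \<le> e"
      using approximate_hahn_set[OF ob \<xi>(1,2) e] by blast
    have \<psi>1: "\<psi> x \<le> 1" for x using \<psi>(3)[of x] \<xi>(3)[of x] by simp
    \<comment> \<open>This cuts \<open>f\<close> down to where \<omega> is almost positive in both
      variables; the result competes in the supremum defining the positive part of the tensor
      square.\<close>
    define h where "h = (\<lambda>z. f z * (\<psi> (fst z) * \<psi> (snd z)))"
    have h: "h \<in> Cc" unfolding h_def using f(1) Cc_product[OF \<psi>(1) \<psi>(1)] by (rule Cc_ops(3))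
    have h0: "0 \<le> h z" for z unfolding h_def using f(2) \<psi>(2) by simp
    have hf: "h z \<le> f z" for z
      unfolding h_def using f(2) \<psi>(2) \<psi>1 by (simp add: mult_left_le mult_le_one)
    have "h \<in> nonneg_minorants f"
      by (rule nonneg_minorantsI[OF h h0]) (use hf in \<open>simp add: le_max_iff_disj\<close>)
    then have "?T h \<le> pos_part ?T f"
      using sup_below_upper[OF obT f(1)] pos_part_nonneg_apply[OF obT f] by simp
    moreover have "0 \<le> tensor ?n ?n h" by (rule posfun_nonneg[OF t(2) h h0])
    moreover have b: "tensor \<sigma> \<tau> h \<le> B * (\<sigma> \<psi> * \<tau> \<psi>)" if "posfun \<sigma>" "posfun \<tau>" for \<sigma> \<tau>
    proof -
      have "tensor \<sigma> \<tau> h \<le> tensor \<sigma> \<tau> (\<lambda>z. B * (\<psi> (fst z) * \<psi> (snd z)))"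
      proof (rule posfun_mono[OF tensor_pos[OF that] h Cc_cmult[OF Cc_product[OF \<psi>(1) \<psi>(1)]]])
        show "h z \<le> B * (\<psi> (fst z) * \<psi> (snd z))" for z
          unfolding h_def using B(2)[of z] \<psi>(2) by (intro mult_right_mono) auto
      qed
      then show ?thesis
        using posfun_cmult[OF tensor_pos[OF that] Cc_product[OF \<psi>(1) \<psi>(1)]]
          tensor_product_fun[OF \<psi>(1) \<psi>(1) posfun_linfun[OF that(1)] posfun_linfun[OF that(2)]] by simp
    qed
    moreover have "tensor ?p ?p f - tensor ?p ?p h \<le> B * (?p \<xi> * e + e * ?p \<xi>)"
    proof -
      have d: "(\<lambda>x. \<xi> x - \<psi> x) \<in> Cc" using \<xi>(1) \<psi>(1) by simp
      \<comment> \<open>Telescoping: \<xi> \<otimes> \<xi> - \<psi> \<otimes> \<psi> = \<xi>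
        \<otimes> (\<xi> - \<psi>) + (\<xi> - \<psi>) \<otimes> \<psi>, each term with a factor of
        small integral.\<close>
      let ?u = "\<lambda>z. \<xi> (fst z) * (\<xi> (snd z) - \<psi> (snd z))" and ?v = "\<lambda>z. (\<xi> (fst z) - \<psi> (fst z)) * \<psi> (snd z)"
      have uv: "?u \<in> Cc" "?v \<in> Cc" by (rule Cc_product[OF \<xi>(1) d], rule Cc_product[OF d \<psi>(1)])
      have "tensor ?p ?p (\<lambda>z. f z - h z) \<le> tensor ?p ?p (\<lambda>z. B * (?u z + ?v z))"
      proof (rule posfun_mono[OF t(1) Cc_ops(2)[OF f(1) h] Cc_cmult[OF Cc_ops(1)[OF uv]]])
        fix z :: "'a \<times> 'a"
        show "f z - h z \<le> B * (?u z + ?v z)"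
        proof (cases "z \<in> func_support f")
          case True
          then have "\<xi> (fst z) = 1" "\<xi> (snd z) = 1" using \<xi>(4) by auto
          then have "?u z + ?v z = 1 - \<psi> (fst z) * \<psi> (snd z)" by (simp add: algebra_simps)
          moreover have "f z - h z = f z * (1 - \<psi> (fst z) * \<psi> (snd z))"
            by (simp add: h_def algebra_simps)
          moreover have "\<psi> (fst z) * \<psi> (snd z) \<le> 1" using \<psi>(2) \<psi>1 by (simp add: mult_le_one)
          ultimately show ?thesis using B(2)[of z] by (simp add: mult_right_mono)
        next
          case False
          then show ?thesis using CcD(3)[OF f(1) False] B(1) \<xi>(2) \<psi>(2,3) by (simp add: h_def)
        qed
      qed
      also have "\<dots> = B * (?p \<xi> * (?p \<xi> - ?p \<psi>) + (?p \<xi> - ?p \<psi>) * ?p \<psi>)"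
        using posfun_cmult[OF t(1) Cc_ops(1)[OF uv]] posfun_add[OF t(1) uv]
          tensor_product_fun[OF \<xi>(1) d posfun_linfun[OF pp(1)] posfun_linfun[OF pp(1)]]
          tensor_product_fun[OF d \<psi>(1) posfun_linfun[OF pp(1)] posfun_linfun[OF pp(1)]]
          posfun_diff[OF pp(1) \<xi>(1) \<psi>(1)] by simp
      also have "\<dots> \<le> B * (?p \<xi> * e + e * ?p \<xi>)"
        using B(1) \<psi>(5) posfun_nonneg[OF pp(1) \<xi>(1,2)] posfun_nonneg[OF pp(1) \<psi>(1,2)]
          posfun_mono[OF pp(1) \<psi>(1) \<xi>(1) \<psi>(3)] e
        by (intro mult_left_mono add_mono mult_mono) auto
      finally show ?thesis
        using posfun_diff[OF t(1) f(1) h] by simp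
    qed
    moreover have "B * (?p \<psi> * ?n \<psi>) \<le> B * (?p \<xi> * e)" "B * (?n \<psi> * ?p \<psi>) \<le> B * (e * ?p \<xi>)"
      using B(1) \<psi>(4) posfun_nonneg[OF pp(1) \<xi>(1,2)] posfun_nonneg[OF pp(1) \<psi>(1,2)] posfun_nonneg[OF pp(2) \<psi>(1,2)]
        posfun_mono[OF pp(1) \<psi>(1) \<xi>(1) \<psi>(3)] e
      by (intro mult_left_mono mult_mono; simp)+
    ultimately show ?thesis
      using b[OF pp] b[OF pp(2) pp(1)] h by (simp add: algebra_simps)
  qed
  then show ?thesis
    unfolding T using le_of_le_add_epsilon[OF *] B(1) posfun_nonneg[OF pp(1) \<xi>(1,2)] by simp
qed

text \<open>Finite energy of a signed \<omega> controls the Jordan parts of its tensor square; by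
  domination this passes to the energy of its positive part.\<close>

lemma pos_part_Eplus:
  assumes "\<omega> \<in> finite_energy \<kappa>"
  shows "pos_part \<omega> \<in> Eplus"
proof -
  have r: "\<omega> \<in> radon" and d: "integral_defined (tensor \<omega> \<omega>) \<kappa>" "\<bar>signed_integral (tensor \<omega> \<omega>) \<kappa>\<bar> \<noteq> \<infinity>"
    using assms by (auto simp: finite_energy_def energy_defined_def energy_def)
  have ob: "order_bounded \<omega>" by (rule radon_order_bounded[OF r])
  note pp = posfun_pos_part[OF ob] posfun_neg_part[OF ob]
  note t = tensor_pos[OF pp(1) pp(1)] tensor_pos[OF pp(2) pp(2)] tensor_pos[OF pp] tensor_pos[OF pp(2) pp(1)]
  note m = posfun_ops(1)[OF t(1,2)] posfun_ops(1)[OF t(3,4)]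
  have T: "tensor \<omega> \<omega> = radon_diff (radon_add (tensor (pos_part \<omega>) (pos_part \<omega>)) (tensor (neg_part \<omega>) (neg_part \<omega>)))
      (radon_add (tensor (pos_part \<omega>) (neg_part \<omega>)) (tensor (neg_part \<omega>) (pos_part \<omega>)))" (is "_ = ?T")
    using tensor_radon_diff[OF pp] jordan_decomposition[OF ob] by simp
  have "pos_integral (pos_part ?T) \<kappa> \<noteq> \<infinity>"
    using finite_signed_integral(1)[OF m Phi] d unfolding T by blast
  then have "pos_integral (tensor (pos_part \<omega>) (pos_part \<omega>)) \<kappa> \<noteq> \<infinity>"
    using pos_integral_dominated_finite[OF t(1) posfun_pos_part[OF order_bounded_radon_diff(1)[OF m]] Phi]
      tensor_pos_part_le[OF ob] unfolding T by blast
  then show ?thesis using pp(1) by (simp add: Eplus_iff)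
qed

text \<open>Nonnegativity of the kernel makes energy monotone in the measure, so cutting off is
  harmless.\<close>

lemma Eplus_dominated:
  assumes "posfun \<sigma>" "\<tau> \<in> Eplus" "\<And>z. 0 \<le> \<kappa> z"
    and "\<And>\<phi>. \<phi> \<in> Cc \<Longrightarrow> (\<And>x. 0 \<le> \<phi> x) \<Longrightarrow> \<sigma> \<phi> \<le> \<tau> \<phi>"
  shows "\<sigma> \<in> Eplus" "mut \<sigma> \<sigma> \<le> mut \<tau> \<tau>"
proof -
  have p: "posfun \<tau>" using EplusD[OF assms(2)] .
  have le: "pos_integral (tensor \<sigma> \<sigma>) \<kappa> \<le> pos_integral (tensor \<tau> \<tau>) \<kappa>"
    by (rule pos_integral_dominated_mono[OF tensor_pos[OF assms(1,1)] tensor_pos[OF p p] Phi assms(3)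
          tensor_mono[OF lc assms(1) p assms(1) p assms(4) assms(4)]])
  then show s: "\<sigma> \<in> Eplus" using mut_eq[OF assms(2,2)] assms(1) by (auto simp: Eplus_iff)
  show "mut \<sigma> \<sigma> \<le> mut \<tau> \<tau>" using le mut_eq[OF assms(2,2)] mut_eq[OF s s] by simp
qed

lemma mut_nonneg_kernel:
  assumes "\<sigma> \<in> Eplus" "\<tau> \<in> Eplus" "\<And>z. 0 \<le> \<kappa> z"
  shows "0 \<le> mut \<sigma> \<tau>"
proof -
  have "ereal (tensor \<sigma> \<tau> (\<lambda>z. 0)) \<le> pos_integral (tensor \<sigma> \<tau>) \<kappa>"
    by (rule pos_integral_upper) (use assms(3) in \<open>auto simp: zero_ereal_def[symmetric]\<close>)
  then show ?thesis
    using posfun_zero[OF tensor_pos[OF EplusD[OF assms(1)] EplusD[OF assms(2)]]]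
      mut_eq[OF assms(1,2)] by simp
qed

lemma radon_mult_Eplus:
  assumes "\<sigma> \<in> Eplus" "\<And>z. 0 \<le> \<kappa> z" "\<theta> \<in> Cc" "\<And>x. 0 \<le> \<theta> x" "\<And>x. \<theta> x \<le> 1"
  shows "radon_mult \<theta> \<sigma> \<in> Eplus" "mut (radon_mult \<theta> \<sigma>) (radon_mult \<theta> \<sigma>) \<le> mut \<sigma> \<sigma>"
proof -
  note p = EplusD[OF assms(1)]
  have p': "posfun (radon_mult \<theta> \<sigma>)" by (rule posfun_mult[OF p CcD(1)[OF assms(3)] assms(4)])
  have le: "radon_mult \<theta> \<sigma> \<phi> \<le> \<sigma> \<phi>" if \<phi>: "\<phi> \<in> Cc" "\<And>x. 0 \<le> \<phi> x" for \<phi>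
  proof -
    have "\<sigma> (\<lambda>x. \<theta> x * \<phi> x) \<le> \<sigma> \<phi>"
      by (rule posfun_mono[OF p Cc_ops(3)[OF assms(3) \<phi>(1)] \<phi>(1)])
         (use assms(4,5) \<phi>(2) in \<open>simp add: mult_left_le_one_le\<close>)
    then show ?thesis using \<phi>(1) by simp
  qed
  show "radon_mult \<theta> \<sigma> \<in> Eplus" "mut (radon_mult \<theta> \<sigma>) (radon_mult \<theta> \<sigma>) \<le> mut \<sigma> \<sigma>"
    by (rule Eplus_dominated[OF p' assms(1,2) le]; assumption)+
qed

section \<open>Capacity\<close>

definition unit_measures :: "'a set \<Rightarrow> 'a functional set" where
  "unit_measures E = {\<nu> \<in> Eplus. compact (meas_support \<nu>) \<and> meas_support \<nu> \<subseteq> E \<and> pos_integral \<nu> (\<lambda>_. 1) = 1}"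

lemma inner_capacity_eq: "inner_capacity \<kappa> E = 1 / (INF \<nu>\<in>unit_measures E. ereal (mut \<nu> \<nu>))"
proof -
  have "energy \<kappa> \<nu> \<nu> = ereal (mut \<nu> \<nu>)" if "\<nu> \<in> Eplus" for \<nu>
    using energy_posfun(2)[OF EplusD[OF that] EplusD[OF that]] mut_eq[OF that that] by simp
  then show ?thesis
    unfolding inner_capacity_def unit_measures_def by (intro arg_cong[of _ _ "\<lambda>x. 1 / x"] INF_cong) auto
qed

lemma INF_energy_nonneg: "0 \<le> (INF \<nu>\<in>unit_measures E. ereal (mut \<nu> \<nu>))"
  by (rule INF_greatest) (auto simp: unit_measures_def mut_nonneg)

text \<open>A test measure has finite energy, so a single one makes the infimum finite and its
  reciprocal positive, or \<infinity> if the infimum is 0.\<close>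

lemma capacity_zeroD:
  assumes "inner_capacity \<kappa> E = 0"
  shows "unit_measures E = {}"
proof (rule ccontr)
  assume "unit_measures E \<noteq> {}"
  then obtain \<nu> where "\<nu> \<in> unit_measures E" by blast
  then have "(INF \<nu>\<in>unit_measures E. ereal (mut \<nu> \<nu>)) \<le> ereal (mut \<nu> \<nu>)" by (rule INF_lower)
  then obtain r where "(INF \<nu>\<in>unit_measures E. ereal (mut \<nu> \<nu>)) = ereal r" "0 \<le> r"
    using INF_energy_nonneg[of E] by (cases "INF \<nu>\<in>unit_measures E. ereal (mut \<nu> \<nu>)") auto
  then show False
    using assms by (cases "r = 0") (auto simp: inner_capacity_eq one_ereal_def)
qed

lemma capacity_finiteD:
  assumes "inner_capacity \<kappa> E < \<infinity>"
  obtains c where "0 < c" "\<And>\<nu>. \<nu> \<in> unit_measures E \<Longrightarrow> c \<le> mut \<nu> \<nu>"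
proof -
  let ?i = "INF \<nu>\<in>unit_measures E. ereal (mut \<nu> \<nu>)"
  have "?i \<noteq> 0" using assms by (auto simp: inner_capacity_eq)
  then have "0 < ?i" using INF_energy_nonneg[of E] by (simp add: order_less_le)
  then obtain c where c: "0 < ereal c" "ereal c < ?i"
    using ereal_dense2 by blast
  have "c \<le> mut \<nu> \<nu>" if "\<nu> \<in> unit_measures E" for \<nu>
  proof -
    have "ereal c < ereal (mut \<nu> \<nu>)" using c(2) INF_lower[OF that, of "\<lambda>\<nu>. ereal (mut \<nu> \<nu>)"] by (rule less_le_trans)
    then show ?thesis by simp
  qed
  then show thesis using c(1) by (intro that[of c]) auto
qed

lemma normalized_unit_measure:
  assumes "\<nu> \<in> Eplus" "compact (meas_support \<nu>)" "meas_support \<nu> \<subseteq> E"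
    and "pos_integral \<nu> (\<lambda>_. 1) = ereal m" "0 < m"
  shows "radon_scale (1 / m) \<nu> \<in> unit_measures E"
    "meas_support (radon_scale (1 / m) \<nu>) \<subseteq> meas_support \<nu>"
    "mut (radon_scale (1 / m) \<nu>) (radon_scale (1 / m) \<nu>) = mut \<nu> \<nu> / m\<^sup>2"
proof -
  have c: "0 < 1 / m" using assms(5) by simp
  show s: "meas_support (radon_scale (1 / m) \<nu>) \<subseteq> meas_support \<nu>"
    by (rule meas_support_scale[OF lc EplusD[OF assms(1)]]) (use c in simp)
  have "pos_integral (radon_scale (1 / m) \<nu>) (\<lambda>_. 1) = 1"
    using pos_integral_scale[OF c one_Phi, of \<nu>] assms(4,5) by (simp add: one_ereal_def)
  then show "radon_scale (1 / m) \<nu> \<in> unit_measures E"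
    using s assms(3) Eplus_scale[OF assms(1) c] compact_meas_support_subset[OF s assms(2)]
    by (auto simp: unit_measures_def)
  show "mut (radon_scale (1 / m) \<nu>) (radon_scale (1 / m) \<nu>) = mut \<nu> \<nu> / m\<^sup>2"
    using assms(1) c by (simp add: mut_simps power2_eq_square)
qed

lemma unit_measures_mid:
  assumes "\<sigma> \<in> unit_measures E" "\<tau> \<in> unit_measures E"
  shows "radon_mid \<sigma> \<tau> \<in> unit_measures E"
proof -
  have E: "\<sigma> \<in> Eplus" "\<tau> \<in> Eplus" using assms by (auto simp: unit_measures_def)
  have s: "meas_support (radon_mid \<sigma> \<tau>) \<subseteq> meas_support \<sigma> \<union> meas_support \<tau>"
    by (rule meas_support_mid[OF lc EplusD[OF E(1)] EplusD[OF E(2)]])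
  have "compact (meas_support \<sigma> \<union> meas_support \<tau>)" using assms by (auto simp: unit_measures_def)
  from compact_meas_support_subset[OF s this] have c: "compact (meas_support (radon_mid \<sigma> \<tau>))" .
  have "pos_integral (radon_add \<sigma> \<tau>) (\<lambda>_. 1) = 1 + 1"
    using pos_integral_add[OF EplusD[OF E(1)] EplusD[OF E(2)] one_Phi] assms by (simp add: unit_measures_def)
  then have "pos_integral (radon_mid \<sigma> \<tau>) (\<lambda>_. 1) = 1"
    unfolding radon_mid_def using pos_integral_scale[OF _ one_Phi, of "1/2" "radon_add \<sigma> \<tau>"] by (simp add: one_ereal_def)
  then show ?thesis using Eplus_mid[OF E] s c assms by (auto simp: unit_measures_def)
qed

section \<open>Sets of capacity zero are negligible for measures of finite energy\<close>

lemma closure_of_vague_le: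
  fixes \<nu> :: "'b::t2_space functional"
  assumes "\<nu> \<in> vague closure_of W" "\<phi> \<in> Cc" "\<And>\<tau>. \<tau> \<in> W \<Longrightarrow> \<tau> \<phi> \<le> c"
  shows "\<nu> \<phi> \<le> c"
proof -
  have c: "continuous_map vague euclideanreal (\<lambda>\<nu>. \<nu> \<phi>)"
    unfolding vague_def
    using continuous_map_product_projection[OF assms(2), of "\<lambda>_. euclideanreal"]
    by (auto intro: continuous_map_from_subtopology)
  have "closedin vague {\<nu> \<in> topspace vague. \<nu> \<phi> \<in> {..c}}"
    by (rule closedin_continuous_map_preimage[OF c]) simp
  moreover have "topspace vague \<inter> W \<subseteq> {\<nu> \<in> topspace vague. \<nu> \<phi> \<in> {..c}}" using assms(3) by auto
  ultimately have "vague closure_of (topspace vague \<inter> W) \<subseteq> {\<nu> \<in> topspace vague. \<nu> \<phi> \<in> {..c}}"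
    by (intro closure_of_minimal)
  moreover have "\<nu> \<in> vague closure_of (topspace vague \<inter> W)"
    using assms(1) closure_of_restrict[of vague W] by simp
  ultimately show ?thesis by auto
qed

text \<open>
  A vague cluster point of the measures \<open>\<psi>\<sigma>\<close>, as \<open>\<psi>\<close> decreases to the indicator of \<open>L\<close>, plays the
  role of the restriction of \<open>\<sigma>\<close> to \<open>L\<close>.
\<close>

lemma outer_content_zero:
  assumes \<sigma>: "\<sigma> \<in> Eplus" and \<kappa>: "\<And>z. 0 \<le> \<kappa> z" and L: "compact L" "unit_measures L = {}" and d: "0 < d"
  shows "\<exists>\<psi>\<in>Cc. (\<forall>x. 0 \<le> \<psi> x) \<and> (\<forall>x\<in>L. \<psi> x = 1) \<and> \<sigma> \<psi> < d"
proof (rule ccontr)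
  note p = EplusD[OF \<sigma>]
  define \<Psi> where "\<Psi> = {\<psi> \<in> Cc. (\<forall>x. 0 \<le> \<psi> x \<and> \<psi> x \<le> 1) \<and> (\<forall>x\<in>L. \<psi> x = 1)}"
  assume no: "\<not> ?thesis"
  have big: "d \<le> \<sigma> \<psi>" if "\<psi> \<in> \<Psi>" for \<psi>
    using no that unfolding \<Psi>_def by (auto simp: not_less)
  define W where "W \<psi>0 = {radon_mult \<psi> \<sigma> |\<psi>. \<psi> \<in> \<Psi> \<and> (\<forall>x. \<psi> x \<le> \<psi>0 x)}" for \<psi>0
  have P: "posfun (radon_mult \<psi> \<sigma>)" if "\<psi> \<in> \<Psi>" for \<psi>
    using that by (intro posfun_mult[OF p]) (auto simp: \<Psi>_def CcD)
  have le: "radon_mult \<psi> \<sigma> \<phi> \<le> \<sigma> \<phi>" if "\<psi> \<in> \<Psi>" "\<phi> \<in> Cc" "\<And>x. 0 \<le> \<phi> x" for \<psi> \<phi>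
  proof -
    have "\<psi> \<in> Cc" using that(1) by (simp add: \<Psi>_def)
    then have "\<sigma> (\<lambda>x. \<psi> x * \<phi> x) \<le> \<sigma> \<phi>"
      using that by (intro posfun_mono[OF p Cc_ops(3) that(2)]) (auto simp: \<Psi>_def mult_left_le_one_le)
    then show ?thesis using that(2) by simp
  qed
  let ?K = "{\<nu> \<in> radon_pos (UNIV :: 'a set). \<forall>\<phi>\<in>Cc. \<bar>\<nu> \<phi>\<bar> \<le> \<sigma> (\<lambda>x. \<bar>\<phi> x\<bar>)}"
  have K: "compactin vague ?K" by (rule compactin_vague_bounded[OF lc closed_UNIV])
  have WK: "W \<psi>0 \<subseteq> ?K" for \<psi>0
  proof
    fix \<tau> assume "\<tau> \<in> W \<psi>0"
    then obtain \<psi> where \<psi>: "\<psi> \<in> \<Psi>" "\<tau> = radon_mult \<psi> \<sigma>" by (auto simp: W_def)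
    have "\<bar>\<tau> \<phi>\<bar> \<le> \<sigma> (\<lambda>x. \<bar>\<phi> x\<bar>)" if "\<phi> \<in> Cc" for \<phi>
      using order_trans[OF posfun_abs[OF P[OF \<psi>(1)] that] le[OF \<psi>(1) Cc_pos(3)[OF that]]] \<psi>(2) by simp
    then show "\<tau> \<in> ?K" using radon_pos_UNIV[OF lc] P[OF \<psi>(1)] \<psi>(2) by auto
  qed
  obtain \<psi>1 where "\<psi>1 \<in> Cc" "\<And>x. 0 \<le> \<psi>1 x" "\<And>x. \<psi>1 x \<le> 1" "\<And>x. x \<in> L \<Longrightarrow> \<psi>1 x = 1"
    using bump_function[OF lc L(1) open_UNIV] by (metis subset_UNIV)
  then have \<psi>1: "\<psi>1 \<in> \<Psi>" by (simp add: \<Psi>_def)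
  let ?\<U> = "(\<lambda>\<psi>0. vague closure_of W \<psi>0) ` \<Psi>"
  \<comment> \<open>The minimum of finitely many cutoffs is again a cutoff, so finitely many
    closures share a measure.\<close>
  have "?K \<inter> \<Inter>\<F> \<noteq> {}" if \<F>: "finite \<F>" "\<F> \<subseteq> ?\<U>" for \<F>
  proof -
    obtain G where G: "finite G" "G \<subseteq> \<Psi>" "\<F> = (\<lambda>\<psi>0. vague closure_of W \<psi>0) ` G"
      using finite_subset_image[OF \<F>] by auto
    have "\<exists>\<psi>\<in>\<Psi>. \<forall>\<psi>0\<in>G. \<forall>x. \<psi> x \<le> \<psi>0 x" using G(1,2)
    proof (induction G)
      case empty
      then show ?case using \<psi>1 by auto
    next
      case (insert \<psi>' G)
      then obtain \<psi> where \<psi>: "\<psi> \<in> \<Psi>" "\<forall>\<psi>0\<in>G. \<forall>x. \<psi> x \<le> \<psi>0 x" by auto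
      have "(\<lambda>x. min (\<psi> x) (\<psi>' x)) \<in> \<Psi>"
        using \<psi>(1) insert.prems Cc_ops(5)[of \<psi> \<psi>'] by (auto simp: \<Psi>_def min_le_iff_disj)
      then show ?case
        by (rule rev_bexI) (use \<psi>(2) in \<open>auto simp: min_le_iff_disj\<close>)
    qed
    then obtain \<psi> where \<psi>: "\<psi> \<in> \<Psi>" "\<forall>\<psi>0\<in>G. \<forall>x. \<psi> x \<le> \<psi>0 x" by blast
    have "radon_mult \<psi> \<sigma> \<in> ?K" using WK[of \<psi>] \<psi>(1) by (auto simp: W_def)
    moreover have "radon_mult \<psi> \<sigma> \<in> vague closure_of W \<psi>0" if "\<psi>0 \<in> G" for \<psi>0
    proof -
      have "radon_mult \<psi> \<sigma> \<in> W \<psi>0" using \<psi> that by (auto simp: W_def)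
      moreover have "W \<psi>0 \<subseteq> topspace vague" using WK compactin_subset_topspace[OF K] by (rule order_trans)
      ultimately show ?thesis using closure_of_subset by blast
    qed
    ultimately show ?thesis unfolding G(3) by blast
  qed
  then have "?K \<inter> \<Inter>?\<U> \<noteq> {}"
    using K unfolding compactin_fip by (elim conjE allE[of _ ?\<U>]) auto
  then obtain \<nu> where \<nu>: "\<nu> \<in> ?K" "\<And>\<psi>0. \<psi>0 \<in> \<Psi> \<Longrightarrow> \<nu> \<in> vague closure_of W \<psi>0" by blast
  have \<nu>p: "posfun \<nu>" using \<nu>(1) radon_pos_UNIV[OF lc] by auto
  have ge: "c \<le> \<nu> \<phi>" if "\<psi>0 \<in> \<Psi>" "\<phi> \<in> Cc" "\<And>\<tau>. \<tau> \<in> W \<psi>0 \<Longrightarrow> c \<le> \<tau> \<phi>" for \<psi>0 \<phi> c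
  proof -
    have "\<nu> (\<lambda>x. - \<phi> x) \<le> - c"
    proof (rule closure_of_vague_le[OF \<nu>(2)[OF that(1)] Cc_minus[OF that(2)]])
      fix \<tau> assume \<tau>: "\<tau> \<in> W \<psi>0"
      then have "linfun \<tau>" using P by (auto simp: W_def)
      then show "\<tau> (\<lambda>x. - \<phi> x) \<le> - c" using linfun_minus[of \<tau> \<phi>] that(2) that(3)[OF \<tau>] by simp
    qed
    then show ?thesis using posfun_minus[OF \<nu>p that(2)] by simp
  qed
  have \<nu>_le: "\<nu> \<phi> \<le> \<sigma> \<phi>" if "\<phi> \<in> Cc" "\<And>x. 0 \<le> \<phi> x" for \<phi>
    by (rule closure_of_vague_le[OF \<nu>(2)[OF \<psi>1] that(1)]) (use le that in \<open>auto simp: W_def\<close>)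
  have \<nu>E: "\<nu> \<in> Eplus" by (rule Eplus_dominated(1)[OF \<nu>p \<sigma> \<kappa> \<nu>_le])
  have "\<nu> \<phi> = 0" if \<phi>: "\<phi> \<in> Cc" "func_support \<phi> \<inter> L = {}" for \<phi>
  proof -
    have o: "open (- func_support \<phi>)" and sb: "L \<subseteq> - func_support \<phi>" using \<phi>(2) by (auto simp: func_support_def open_Compl)
    \<comment> \<open>A cutoff living off the support of \<phi>: every measure in
      \<open>W \<psi>0\<close> vanishes on \<phi>, hence so does the cluster point.\<close>
    obtain \<psi>0 where \<psi>0: "\<psi>0 \<in> Cc" "\<And>x. 0 \<le> \<psi>0 x" "\<And>x. \<psi>0 x \<le> 1" "\<And>x. x \<in> L \<Longrightarrow> \<psi>0 x = 1"
        "func_support \<psi>0 \<subseteq> - func_support \<phi>"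
      using bump_function[OF lc L(1) o sb] by metis
    then have "\<psi>0 \<in> \<Psi>" by (simp add: \<Psi>_def)
    have z: "\<tau> \<phi> = 0" if "\<tau> \<in> W \<psi>0" for \<tau>
    proof -
      obtain \<psi> where \<psi>: "\<psi> \<in> \<Psi>" "\<And>x. \<psi> x \<le> \<psi>0 x" "\<tau> = radon_mult \<psi> \<sigma>" using \<open>\<tau> \<in> W \<psi>0\<close> by (auto simp: W_def)
      have "\<psi> x * \<phi> x = 0" for x
      proof (cases "x \<in> func_support \<phi>")
        case True
        then have "\<psi>0 x = 0" using CcD(3)[OF \<psi>0(1)] \<psi>0(5) by auto
        moreover have "0 \<le> \<psi> x" using \<psi>(1) by (simp add: \<Psi>_def)
        ultimately show ?thesis using \<psi>(2)[of x] by simp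
      qed (use CcD(3)[OF \<phi>(1)] in simp)
      then have "(\<lambda>x. \<psi> x * \<phi> x) = (\<lambda>x. 0)" by (rule ext)
      then show ?thesis using \<psi>(3) \<phi>(1) posfun_zero[OF p] by simp
    qed
    show ?thesis
    proof (rule antisym)
      show "\<nu> \<phi> \<le> 0" by (rule closure_of_vague_le[OF \<nu>(2)[OF \<open>\<psi>0 \<in> \<Psi>\<close>] \<phi>(1)]) (simp add: z)
      show "0 \<le> \<nu> \<phi>" by (rule ge[OF \<open>\<psi>0 \<in> \<Psi>\<close> \<phi>(1)]) (simp add: z)
    qed
  qed
  then have sL: "meas_support \<nu> \<subseteq> L"
    using meas_support_subset_iff[OF lc \<nu>p compact_imp_closed[OF L(1)]] by blast
  \<comment> \<open>No mass is lost: the measure with density \<psi> takes at \<psi>1 the value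
    \<sigma> (\<psi> \<psi>1), and this product is again in \<open>\<Psi>\<close>.\<close>
  have "d \<le> \<nu> \<psi>1"
  proof (rule ge[OF \<psi>1])
    show "\<psi>1 \<in> Cc" using \<psi>1 by (simp add: \<Psi>_def)
    fix \<tau> assume "\<tau> \<in> W \<psi>1"
    then obtain \<psi> where \<psi>: "\<psi> \<in> \<Psi>" "\<tau> = radon_mult \<psi> \<sigma>" by (auto simp: W_def)
    have "(\<lambda>x. \<psi> x * \<psi>1 x) \<in> \<Psi>" using \<psi>(1) \<psi>1 Cc_ops(3)[of \<psi> \<psi>1] by (simp add: \<Psi>_def mult_le_one)
    then show "d \<le> \<tau> \<psi>1" using big \<psi>(2) \<open>\<psi>1 \<in> Cc\<close> by simp
  qed
  moreover have "pos_integral \<nu> (\<lambda>_. 1) = ereal (\<nu> \<psi>1)"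
    by (rule mass_compact_support[OF lc \<nu>p sL]) (use \<psi>1 in \<open>auto simp: \<Psi>_def\<close>)
  ultimately have "radon_scale (1 / \<nu> \<psi>1) \<nu> \<in> unit_measures L"
    using d by (intro normalized_unit_measure(1)[OF \<nu>E compact_meas_support_subset[OF sL L(1)] sL]) auto
  then show False using L(2) by simp
qed

text \<open>
  The exceptional set meets each \<open>{p \<le> h - \<epsilon>}\<close> in a closed set, where \<open>p\<close> is the potential of
  \<open>\<tau>\<close>; so only compact sets of capacity zero have to be removed.
\<close>

lemma integral_le_of_nearly_everywhere:
  assumes \<sigma>: "\<sigma> \<in> Eplus" "meas_support \<sigma> \<subseteq> E" "closed E" and \<kappa>: "\<And>z. 0 \<le> \<kappa> z" and \<tau>: "posfun \<tau>"
    and h: "continuous_on UNIV h" "\<And>x. 0 \<le> h x"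
    and ex: "\<And>L. compact L \<Longrightarrow> L \<subseteq> {x\<in>E. pos_integral \<tau> (\<lambda>y. \<kappa> (x, y)) < ereal (h x)} \<Longrightarrow> unit_measures L = {}"
    and \<theta>: "\<theta> \<in> Cc" "\<And>x. 0 \<le> \<theta> x" "\<And>x. \<theta> x \<le> 1"
  shows "ereal (\<sigma> (\<lambda>x. h x * \<theta> x)) \<le> pos_integral (tensor \<sigma> \<tau>) \<kappa>"
proof -
  let ?I = "pos_integral (tensor \<sigma> \<tau>) \<kappa>" and ?p = "\<lambda>x. pos_integral \<tau> (\<lambda>y. \<kappa> (x, y))"
  note p = EplusD[OF \<sigma>(1)]
  have h\<theta>: "(\<lambda>x. h x * \<theta> x) \<in> Cc" by (rule Cc_mult(1)[OF \<theta>(1) h(1)])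
  obtain H where H: "0 \<le> H" "\<And>x. \<bar>h x * \<theta> x\<bar> \<le> H" using Cc_bounded[OF h\<theta>] by blast
  have p0: "0 \<le> ?p x" for x
  proof -
    have "ereal (\<tau> (\<lambda>y. 0)) \<le> ?p x"
      by (rule pos_integral_upper) (use \<kappa> in \<open>auto simp: zero_ereal_def[symmetric]\<close>)
    then show ?thesis using posfun_zero[OF \<tau>] by (simp add: zero_ereal_def)
  qed
  have *: "ereal (\<sigma> (\<lambda>x. h x * \<theta> x) - e * (\<sigma> \<theta> + H)) \<le> ?I" if e: "0 < e" for e
  proof -
    let ?G = "{x. ereal (h x - e) < ?p x}"
    have G: "open ?G"
      by (rule open_potential_greater[OF lc lc Phi \<kappa> \<tau>]) (intro continuous_intros h)
    let ?L = "(func_support \<theta> \<inter> E) \<inter> (- ?G)"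
    have L: "compact ?L"
      using CcD(2)[OF \<theta>(1)] \<sigma>(3) G by (intro compact_Int_closed closed_Compl)
    have "?L \<subseteq> {x\<in>E. ?p x < ereal (h x)}"
    proof
      fix x assume "x \<in> ?L"
      then have "x \<in> E" "?p x \<le> ereal (h x - e)" by (auto simp: not_less)
      moreover have "ereal (h x - e) < ereal (h x)" using e by simp
      ultimately show "x \<in> {x\<in>E. ?p x < ereal (h x)}" using le_less_trans by blast
    qed
    from outer_content_zero[OF \<sigma>(1) \<kappa> L ex[OF L this] e]
    obtain \<psi> where \<psi>: "\<psi> \<in> Cc" "\<And>x. 0 \<le> \<psi> x" "\<And>x. x \<in> ?L \<Longrightarrow> \<psi> x = 1" "\<sigma> \<psi> < e" by blast
    \<comment> \<open>A minorant of the potential on \<open>E\<close>: the term with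
      \<open>H\<close> makes it nonpositive on \<open>?L\<close>, and the term with \<open>e\<close>
      lowers it to the level h - e that the potential exceeds on the rest of the support of
      \<theta>.\<close>
    let ?f = "\<lambda>x. (h x * \<theta> x - e * \<theta> x) - H * \<psi> x"
    have f: "?f \<in> Cc" by (intro Cc_ops(2) h\<theta> Cc_cmult \<theta>(1) \<psi>(1))
    have "ereal (?f x) \<le> ?p x" if x: "x \<in> E" for x
    proof (cases "x \<in> ?L")
      case True
      have "0 \<le> e * \<theta> x" using e \<theta>(2) by simp
      then have "?f x \<le> 0" using H(2)[of x] \<psi>(3)[OF True] by (simp add: abs_le_iff)
      then have "ereal (?f x) \<le> 0" by (simp add: zero_ereal_def)
      then show ?thesis using p0 by (rule order_trans)
    next
      case False
      have H\<psi>: "0 \<le> H * \<psi> x" using H(1) \<psi>(2) by simp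
      show ?thesis
      proof (cases "x \<in> func_support \<theta> \<and> 0 \<le> h x - e")
        case True
        then have 1: "ereal (h x - e) \<le> ?p x" using False x by (auto intro: less_imp_le)
        have "?f x \<le> h x - e"
          using H\<psi> True \<theta>(2,3)[of x] mult_left_le[of "\<theta> x" "h x - e"] by (simp add: algebra_simps)
        then have "ereal (?f x) \<le> ereal (h x - e)" by simp
        then show ?thesis using 1 by (rule order_trans)
      next
        case False
        have "(h x - e) * \<theta> x \<le> 0"
          using False CcD(3)[OF \<theta>(1), of x] \<theta>(2)[of x] by (auto simp: mult_le_0_iff)
        then have "?f x \<le> 0" using H\<psi> by (simp add: algebra_simps)
        then have "ereal (?f x) \<le> 0" by (simp add: zero_ereal_def)
        then show ?thesis using p0 by (rule order_trans)
      qed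
    qed
    then have "ereal (\<sigma> ?f) \<le> ?I"
      by (rule integral_potential_le[OF lc lc Phi \<kappa> \<tau> p \<sigma>(2,3) f])
    moreover have "\<sigma> ?f = \<sigma> (\<lambda>x. h x * \<theta> x) - e * \<sigma> \<theta> - H * \<sigma> \<psi>"
      using posfun_diff[OF p Cc_ops(2)[OF h\<theta> Cc_cmult[OF \<theta>(1)]] Cc_cmult[OF \<psi>(1)]]
        posfun_diff[OF p h\<theta> Cc_cmult[OF \<theta>(1)]]
        posfun_cmult[OF p \<theta>(1)] posfun_cmult[OF p \<psi>(1)] by simp
    moreover have "H * \<sigma> \<psi> \<le> e * H" using \<psi>(4) H(1) by (simp add: mult.commute mult_left_mono)
    ultimately have "\<sigma> (\<lambda>x. h x * \<theta> x) - e * (\<sigma> \<theta> + H) \<le> \<sigma> ?f" "ereal (\<sigma> ?f) \<le> ?I"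
      by (simp_all add: algebra_simps)
    then show ?thesis using order_trans[of _ "ereal (\<sigma> ?f)" ?I] by simp
  qed
  show ?thesis
  proof (cases ?I)
    case (real r)
    have "\<sigma> (\<lambda>x. h x * \<theta> x) \<le> r + e * (\<sigma> \<theta> + H)" if "0 < e" for e using *[OF that] real by simp
    then have "\<sigma> (\<lambda>x. h x * \<theta> x) \<le> r"
      using le_of_le_add_epsilon[of "\<sigma> (\<lambda>x. h x * \<theta> x)" r "\<sigma> \<theta> + H"] posfun_nonneg[OF p \<theta>(1,2)] H(1) by simp
    then show ?thesis using real by simp
  next
    case MInf
    then show ?thesis using *[of 1] by simp
  qed simp
qed

end

section \<open>Consistent kernels\<close>

locale consistent_kernel = pd_kernel +
  assumes cons: "consistent \<kappa>"
begin

text \<open>Consistency for an indexed family: the filter is pushed forward along \<open>T\<close>,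
  and a vague limit is in particular a vague cluster point.\<close>

lemma strong_convergence:
  fixes T :: "'x \<Rightarrow> 'a functional"
  assumes F: "F \<noteq> bot" and E: "\<forall>\<^sub>F x in F. T x \<in> Eplus"
    and cauchy: "\<And>e. 0 < e \<Longrightarrow> \<exists>Z. eventually (\<lambda>x. x \<in> Z) F \<and> (\<forall>x\<in>Z. \<forall>y\<in>Z. dist2 (T x) (T y) < e)"
    and \<nu>: "posfun \<nu>" and lim: "\<And>\<phi>. \<phi> \<in> Cc \<Longrightarrow> ((\<lambda>x. T x \<phi>) \<longlongrightarrow> \<nu> \<phi>) F"
  shows "\<nu> \<in> Eplus" "((\<lambda>x. dist2 (T x) \<nu>) \<longlongrightarrow> 0) F"
proof -
  let ?F = "filtermap T F"
  have 1: "?F \<noteq> bot" using F by (simp add: filtermap_bot_iff)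
  have 2: "\<forall>\<^sub>F \<sigma> in ?F. \<sigma> \<in> Eplus" using E by (simp add: eventually_filtermap)
  have 3: "\<forall>\<^sub>F (\<sigma>, \<tau>) in ?F \<times>\<^sub>F ?F. strong_norm \<kappa> (radon_diff \<sigma> \<tau>) < \<epsilon>" if \<epsilon>: "0 < \<epsilon>" for \<epsilon>
  proof -
    have "0 < \<epsilon>\<^sup>2" using \<epsilon> by simp
    from cauchy[OF this] obtain Z where Z: "eventually (\<lambda>x. x \<in> Z) F" "\<forall>x\<in>Z. \<forall>y\<in>Z. dist2 (T x) (T y) < \<epsilon>\<^sup>2"
      by blast
    let ?P = "\<lambda>\<sigma>. \<sigma> \<in> T ` Z \<and> \<sigma> \<in> Eplus"
    have P: "eventually ?P ?F"
      unfolding eventually_filtermap using Z(1) E by eventually_elim auto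
    have "strong_norm \<kappa> (radon_diff \<sigma> \<tau>) < \<epsilon>" if "?P \<sigma>" "?P \<tau>" for \<sigma> \<tau>
    proof -
      have "dist2 \<sigma> \<tau> < \<epsilon>\<^sup>2" using that Z(2) by auto
      then have "sqrt (dist2 \<sigma> \<tau>) < \<epsilon>" using \<epsilon> real_less_lsqrt[of \<epsilon> "dist2 \<sigma> \<tau>"]
        energy_radon_diff(3)[of \<sigma> \<tau>] that by simp
      then show ?thesis using strong_norm_radon_diff that by simp
    qed
    then show ?thesis
      unfolding eventually_prod_filter using P by (intro exI[of _ ?P] conjI) auto
  qed
  have r: "\<nu> \<in> radon" by (rule posfun_radon[OF lc \<nu>])
  have "\<forall>\<^sub>F x in F. T x \<in> radon"
    using E by eventually_elim (use posfun_radon[OF lc] EplusD in blast)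
  then have l: "limitin vague T \<nu> F" by (intro limitin_vague r lim)
  have 4: "\<exists>\<^sub>F \<sigma> in ?F. \<sigma> \<in> U" if "openin vague U" "\<nu> \<in> U" for U
  proof -
    have "\<forall>\<^sub>F x in F. T x \<in> U" using l that unfolding limitin_def by blast
    then have "\<forall>\<^sub>F \<sigma> in ?F. \<sigma> \<in> U" by (simp add: eventually_filtermap)
    then show ?thesis by (rule eventually_frequently[OF 1])
  qed
  have c: "\<nu> \<in> finite_energy \<kappa>" "((\<lambda>\<sigma>. strong_norm \<kappa> (radon_diff \<sigma> \<nu>)) \<longlongrightarrow> 0) ?F"
    using conjunct2[OF cons[unfolded consistent_def], rule_format, of ?F \<nu>] 1 2 3 4 r by blast+
  show \<nu>E: "\<nu> \<in> Eplus"
    using c(1) \<nu> radon_pos_UNIV[OF lc, of \<nu> UNIV] by (simp add: finite_energy_pos_def)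
  have "((\<lambda>x. strong_norm \<kappa> (radon_diff (T x) \<nu>)) \<longlongrightarrow> 0) F"
    using c(2) by (simp add: filterlim_filtermap)
  then have "((\<lambda>x. (strong_norm \<kappa> (radon_diff (T x) \<nu>))\<^sup>2) \<longlongrightarrow> 0\<^sup>2) F" by (rule tendsto_power)
  then have t: "((\<lambda>x. (strong_norm \<kappa> (radon_diff (T x) \<nu>))\<^sup>2) \<longlongrightarrow> 0) F" by simp
  have e: "\<forall>\<^sub>F x in F. (strong_norm \<kappa> (radon_diff (T x) \<nu>))\<^sup>2 = dist2 (T x) \<nu>"
    using E by eventually_elim (simp add: strong_norm_radon_diff[OF _ \<nu>E] energy_radon_diff(3)[OF _ \<nu>E])
  show "((\<lambda>x. dist2 (T x) \<nu>) \<longlongrightarrow> 0) F"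
    using t unfolding tendsto_cong[OF e] .
qed

text \<open>
  Unit measures of bounded energy escaping every compact set would yield a Cauchy filter with
  vague limit \<open>0\<close>, hence by consistency unit measures of arbitrarily small energy.
\<close>

lemma capacity_tail:
  assumes fin: "inner_capacity \<kappa> E < \<infinity>" and M: "0 < M"
  shows "\<exists>K. compact K \<and> (\<forall>\<nu>\<in>Eplus. \<forall>m\<ge>0. compact (meas_support \<nu>) \<and> meas_support \<nu> \<subseteq> E \<and>
    meas_support \<nu> \<inter> K = {} \<and> pos_integral \<nu> (\<lambda>_. 1) = ereal m \<longrightarrow> M * m\<^sup>2 \<le> mut \<nu> \<nu>)"
proof (rule ccontr)
  assume no: "\<not> ?thesis"
  define W where "W K = {\<nu> \<in> unit_measures E. meas_support \<nu> \<inter> K = {}}" for K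
  have WE: "\<nu> \<in> Eplus" if "\<nu> \<in> W K" for \<nu> K using that by (simp add: W_def unit_measures_def)
  \<comment> \<open>Both sides of the negated inequality are homogeneous of degree two, so
    normalizing the mass to 1 leaves energy at most \<open>M\<close>.\<close>
  have small: "\<exists>\<nu>\<in>W K. mut \<nu> \<nu> \<le> M" if K: "compact K" for K
  proof -
    obtain \<nu> m where \<nu>: "\<nu> \<in> Eplus" "compact (meas_support \<nu>)" "meas_support \<nu> \<subseteq> E" "meas_support \<nu> \<inter> K = {}"
      "pos_integral \<nu> (\<lambda>_. 1) = ereal m" "0 \<le> m" "mut \<nu> \<nu> < M * m\<^sup>2"
      using no K by (auto simp: not_le)
    have "m \<noteq> 0" using \<nu>(7) mut_nonneg[OF \<nu>(1)] by auto
    then have m: "0 < m" using \<nu>(6) by simp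
    note n = normalized_unit_measure[OF \<nu>(1-3,5) m]
    have "radon_scale (1 / m) \<nu> \<in> W K" using n(1,2) \<nu>(4) by (auto simp: W_def)
    moreover have "mut \<nu> \<nu> / m\<^sup>2 \<le> M" using \<nu>(7) m by (simp add: field_simps)
    ultimately show ?thesis using n(3) by metis
  qed
  let ?\<W> = "W ` Collect compact"
  have "\<exists>F. F \<noteq> bot \<and> (\<forall>V\<in>?\<W>. eventually (\<lambda>x. x \<in> V) F) \<and>
    (\<forall>e>0. \<exists>Z. eventually (\<lambda>x. x \<in> Z) F \<and> (\<forall>x\<in>Z. \<forall>y\<in>Z. dist2 x y < e))"
  proof (rule cauchy_filter_of_convex_sets[where f = "\<lambda>\<nu>. mut \<nu> \<nu>" and C = M])
    show "?\<W> \<noteq> {}" by (auto intro: exI[of _ "{}"])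
  next
    fix V1 V2 assume "V1 \<in> ?\<W>" "V2 \<in> ?\<W>"
    then obtain K1 K2 where K: "compact K1" "compact K2" "V1 = W K1" "V2 = W K2" by auto
    then show "\<exists>U\<in>?\<W>. U \<subseteq> V1 \<inter> V2"
      by (intro bexI[of _ "W (K1 \<union> K2)"]) (auto simp: W_def)
  next
    fix V assume "V \<in> ?\<W>"
    then show "\<exists>x\<in>V. mut x x \<le> M" using small by auto
  next
    fix V \<nu> assume "V \<in> ?\<W>" "\<nu> \<in> V"
    then show "0 \<le> mut \<nu> \<nu>" using WE mut_nonneg by blast
  next
    fix V \<sigma> \<tau> assume V: "V \<in> ?\<W>" "\<sigma> \<in> V" "\<tau> \<in> V"
    then obtain K where K: "V = W K" by auto
    have E: "\<sigma> \<in> Eplus" "\<tau> \<in> Eplus" using V K WE by auto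
    have "radon_mid \<sigma> \<tau> \<in> V"
      using V(2,3) unit_measures_mid[of \<sigma> E \<tau>] meas_support_mid[OF lc EplusD[OF E(1)] EplusD[OF E(2)]]
      unfolding K W_def by blast
    then show "\<exists>z\<in>V. mut z z \<le> (mut \<sigma> \<sigma> + mut \<tau> \<tau>) / 2 - dist2 \<sigma> \<tau> / 4"
      using mut_mid[OF E] by (intro bexI[of _ "radon_mid \<sigma> \<tau>"]) auto
  qed
  then obtain F where F: "F \<noteq> bot" "\<And>K. compact K \<Longrightarrow> eventually (\<lambda>x. x \<in> W K) F"
      "\<And>e. 0 < e \<Longrightarrow> \<exists>Z. eventually (\<lambda>x. x \<in> Z) F \<and> (\<forall>x\<in>Z. \<forall>y\<in>Z. dist2 x y < e)"
    by auto
  have EF: "\<forall>\<^sub>F \<nu> in F. \<nu> \<in> Eplus"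
    using F(2)[OF compact_empty] by eventually_elim (rule WE)
  let ?z = "\<lambda>\<phi>\<in>(Cc :: ('a \<Rightarrow> real) set). 0 :: real"
  have "((\<lambda>\<nu>. dist2 \<nu> ?z) \<longlongrightarrow> 0) F"
  proof (rule strong_convergence(2)[OF F(1) EF F(3)])
    \<comment> \<open>Measures in \<open>W K\<close> vanish on \<phi> as soon as \<open>K\<close>
      contains its support; taking \<open>K\<close> to be that support gives the vague limit
      0.\<close>
    fix \<phi> :: "'a \<Rightarrow> real" assume \<phi>: "\<phi> \<in> Cc"
    have "\<forall>\<^sub>F \<nu> in F. \<nu> \<phi> = ?z \<phi>"
      using F(2)[OF CcD(2)[OF \<phi>]]
    proof eventually_elim
      case (elim \<nu>)
      then have "func_support \<phi> \<inter> meas_support \<nu> = {}" by (auto simp: W_def)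
      then show ?case
        using posfun_eq_0_off_support[OF lc EplusD[OF WE[OF elim]] order_refl \<phi>] \<phi> by simp
    qed
    then show "((\<lambda>\<nu>. \<nu> \<phi>) \<longlongrightarrow> ?z \<phi>) F" by (rule tendsto_eventually)
  qed simp_all
  moreover have "\<forall>\<^sub>F \<nu> in F. dist2 \<nu> ?z = mut \<nu> \<nu>"
    using EF by eventually_elim (rule dist2_zero)
  ultimately have lim: "((\<lambda>\<nu>. mut \<nu> \<nu>) \<longlongrightarrow> 0) F" by (rule Lim_transform_eventually)
  obtain c where c: "0 < c" "\<And>\<nu>. \<nu> \<in> unit_measures E \<Longrightarrow> c \<le> mut \<nu> \<nu>"
    using capacity_finiteD[OF fin] by blast
  have "\<forall>\<^sub>F \<nu> in F. c \<le> mut \<nu> \<nu>"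
    using F(2)[OF compact_empty] by eventually_elim (simp add: W_def c(2))
  then have "c \<le> 0" using tendsto_lowerbound[OF lim _ F(1)] by simp
  then show False using c(1) by simp
qed

section \<open>Uniform integrability and tightness on one plate\<close>

definition tail_controlled :: "'a set \<Rightarrow> ('a \<Rightarrow> real) \<Rightarrow> bool" where
  "tail_controlled E g \<longleftrightarrow> (\<exists>G. \<forall>x\<in>E. g x \<le> G) \<or>
     (\<exists>r>1. \<exists>\<omega>\<in>finite_energy \<kappa>. nearly_everywhere \<kappa> E
        (\<lambda>x. potential_defined \<kappa> x \<omega> \<and> ereal (g x powr r) \<le> potential \<kappa> x \<omega>))"

text \<open>For \<kappa> \<ge> 0 the potential of \<open>\<omega>\<close> is at most that of
  \<open>pos_part \<omega>\<close>, so the latter falls below g^r only on the exceptional set.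
  Integration against \<sigma> yields a mutual energy, which the two energies bound.\<close>

lemma moment_bound:
  assumes \<kappa>: "\<And>z. 0 \<le> \<kappa> z" and E: "closed E" and g: "continuous_on UNIV g" "\<And>x. 0 < g x"
    and r: "1 < r" "\<omega> \<in> finite_energy \<kappa>"
    and ne: "nearly_everywhere \<kappa> E (\<lambda>x. potential_defined \<kappa> x \<omega> \<and> ereal (g x powr r) \<le> potential \<kappa> x \<omega>)"
    and \<sigma>: "\<sigma> \<in> Eplus" "meas_support \<sigma> \<subseteq> E" and \<theta>: "\<theta> \<in> Cc" "\<And>x. 0 \<le> \<theta> x" "\<And>x. \<theta> x \<le> 1"
  shows "\<sigma> (\<lambda>x. g x powr r * \<theta> x) \<le> mut \<sigma> \<sigma> + mut (pos_part \<omega>) (pos_part \<omega>)"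
proof -
  let ?\<tau> = "pos_part \<omega>"
  have \<tau>: "?\<tau> \<in> Eplus" by (rule pos_part_Eplus[OF r(2)])
  have "\<omega> \<in> radon" using r(2) by (simp add: finite_energy_def)
  then have n: "posfun (neg_part \<omega>)" by (intro posfun_neg_part radon_order_bounded)
  have gr: "continuous_on UNIV (\<lambda>x. g x powr r)"
    using less_imp_neq[OF g(2)] by (intro continuous_on_powr g(1) continuous_on_const) (metis)
  let ?X = "{x\<in>E. \<not> (potential_defined \<kappa> x \<omega> \<and> ereal (g x powr r) \<le> potential \<kappa> x \<omega>)}"
  have X: "unit_measures ?X = {}"
    using ne unfolding nearly_everywhere_def by (rule capacity_zeroD)
  have sub: "{x\<in>E. pos_integral ?\<tau> (\<lambda>y. \<kappa> (x, y)) < ereal (g x powr r)} \<subseteq> ?X"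
  proof clarify
    fix x assume x: "pos_integral ?\<tau> (\<lambda>y. \<kappa> (x, y)) < ereal (g x powr r)" "ereal (g x powr r) \<le> potential \<kappa> x \<omega>"
    have "ereal (neg_part \<omega> (\<lambda>y. 0)) \<le> pos_integral (neg_part \<omega>) (\<lambda>y. \<kappa> (x, y))"
      by (rule pos_integral_upper) (use \<kappa> in \<open>auto simp: zero_ereal_def[symmetric]\<close>)
    then have "0 \<le> pos_integral (neg_part \<omega>) (\<lambda>y. \<kappa> (x, y))"
      using posfun_zero[OF n] by (simp add: zero_ereal_def)
    then have "potential \<kappa> x \<omega> \<le> pos_integral ?\<tau> (\<lambda>y. \<kappa> (x, y))"
      unfolding potential_def signed_integral_def
      by (cases "pos_integral ?\<tau> (\<lambda>y. \<kappa> (x, y))"; cases "pos_integral (neg_part \<omega>) (\<lambda>y. \<kappa> (x, y))") auto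
    with x show False by simp
  qed
  have "ereal (\<sigma> (\<lambda>x. g x powr r * \<theta> x)) \<le> pos_integral (tensor \<sigma> ?\<tau>) \<kappa>"
  proof (rule integral_le_of_nearly_everywhere[OF \<sigma> E \<kappa> EplusD[OF \<tau>] gr _ _ \<theta>])
    fix L assume "compact L" "L \<subseteq> {x\<in>E. pos_integral ?\<tau> (\<lambda>y. \<kappa> (x, y)) < ereal (g x powr r)}"
    then have "L \<subseteq> ?X" using sub by blast
    then have "unit_measures L \<subseteq> unit_measures ?X" unfolding unit_measures_def by blast
    then show "unit_measures L = {}" using X by blast
  qed simp
  then have "\<sigma> (\<lambda>x. g x powr r * \<theta> x) \<le> mut \<sigma> ?\<tau>" using mut_eq[OF \<sigma>(1) \<tau>] by simp
  also have "\<dots> \<le> mut \<sigma> \<sigma> + mut ?\<tau> ?\<tau>"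
    using mut_sum_le[OF \<sigma>(1) \<tau>] mut_nonneg_kernel[OF \<tau> \<sigma>(1) \<kappa>] by simp
  finally show ?thesis .
qed

text \<open>Splits g into a bounded part and a small multiple of g^r: above T, y = y^(1-r) y^r, and
  y^(1-r) decreases in y.\<close>

lemma powr_truncation:
  fixes y T r :: real
  assumes "0 < y" "0 < T" "1 < r"
  shows "y \<le> T + T powr (1 - r) * y powr r"
proof (cases "y \<le> T")
  case True
  then show ?thesis using assms by (simp add: add_increasing2)
next
  case False
  then have "y powr (1 - r) \<le> T powr (1 - r)" using assms by (intro powr_mono2') auto
  then have "y powr (1 - r) * y powr r \<le> T powr (1 - r) * y powr r" by (intro mult_right_mono) auto
  moreover have "y powr (1 - r) * y powr r = y" using assms by (simp add: powr_add[symmetric])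
  ultimately show ?thesis using assms by simp
qed

text \<open>Uniform integrability: \<open>T\<close> depends on \<open>B\<close> and
  \<open>d\<close>, but neither on the measure nor on the cutoff.\<close>

lemma truncated_integral_bound:
  assumes \<kappa>: "\<And>z. 0 \<le> \<kappa> z" and E: "closed E" and g: "continuous_on UNIV g" "\<And>x. 0 < g x"
    and tc: "tail_controlled E g" and B: "0 \<le> B" and d: "0 < d"
  obtains T where "0 \<le> T"
    "\<And>\<sigma> \<theta>. \<sigma> \<in> Eplus \<Longrightarrow> meas_support \<sigma> \<subseteq> E \<Longrightarrow> mut \<sigma> \<sigma> \<le> B \<Longrightarrow>
      \<theta> \<in> Cc \<Longrightarrow> (\<And>x. 0 \<le> \<theta> x) \<Longrightarrow> (\<And>x. \<theta> x \<le> 1) \<Longrightarrow> \<sigma> (\<lambda>x. g x * \<theta> x) \<le> T * \<sigma> \<theta> + d"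
  using tc unfolding tail_controlled_def
proof (elim disjE exE bexE conjE)
  fix G assume G: "\<forall>x\<in>E. g x \<le> G"
  show thesis
  proof (rule that[of "max G 0"])
    fix \<sigma> and \<theta> :: "'a \<Rightarrow> real" assume \<sigma>: "\<sigma> \<in> Eplus" "meas_support \<sigma> \<subseteq> E" and \<theta>: "\<theta> \<in> Cc" "\<And>x. 0 \<le> \<theta> x"
    have "\<sigma> (\<lambda>x. g x * \<theta> x) \<le> \<sigma> (\<lambda>x. max G 0 * \<theta> x)"
    proof (rule posfun_mono_on_support[OF lc EplusD[OF \<sigma>(1)] \<sigma>(2) Cc_mult(1)[OF \<theta>(1) g(1)] Cc_cmult[OF \<theta>(1)]])
      fix x assume "x \<in> E"
      then show "g x * \<theta> x \<le> max G 0 * \<theta> x" using G \<theta>(2) by (intro mult_right_mono) (auto simp: le_max_iff_disj)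
    qed
    then show "\<sigma> (\<lambda>x. g x * \<theta> x) \<le> max G 0 * \<sigma> \<theta> + d"
      using posfun_cmult[OF EplusD[OF \<sigma>(1)] \<theta>(1), of "max G 0"] d by simp
  qed simp
next
  fix r \<omega> assume r: "1 < r" "\<omega> \<in> finite_energy \<kappa>"
    and ne: "nearly_everywhere \<kappa> E (\<lambda>x. potential_defined \<kappa> x \<omega> \<and> ereal (g x powr r) \<le> potential \<kappa> x \<omega>)"
  define H where "H = B + mut (pos_part \<omega>) (pos_part \<omega>)"
  have H: "0 \<le> H" unfolding H_def using B mut_nonneg[OF pos_part_Eplus[OF r(2)]] by simp
  \<comment> \<open>Chosen so that T^(1-r) = 1 / (H/d + 1), whence T^(1-r) H \<le> d; the summand 1
    covers H = 0.\<close>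
  define T where "T = (H / d + 1) powr (1 / (r - 1))"
  have pos: "0 < H / d + 1" using H d by (simp add: add_nonneg_pos)
  then have T: "0 < T" unfolding T_def by simp
  have "T powr (1 - r) = (H / d + 1) powr (- 1)"
    unfolding T_def powr_powr using r(1) by (intro arg_cong2[of _ _ _ _ "(powr)"]) (auto simp: field_simps)
  also have "\<dots> = 1 / (H / d + 1)" using pos by (simp add: powr_minus_divide)
  finally have "T powr (1 - r) * H = H / (H / d + 1)" by simp
  also have "\<dots> \<le> d" using H d pos by (simp add: field_simps)
  finally have TH: "T powr (1 - r) * H \<le> d" .
  show thesis
  proof (rule that[of T])
    fix \<sigma> and \<theta> :: "'a \<Rightarrow> real" assume \<sigma>: "\<sigma> \<in> Eplus" "meas_support \<sigma> \<subseteq> E" "mut \<sigma> \<sigma> \<le> B"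
      and \<theta>: "\<theta> \<in> Cc" "\<And>x. 0 \<le> \<theta> x" "\<And>x. \<theta> x \<le> 1"
    note p = EplusD[OF \<sigma>(1)]
    have gr: "continuous_on UNIV (\<lambda>x. g x powr r)"
      using less_imp_neq[OF g(2)] by (intro continuous_on_powr g(1) continuous_on_const) (metis)
    have c: "(\<lambda>x. g x powr r * \<theta> x) \<in> Cc" by (rule Cc_mult(1)[OF \<theta>(1) gr])
    have "\<sigma> (\<lambda>x. g x * \<theta> x) \<le> \<sigma> (\<lambda>x. T * \<theta> x + T powr (1 - r) * (g x powr r * \<theta> x))"
    proof (rule posfun_mono[OF p Cc_mult(1)[OF \<theta>(1) g(1)] Cc_ops(1)[OF Cc_cmult[OF \<theta>(1)] Cc_cmult[OF c]]])
      fix x show "g x * \<theta> x \<le> T * \<theta> x + T powr (1 - r) * (g x powr r * \<theta> x)"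
        using mult_right_mono[OF powr_truncation[OF g(2) T r(1)] \<theta>(2)[of x], of x] by (simp add: algebra_simps)
    qed
    also have "\<dots> = T * \<sigma> \<theta> + T powr (1 - r) * \<sigma> (\<lambda>x. g x powr r * \<theta> x)"
      using posfun_add[OF p Cc_cmult[OF \<theta>(1)] Cc_cmult[OF c]]
        posfun_cmult[OF p \<theta>(1)] posfun_cmult[OF p c] by simp
    also have "\<sigma> (\<lambda>x. g x powr r * \<theta> x) \<le> H"
      using moment_bound[OF \<kappa> E g r ne \<sigma>(1,2) \<theta>] \<sigma>(3) by (simp add: H_def)
    then have "T * \<sigma> \<theta> + T powr (1 - r) * \<sigma> (\<lambda>x. g x powr r * \<theta> x) \<le> T * \<sigma> \<theta> + T powr (1 - r) * H"
      by (intro add_left_mono mult_left_mono) auto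
    finally show "\<sigma> (\<lambda>x. g x * \<theta> x) \<le> T * \<sigma> \<theta> + d" using TH by simp
  qed (use T in simp)
qed

text \<open>Outside the cutoff the integral of g is at most T times a mass plus d/2, and
  \<open>capacity_tail\<close> makes T times that mass at most d/2 if the cutoff captures a large
  enough compact set.\<close>

lemma tightness:
  assumes \<kappa>: "\<And>z. 0 \<le> \<kappa> z" and E: "closed E" and g: "continuous_on UNIV g" "\<And>x. 0 < g x"
    and tc: "tail_controlled E g" and fin: "inner_capacity \<kappa> E < \<infinity>" and B: "0 \<le> B" and d: "0 < d"
  obtains \<eta> where "\<eta> \<in> Cc" "\<And>x. 0 \<le> \<eta> x" "\<And>x. \<eta> x \<le> 1"
    "\<And>\<sigma>. \<sigma> \<in> Eplus \<Longrightarrow> meas_support \<sigma> \<subseteq> E \<Longrightarrow> mut \<sigma> \<sigma> \<le> B \<Longrightarrow>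
      pos_integral \<sigma> (\<lambda>x. ereal (g x)) \<le> ereal (\<sigma> (\<lambda>x. g x * \<eta> x) + d)"
proof -
  have d2: "0 < d / 2" using d by simp
  obtain T where T: "0 \<le> T"
    "\<And>\<sigma> \<theta>. \<sigma> \<in> Eplus \<Longrightarrow> meas_support \<sigma> \<subseteq> E \<Longrightarrow> mut \<sigma> \<sigma> \<le> B \<Longrightarrow>
      \<theta> \<in> Cc \<Longrightarrow> (\<And>x. 0 \<le> \<theta> x) \<Longrightarrow> (\<And>x. \<theta> x \<le> 1) \<Longrightarrow> \<sigma> (\<lambda>x. g x * \<theta> x) \<le> T * \<sigma> \<theta> + d / 2"
    using truncated_integral_bound[OF \<kappa> E g tc B d2] by blast
  \<comment> \<open>From M (\<sigma> \<theta>)^2 \<le> B and this \<open>M\<close> follows T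
    (\<sigma> \<theta>) \<le> d/2; the summand 1 keeps \<open>M\<close> positive.\<close>
  define M where "M = 4 * T\<^sup>2 * B / d\<^sup>2 + 1"
  have M: "0 < M" unfolding M_def using B d by (simp add: add_nonneg_pos)
  obtain K where K: "compact K"
    "\<forall>\<nu>\<in>Eplus. \<forall>m\<ge>0. compact (meas_support \<nu>) \<and> meas_support \<nu> \<subseteq> E \<and>
      meas_support \<nu> \<inter> K = {} \<and> pos_integral \<nu> (\<lambda>_. 1) = ereal m \<longrightarrow> M * m\<^sup>2 \<le> mut \<nu> \<nu>"
    using capacity_tail[OF fin M] by (elim exE conjE)
  obtain \<zeta> where \<zeta>: "\<zeta> \<in> Cc" "\<And>x. 0 \<le> \<zeta> x" "\<And>x. x \<in> K \<Longrightarrow> \<zeta> x = 1"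
    using bump_function[OF lc K(1) open_UNIV] by (metis subset_UNIV)
  \<comment> \<open>Doubling makes \<eta> equal to 1 wherever \<zeta> \<ge> 1/2, a neighbourhood of
    \<open>K\<close>. So the closed support of a multiple of 1 - \<eta> misses \<open>K\<close>;
    with \<zeta> in place of \<eta> it could touch \<open>K\<close>.\<close>
  define \<eta> where "\<eta> = (\<lambda>x. min (2 * \<zeta> x) 1)"
  have c\<zeta>: "continuous_on UNIV \<zeta>" by (rule CcD(1)[OF \<zeta>(1)])
  have c\<eta>: "continuous_on UNIV \<eta>" unfolding \<eta>_def by (intro continuous_intros c\<zeta>)
  have \<eta>: "\<eta> \<in> Cc"
    by (rule CcI[OF c\<eta> CcD(2)[OF \<zeta>(1)]]) (use CcD(3)[OF \<zeta>(1)] in \<open>simp add: \<eta>_def\<close>)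
  have \<eta>0: "0 \<le> \<eta> x" and \<eta>1: "\<eta> x \<le> 1" for x using \<zeta>(2)[of x] by (auto simp: \<eta>_def)
  show thesis
  proof (rule that[OF \<eta> \<eta>0 \<eta>1])
    fix \<sigma> assume \<sigma>: "\<sigma> \<in> Eplus" "meas_support \<sigma> \<subseteq> E" "mut \<sigma> \<sigma> \<le> B"
    note p = EplusD[OF \<sigma>(1)]
    show "pos_integral \<sigma> (\<lambda>x. ereal (g x)) \<le> ereal (\<sigma> (\<lambda>x. g x * \<eta> x) + d)"
    proof (rule pos_integral_least)
      fix \<phi> :: "'a \<Rightarrow> real" assume \<phi>: "\<phi> \<in> Cc" "\<And>x. ereal (\<phi> x) \<le> ereal (g x)"
      obtain \<xi> where \<xi>: "\<xi> \<in> Cc" "\<And>x. 0 \<le> \<xi> x" "\<And>x. \<xi> x \<le> 1" "\<And>x. x \<in> func_support \<phi> \<Longrightarrow> \<xi> x = 1"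
        using bump_function[OF lc CcD(2)[OF \<phi>(1)] open_UNIV] by (metis subset_UNIV)
      \<comment> \<open>The competing \<phi> has compact support, so 1 - \<eta> may be cut off by
        \<xi> without spoiling the comparison.\<close>
      define \<theta> where "\<theta> = (\<lambda>x. (1 - \<eta> x) * \<xi> x)"
      have \<theta>: "\<theta> \<in> Cc" unfolding \<theta>_def by (intro Cc_mult(1)[OF \<xi>(1)] continuous_intros c\<eta>)
      have \<theta>0: "0 \<le> \<theta> x" and \<theta>1: "\<theta> x \<le> 1" for x
        using \<eta>0[of x] \<eta>1[of x] \<xi>(2,3)[of x] by (auto simp: \<theta>_def mult_le_one)
      let ?\<nu> = "radon_mult \<theta> \<sigma>"
      have \<nu>: "?\<nu> \<in> Eplus" "mut ?\<nu> ?\<nu> \<le> B"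
        using radon_mult_Eplus[OF \<sigma>(1) \<kappa> \<theta> \<theta>0 \<theta>1] \<sigma>(3) by auto
      have s: "meas_support ?\<nu> \<subseteq> meas_support \<sigma> \<inter> func_support \<theta>"
        by (rule meas_support_mult[OF lc p \<theta> \<theta>0])
      have cs: "compact (meas_support ?\<nu>)"
        using compact_meas_support_subset[OF _ CcD(2)[OF \<theta>]] s by blast
      have "func_support \<theta> \<subseteq> {x. \<zeta> x \<le> 1 / 2}"
        by (rule func_support_subset[OF closed_Collect_le[OF c\<zeta> continuous_on_const]])
           (auto simp: \<theta>_def \<eta>_def)
      then have disj: "meas_support ?\<nu> \<inter> K = {}" using s \<zeta>(3) by fastforce
      obtain \<xi>' where \<xi>': "\<xi>' \<in> Cc" "\<And>x. \<xi>' x \<le> 1" "\<And>x. x \<in> func_support \<theta> \<Longrightarrow> \<xi>' x = 1"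
        using bump_function[OF lc CcD(2)[OF \<theta>] open_UNIV] by (metis subset_UNIV)
      have "(\<lambda>x. \<theta> x * \<xi>' x) = \<theta>" using \<xi>'(3) CcD(3)[OF \<theta>] by force
      then have v: "?\<nu> \<xi>' = \<sigma> \<theta>" using \<xi>'(1) by simp
      have "pos_integral ?\<nu> (\<lambda>_. 1) = ereal (?\<nu> \<xi>')"
        by (rule mass_compact_support[OF lc EplusD[OF \<nu>(1)] _ \<xi>', of "func_support \<theta>"]) (use s in auto)
      then have mass: "pos_integral ?\<nu> (\<lambda>_. 1) = ereal (\<sigma> \<theta>)" using v by simp
      have \<sigma>\<theta>: "0 \<le> \<sigma> \<theta>" by (rule posfun_nonneg[OF p \<theta> \<theta>0])
      have "M * (\<sigma> \<theta>)\<^sup>2 \<le> mut ?\<nu> ?\<nu>"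
        by (rule K(2)[rule_format, OF \<nu>(1) \<sigma>\<theta>]) (use cs disj mass s \<sigma>(2) in blast)
      then have MB: "M * (\<sigma> \<theta>)\<^sup>2 \<le> B" using \<nu>(2) by simp
      have "4 * T\<^sup>2 * (M * (\<sigma> \<theta>)\<^sup>2) \<le> 4 * T\<^sup>2 * B" using MB by (intro mult_left_mono) auto
      also have "\<dots> \<le> d\<^sup>2 * M" unfolding M_def using d by (simp add: field_simps)
      finally have "M * (2 * T * \<sigma> \<theta>)\<^sup>2 \<le> M * d\<^sup>2" by (simp add: power_mult_distrib algebra_simps)
      then have "(2 * T * \<sigma> \<theta>)\<^sup>2 \<le> d\<^sup>2" using M by simp
      then have T\<theta>: "T * \<sigma> \<theta> \<le> d / 2" using power2_le_imp_le[of "2 * T * \<sigma> \<theta>" d] d by simp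
      have g\<eta>: "(\<lambda>x. g x * \<eta> x) \<in> Cc" and g\<theta>: "(\<lambda>x. g x * \<theta> x) \<in> Cc"
        by (rule Cc_mult(1)[OF \<eta> g(1)], rule Cc_mult(1)[OF \<theta> g(1)])
      have "\<sigma> \<phi> \<le> \<sigma> (\<lambda>x. g x * \<eta> x + g x * \<theta> x)"
      proof (rule posfun_mono[OF p \<phi>(1) Cc_ops(1)[OF g\<eta> g\<theta>]])
        fix x
        show "\<phi> x \<le> g x * \<eta> x + g x * \<theta> x"
        proof (cases "x \<in> func_support \<phi>")
          case True
          then show ?thesis using \<phi>(2)[of x] \<xi>(4)[OF True] by (simp add: \<theta>_def algebra_simps)
        next
          case False
          then show ?thesis using CcD(3)[OF \<phi>(1) False] g(2)[of x] \<eta>0[of x] \<theta>0[of x] by simp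
        qed
      qed
      also have "\<dots> = \<sigma> (\<lambda>x. g x * \<eta> x) + \<sigma> (\<lambda>x. g x * \<theta> x)"
        by (rule posfun_add[OF p g\<eta> g\<theta>])
      also have "\<dots> \<le> \<sigma> (\<lambda>x. g x * \<eta> x) + d"
        using T(2)[OF \<sigma> \<theta> \<theta>0 \<theta>1] T\<theta> by simp
      finally show "ereal (\<sigma> \<phi>) \<le> ereal (\<sigma> (\<lambda>x. g x * \<eta> x) + d)" by simp
    qed
  qed
qed

end

section \<open>Condensers\<close>

locale condenser_problem = consistent_kernel +
  fixes P N :: "nat set" and A :: "nat \<Rightarrow> 'a set" and a :: "nat \<Rightarrow> real" and g :: "nat \<Rightarrow> 'a \<Rightarrow> real"
  assumes cond: "condenser P N A"
    and g_cont: "\<And>i. i \<in> P \<union> N \<Longrightarrow> continuous_on UNIV (g i)"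
    and g_pos: "\<And>i x. i \<in> P \<union> N \<Longrightarrow> 0 < g i x"
    and tails: "\<And>i. i \<in> P \<union> N \<Longrightarrow> tail_controlled (A i) (g i)"
    and compact_or_capacity: "\<And>i. i \<in> P \<union> N \<Longrightarrow> compact (A i) \<or> inner_capacity \<kappa> (A i) < \<infinity>"
    and a_pos: "\<And>i. i \<in> P \<union> N \<Longrightarrow> 0 < a i"
    and negative_plates: "N = {} \<or>
         (\<Sum>\<^sub>\<infinity>i\<in>P \<union> N. ennreal (a i) * inverse (INF x\<in>A i. ennreal (g i x))) < \<infinity> \<and>
         (SUP z\<in>(\<Union>i\<in>P. A i) \<times> (\<Union>j\<in>N. A j). \<kappa> z) < \<infinity>"
begin

abbreviation J :: "nat set" where "J \<equiv> P \<union> N"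

abbreviation M :: "(nat \<Rightarrow> 'a functional) set" where "M \<equiv> cond_meas P N A"

abbreviation Adm :: "(nat \<Rightarrow> 'a functional) set" where "Adm \<equiv> admissible \<kappa> P N A a g"

definition meets :: "'a set \<Rightarrow> nat set" where
  "meets K = {i \<in> J. A i \<inter> K \<noteq> {}}"

text \<open>For \<open>Q = P\<close> and \<open>Q = N\<close> these are the positive and the
  negative charge. Each value is a finite sum over the plates that meet the support, even for
  infinite \<open>Q\<close>.\<close>

definition part :: "nat set \<Rightarrow> (nat \<Rightarrow> 'a functional) \<Rightarrow> ('a \<Rightarrow> real) \<Rightarrow> real" where
  "part Q \<mu> = (\<lambda>\<phi>\<in>Cc. \<Sum>i\<in>Q \<inter> meets (func_support \<phi>). \<mu> i \<phi>)"

lemma finite_meets: "compact K \<Longrightarrow> finite (meets K)"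
  using cond by (simp add: condenser_def meets_def)

lemma closed_plate: "i \<in> J \<Longrightarrow> closed (A i)"
  and plate_nonempty: "i \<in> J \<Longrightarrow> A i \<noteq> {}"
  and disjoint_index: "P \<inter> N = {}"
  using cond by (auto simp: condenser_def)

lemma M_D:
  assumes "\<mu> \<in> M" "i \<in> J"
  shows "posfun (\<mu> i)" "meas_support (\<mu> i) \<subseteq> A i"
  using assms radon_pos_UNIV[OF lc, of "\<mu> i" "A i"] by (auto simp: cond_meas_def)

lemma plate_integral_zero:
  assumes "\<mu> \<in> M" "i \<in> J" "\<phi> \<in> Cc" "i \<notin> meets (func_support \<phi>)"
  shows "\<mu> i \<phi> = 0"
  by (rule posfun_eq_0_off_support[OF lc M_D[OF assms(1,2)] assms(3)]) (use assms in \<open>auto simp: meets_def\<close>)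

text \<open>Plates off the support contribute 0, so several test functions can be evaluated over one
  common finite index set.\<close>

lemma part_eq:
  assumes "\<mu> \<in> M" "Q \<subseteq> J" "\<phi> \<in> Cc" "compact K" "func_support \<phi> \<subseteq> K"
  shows "part Q \<mu> \<phi> = (\<Sum>i\<in>Q \<inter> meets K. \<mu> i \<phi>)"
proof -
  have "(\<Sum>i\<in>Q \<inter> meets (func_support \<phi>). \<mu> i \<phi>) = (\<Sum>i\<in>Q \<inter> meets K. \<mu> i \<phi>)"
  proof (rule sum.mono_neutral_left)
    show "finite (Q \<inter> meets K)" using finite_meets[OF assms(4)] by simp
    show "Q \<inter> meets (func_support \<phi>) \<subseteq> Q \<inter> meets K" using assms(5) by (auto simp: meets_def)
    show "\<forall>i\<in>Q \<inter> meets K - Q \<inter> meets (func_support \<phi>). \<mu> i \<phi> = 0"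
      using plate_integral_zero[OF assms(1) _ assms(3)] assms(2) by auto
  qed
  then show ?thesis using assms(3) by (simp add: part_def)
qed

lemma cond_R_eq:
  assumes "\<mu> \<in> M"
  shows "cond_R P N \<mu> = radon_diff (part P \<mu>) (part N \<mu>)"
proof -
  have "(\<Sum>\<^sub>\<infinity>i\<in>J. sign_coeff P i * \<mu> i \<phi>) = part P \<mu> \<phi> - part N \<mu> \<phi>" if \<phi>: "\<phi> \<in> Cc" for \<phi>
  proof -
    let ?m = "meets (func_support \<phi>)"
    have fin: "finite ?m" by (rule finite_meets[OF CcD(2)[OF \<phi>]])
    have "(\<Sum>\<^sub>\<infinity>i\<in>J. sign_coeff P i * \<mu> i \<phi>) = (\<Sum>\<^sub>\<infinity>i\<in>?m. sign_coeff P i * \<mu> i \<phi>)"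
      by (rule infsum_cong_neutral) (use plate_integral_zero[OF assms _ \<phi>] in \<open>auto simp: meets_def\<close>)
    also have "\<dots> = (\<Sum>i\<in>(P \<inter> ?m) \<union> (N \<inter> ?m). sign_coeff P i * \<mu> i \<phi>)"
      using fin by (simp add: infsum_finite) (intro sum.cong, auto simp: meets_def)
    also have "\<dots> = (\<Sum>i\<in>P \<inter> ?m. sign_coeff P i * \<mu> i \<phi>) + (\<Sum>i\<in>N \<inter> ?m. sign_coeff P i * \<mu> i \<phi>)"
      by (rule sum.union_disjoint) (use fin disjoint_index in auto)
    also have "(\<Sum>i\<in>P \<inter> ?m. sign_coeff P i * \<mu> i \<phi>) = (\<Sum>i\<in>P \<inter> ?m. \<mu> i \<phi>)"
      by (rule sum.cong) (auto simp: sign_coeff_def)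
    also have "(\<Sum>i\<in>N \<inter> ?m. sign_coeff P i * \<mu> i \<phi>) = (\<Sum>i\<in>N \<inter> ?m. - \<mu> i \<phi>)"
      by (rule sum.cong) (use disjoint_index in \<open>auto simp: sign_coeff_def\<close>)
    finally show ?thesis using \<phi> by (simp add: part_def sum_negf)
  qed
  then show ?thesis
    unfolding cond_R_def radon_diff_def by (intro restrict_ext)
qed

lemma posfun_part:
  assumes "\<mu> \<in> M" "Q \<subseteq> J"
  shows "posfun (part Q \<mu>)"
proof -
  have l: "linfun (\<mu> i)" if "i \<in> Q" for i using M_D(1)[OF assms(1)] assms(2) that by auto
  note pe = part_eq[OF assms]
  have "linfun (part Q \<mu>)"
    unfolding linfun_def
  proof (intro conjI ballI allI)
    show "part Q \<mu> \<in> extensional Cc" unfolding part_def by (rule restrict_extensional)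
  next
    fix \<phi> \<psi> :: "'a \<Rightarrow> real" assume *: "\<phi> \<in> Cc" "\<psi> \<in> Cc"
    let ?K = "func_support \<phi> \<union> func_support \<psi>"
    have K: "compact ?K" using CcD(2)[OF *(1)] CcD(2)[OF *(2)] by (rule compact_Un)
    have s: "func_support (\<lambda>x. \<phi> x + \<psi> x) \<subseteq> ?K"
      by (rule func_support_subset[OF compact_imp_closed[OF K]]) (use CcD(3)[OF *(1)] CcD(3)[OF *(2)] in simp)
    have "(\<Sum>i\<in>Q \<inter> meets ?K. \<mu> i (\<lambda>x. \<phi> x + \<psi> x)) = (\<Sum>i\<in>Q \<inter> meets ?K. \<mu> i \<phi> + \<mu> i \<psi>)"
      by (rule sum.cong[OF refl]) (use linfun_add[OF l *] in simp)
    then show "part Q \<mu> (\<lambda>x. \<phi> x + \<psi> x) = part Q \<mu> \<phi> + part Q \<mu> \<psi>"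
      using pe[OF Cc_ops(1)[OF *] K s] pe[OF *(1) K] pe[OF *(2) K] by (simp add: sum.distrib)
  next
    fix \<phi> :: "'a \<Rightarrow> real" and c :: real assume *: "\<phi> \<in> Cc"
    let ?K = "func_support \<phi>"
    have K: "compact ?K" using CcD(2)[OF *] .
    have s: "func_support (\<lambda>x. c * \<phi> x) \<subseteq> ?K"
      by (rule func_support_subset[OF compact_imp_closed[OF K]]) (use CcD(3)[OF *] in simp)
    have "(\<Sum>i\<in>Q \<inter> meets ?K. \<mu> i (\<lambda>x. c * \<phi> x)) = (\<Sum>i\<in>Q \<inter> meets ?K. c * \<mu> i \<phi>)"
      by (rule sum.cong[OF refl]) (use linfun_cmult[OF l *] in simp)
    then show "part Q \<mu> (\<lambda>x. c * \<phi> x) = c * part Q \<mu> \<phi>"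
      using pe[OF Cc_cmult[OF *] K s] pe[OF * K] by (simp add: sum_distrib_left)
  qed
  moreover have "0 \<le> part Q \<mu> \<phi>" if "\<phi> \<in> Cc" "\<forall>x. 0 \<le> \<phi> x" for \<phi>
    using posfun_nonneg[OF M_D(1)[OF assms(1)] that(1)] that assms(2) unfolding part_def
    by (auto intro!: sum_nonneg)
  ultimately show ?thesis unfolding posfun_def by blast
qed

text \<open>Carries energy bounds from a whole charge to each of its plates.\<close>

lemma plate_le_part:
  assumes "\<mu> \<in> M" "Q \<subseteq> J" "i \<in> Q" "\<phi> \<in> Cc" "\<And>x. 0 \<le> \<phi> x"
  shows "\<mu> i \<phi> \<le> part Q \<mu> \<phi>"
proof (cases "i \<in> meets (func_support \<phi>)")
  case True
  have "\<mu> i \<phi> \<le> (\<Sum>i\<in>Q \<inter> meets (func_support \<phi>). \<mu> i \<phi>)"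
  proof (rule member_le_sum)
    show "0 \<le> \<mu> j \<phi>" if "j \<in> Q \<inter> meets (func_support \<phi>) - {i}" for j
      using posfun_nonneg[OF M_D(1)[OF assms(1)] assms(4,5)] that assms(2) by auto
  qed (use True assms(3) finite_meets[OF CcD(2)[OF assms(4)]] in auto)
  then show ?thesis using assms(4) by (simp add: part_def)
next
  case False
  then have "\<mu> i \<phi> = 0" using plate_integral_zero[OF assms(1) _ assms(4)] assms(2,3) by auto
  then show ?thesis using posfun_nonneg[OF posfun_part[OF assms(1,2)] assms(4,5)] by simp
qed

section \<open>Admissible measures\<close>

lemma Adm_D:
  assumes "\<mu> \<in> Adm"
  shows "\<mu> \<in> M" "cond_R P N \<mu> \<in> finite_energy \<kappa>"
    "\<And>i. i \<in> J \<Longrightarrow> pos_integral (\<mu> i) (\<lambda>x. ereal (g i x)) = ereal (a i)"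
  using assms by (auto simp: admissible_def cond_finite_energy_def)

text \<open>A Markov inequality. \<open>g i\<close> need not have compact support, so it is cut off
  by \<xi> before the constraint is applied.\<close>

lemma Adm_integral_le:
  assumes \<mu>: "\<mu> \<in> Adm" "i \<in> J" and \<phi>: "\<phi> \<in> Cc" and b: "0 \<le> b" "\<And>x. x \<in> A i \<Longrightarrow> \<phi> x \<le> b * g i x"
  shows "\<mu> i \<phi> \<le> b * a i"
proof -
  note p = M_D[OF Adm_D(1)[OF \<mu>(1)] \<mu>(2)]
  obtain \<xi> where \<xi>: "\<xi> \<in> Cc" "\<And>x. 0 \<le> \<xi> x" "\<And>x. \<xi> x \<le> 1" "\<And>x. x \<in> func_support \<phi> \<Longrightarrow> \<xi> x = 1"
    using bump_function[OF lc CcD(2)[OF \<phi>] open_UNIV] by (metis subset_UNIV)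
  have c: "(\<lambda>x. g i x * \<xi> x) \<in> Cc" by (rule Cc_mult(1)[OF \<xi>(1) g_cont[OF \<mu>(2)]])
  have "\<mu> i \<phi> \<le> \<mu> i (\<lambda>x. b * (g i x * \<xi> x))"
  proof (rule posfun_mono_on_support[OF lc p \<phi> Cc_cmult[OF c]])
    fix x assume x: "x \<in> A i"
    show "\<phi> x \<le> b * (g i x * \<xi> x)"
    proof (cases "x \<in> func_support \<phi>")
      case True
      then show ?thesis using b(2)[OF x] \<xi>(4) by simp
    next
      case False
      then show ?thesis using CcD(3)[OF \<phi>] b(1) g_pos[OF \<mu>(2), of x] \<xi>(2)[of x] by simp
    qed
  qed
  also have "\<dots> = b * \<mu> i (\<lambda>x. g i x * \<xi> x)" by (rule posfun_cmult[OF p(1) c])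
  also have "\<dots> \<le> b * a i"
  proof (rule mult_left_mono[OF _ b(1)])
    have "ereal (\<mu> i (\<lambda>x. g i x * \<xi> x)) \<le> pos_integral (\<mu> i) (\<lambda>x. ereal (g i x))"
      by (rule pos_integral_upper[OF c]) (use \<xi>(3) g_pos[OF \<mu>(2)] in \<open>simp add: mult_left_le less_imp_le\<close>)
    then show "\<mu> i (\<lambda>x. g i x * \<xi> x) \<le> a i" using Adm_D(3)[OF \<mu>] by simp
  qed
  finally show ?thesis .
qed

text \<open>\<phi> divided by \<open>g i\<close> is continuous with compact support, hence bounded,
  so the constraint bounds \<open>\<mu> i \<phi>\<close> uniformly. These are the pointwise bounds
  for vague compactness.\<close>

lemma Adm_bounded:
  obtains c where "\<And>\<mu> i \<phi>. \<mu> \<in> Adm \<Longrightarrow> i \<in> J \<Longrightarrow> \<phi> \<in> Cc \<Longrightarrow> \<bar>\<mu> i \<phi>\<bar> \<le> c i \<phi>"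
proof -
  have "\<exists>c. \<forall>\<mu>\<in>Adm. \<bar>\<mu> i \<phi>\<bar> \<le> c" if i: "i \<in> J" and \<phi>: "\<phi> \<in> Cc" for i \<phi>
  proof -
    have "continuous_on UNIV (\<lambda>x. 1 / g i x)"
      using g_cont[OF i] g_pos[OF i] by (intro continuous_intros) (auto simp: less_imp_neq[symmetric])
    from Cc_mult(1)[OF \<phi> this] have "(\<lambda>x. 1 / g i x * \<phi> x) \<in> Cc" .
    then obtain B where B: "0 \<le> B" "\<And>x. \<bar>1 / g i x * \<phi> x\<bar> \<le> B" using Cc_bounded by blast
    have le: "\<bar>\<phi> x\<bar> \<le> B * g i x" for x
      using B(2)[of x] g_pos[OF i, of x] by (simp add: abs_mult field_simps)
    have "\<bar>\<mu> i \<phi>\<bar> \<le> B * a i" if \<mu>: "\<mu> \<in> Adm" for \<mu>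
      using posfun_abs[OF M_D(1)[OF Adm_D(1)[OF \<mu>] i] \<phi>] Adm_integral_le[OF \<mu> i Cc_pos(3)[OF \<phi>] B(1) le] by simp
    then show ?thesis by blast
  qed
  then have "\<forall>i\<in>J. \<forall>\<phi>\<in>Cc. \<exists>c. \<forall>\<mu>\<in>Adm. \<bar>\<mu> i \<phi>\<bar> \<le> c" by blast
  then obtain c where "\<forall>i\<in>J. \<forall>\<phi>\<in>Cc. \<forall>\<mu>\<in>Adm. \<bar>\<mu> i \<phi>\<bar> \<le> c i \<phi>" by metis
  then show thesis by (intro that[of c]) blast
qed

text \<open>The mass on plate \<open>i\<close> is at most \<open>a i\<close> divided by the infimum
  of \<open>g i\<close>, and these bounds are summable. One \<open>S\<close> serves every \<mu> and
  every set \<open>Q\<close> of plates, hence both charges.\<close>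

lemma total_mass_bound:
  assumes fin: "(\<Sum>\<^sub>\<infinity>i\<in>J. ennreal (a i) * inverse (INF x\<in>A i. ennreal (g i x))) < \<infinity>"
  obtains S where "0 \<le> S"
    "\<And>\<mu> Q \<phi> c. \<mu> \<in> Adm \<Longrightarrow> Q \<subseteq> J \<Longrightarrow> \<phi> \<in> Cc \<Longrightarrow> 0 \<le> c \<Longrightarrow> (\<And>i x. i \<in> Q \<Longrightarrow> x \<in> A i \<Longrightarrow> \<phi> x \<le> c) \<Longrightarrow>
      part Q \<mu> \<phi> \<le> c * S"
proof -
  define t where "t i = ennreal (a i) * inverse (INF x\<in>A i. ennreal (g i x))" for i
  let ?S = "\<Sum>\<^sub>\<infinity>i\<in>J. t i"
  have sum_le: "sum t F \<le> ?S" if "finite F" "F \<subseteq> J" for F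
  proof -
    have "infsum t F \<le> ?S"
      by (rule infsum_mono_neutral) (use that in \<open>auto intro!: nonneg_summable_on_complete\<close>)
    then show ?thesis using that by simp
  qed
  have S: "?S < \<infinity>" using fin by (simp add: t_def)
  have tf: "t i < \<infinity>" if "i \<in> J" for i
    using sum_le[of "{i}"] that S by (simp add: le_less_trans)
  have plate: "\<mu> i \<phi> \<le> c * enn2real (t i)"
    if \<mu>: "\<mu> \<in> Adm" and i: "i \<in> J" and \<phi>: "\<phi> \<in> Cc" and c: "0 \<le> c" "\<And>x. x \<in> A i \<Longrightarrow> \<phi> x \<le> c" for \<mu> i \<phi> c
  proof -
    let ?I = "INF x\<in>A i. ennreal (g i x)"
    obtain x0 where x0: "x0 \<in> A i" using plate_nonempty[OF i] by blast
    have "?I \<le> ennreal (g i x0)" by (rule INF_lower[OF x0])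
    then have "?I < top" by (simp add: le_less_trans)
    then obtain \<gamma> where \<gamma>: "?I = ennreal \<gamma>" "0 \<le> \<gamma>" by (cases ?I) auto
    \<comment> \<open>An infimum 0 would make this term infinite, against summability.\<close>
    have "\<gamma> \<noteq> 0"
    proof
      assume "\<gamma> = 0"
      then have "t i = top" using \<gamma> a_pos[OF i] by (simp add: t_def ennreal_mult_top)
      then show False using tf[OF i] by simp
    qed
    then have \<gamma>p: "0 < \<gamma>" using \<gamma>(2) by simp
    have g\<gamma>: "\<gamma> \<le> g i x" if "x \<in> A i" for x
    proof -
      have "ennreal \<gamma> \<le> ennreal (g i x)" unfolding \<gamma>(1)[symmetric] by (rule INF_lower[OF that])
      then show ?thesis using g_pos[OF i, of x] by (simp add: ennreal_le_iff)
    qed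
    have "t i = ennreal (a i / \<gamma>)"
      using \<gamma>p a_pos[OF i] by (simp add: t_def \<gamma>(1) inverse_ennreal ennreal_mult[symmetric] divide_inverse)
    then have ti: "enn2real (t i) = a i / \<gamma>" using \<gamma>p a_pos[OF i] by simp
    have "\<mu> i \<phi> \<le> (c / \<gamma>) * a i"
    proof (rule Adm_integral_le[OF \<mu> i \<phi>])
      show "0 \<le> c / \<gamma>" using c(1) \<gamma>p by simp
      fix x assume x: "x \<in> A i"
      have "c / \<gamma> * \<gamma> \<le> c / \<gamma> * g i x" using g\<gamma>[OF x] c(1) \<gamma>p by (intro mult_left_mono) auto
      then show "\<phi> x \<le> c / \<gamma> * g i x" using c(2)[OF x] \<gamma>p by simp
    qed
    then show ?thesis using ti by simp
  qed
  show thesis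
  proof (rule that[of "enn2real ?S"])
    fix \<mu> Q \<phi> c assume \<mu>: "\<mu> \<in> Adm" and Q: "Q \<subseteq> J" and \<phi>: "\<phi> \<in> Cc" and c: "0 \<le> c"
      and le: "\<And>i x. i \<in> Q \<Longrightarrow> x \<in> A i \<Longrightarrow> \<phi> x \<le> c"
    let ?F = "Q \<inter> meets (func_support \<phi>)"
    have F: "finite ?F" "?F \<subseteq> J" using finite_meets[OF CcD(2)[OF \<phi>]] Q by auto
    have "part Q \<mu> \<phi> = (\<Sum>i\<in>?F. \<mu> i \<phi>)" using \<phi> by (simp add: part_def)
    also have "\<dots> \<le> (\<Sum>i\<in>?F. c * enn2real (t i))"
      by (rule sum_mono, rule plate[OF \<mu> _ \<phi> c]) (use F le in auto)
    also have "\<dots> = c * enn2real (sum t ?F)"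
      using tf F(2) by (subst enn2real_sum) (auto simp: sum_distrib_left)
    also have "\<dots> \<le> c * enn2real ?S"
      using sum_le[OF F] S c by (intro mult_left_mono enn2real_mono) auto
    finally show "part Q \<mu> \<phi> \<le> c * enn2real ?S" .
  qed simp
qed

text \<open>The kernel is at most \<open>C\<close> between plates of opposite sign, and each charge
  has mass at most \<open>S\<close>. Without negative plates one factor is the zero
  functional.\<close>

lemma cross_energy_bound:
  obtains C where "\<And>\<mu>. \<mu> \<in> Adm \<Longrightarrow> pos_integral (tensor (part P \<mu>) (part N \<mu>)) \<kappa> \<le> ereal C"
    "\<And>\<mu>. \<mu> \<in> Adm \<Longrightarrow> pos_integral (tensor (part N \<mu>) (part P \<mu>)) \<kappa> \<le> ereal C"
proof (cases "N = {}")
  case True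
  have "pos_integral (tensor (part P \<mu>) (part N \<mu>)) \<kappa> \<le> ereal 0 \<and>
    pos_integral (tensor (part N \<mu>) (part P \<mu>)) \<kappa> \<le> ereal 0" if \<mu>: "\<mu> \<in> Adm" for \<mu>
  proof -
    have z: "part N \<mu> = (\<lambda>\<phi>\<in>Cc. 0)" unfolding part_def by (rule restrict_ext) (simp add: True)
    have p: "posfun (part P \<mu>)" using posfun_part[OF Adm_D(1)[OF \<mu>], of P] by simp
    have "tensor (part P \<mu>) (part N \<mu>) = (\<lambda>f\<in>Cc. 0)"
      unfolding z tensor_def by (rule restrict_ext) (simp add: Cc_section posfun_zero[OF p])
    moreover have "tensor (part N \<mu>) (part P \<mu>) = (\<lambda>f\<in>Cc. 0)"
      unfolding z tensor_def by (rule restrict_ext) (simp add: Cc_partial_integral[OF lc _ p])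
    ultimately show ?thesis using pos_integral_zero[OF Phi] by simp
  qed
  then show thesis by (intro that[of 0]) auto
next
  case False
  then obtain S where S: "0 \<le> S"
    "\<And>\<mu> Q \<phi> c. \<mu> \<in> Adm \<Longrightarrow> Q \<subseteq> J \<Longrightarrow> \<phi> \<in> Cc \<Longrightarrow> 0 \<le> c \<Longrightarrow> (\<And>i x. i \<in> Q \<Longrightarrow> x \<in> A i \<Longrightarrow> \<phi> x \<le> c) \<Longrightarrow>
      part Q \<mu> \<phi> \<le> c * S"
    using total_mass_bound negative_plates by blast
  let ?s = "SUP z\<in>(\<Union>i\<in>P. A i) \<times> (\<Union>j\<in>N. A j). \<kappa> z"
  obtain C where C: "0 \<le> C" "?s \<le> ereal C"
  proof (cases ?s)
    case (real r)
    \<comment> \<open>The supremum may be negative on a compact space, while the mass estimate takes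
      a nonnegative level.\<close>
    then show thesis by (intro that[of "max r 0"]) auto
  next
    case PInf
    then show thesis using negative_plates False by simp
  next
    case MInf
    then show thesis by (intro that[of 0]) auto
  qed
  have \<kappa>C: "\<kappa> (x, y) \<le> ereal C" if "i \<in> P" "j \<in> N" "x \<in> A i" "y \<in> A j" for x y i j
    by (rule order_trans[OF SUP_upper C(2)]) (use that in auto)
  have sym: "\<kappa> (y, x) = \<kappa> (x, y)" for x y using pd by (simp add: positive_definite_def)
  have bound: "pos_integral (tensor (part Q \<mu>) (part Q' \<mu>)) \<kappa> \<le> ereal (C * S * S)"
    if \<mu>: "\<mu> \<in> Adm" and Q: "Q \<subseteq> J" "Q' \<subseteq> J"
      and le: "\<And>i j x y. i \<in> Q \<Longrightarrow> j \<in> Q' \<Longrightarrow> x \<in> A i \<Longrightarrow> y \<in> A j \<Longrightarrow> \<kappa> (x, y) \<le> ereal C" for \<mu> Q Q'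
  proof (rule pos_integral_least)
    fix f :: "'a \<times> 'a \<Rightarrow> real" assume f: "f \<in> Cc" "\<And>z. ereal (f z) \<le> \<kappa> z"
    have pQ: "posfun (part Q' \<mu>)" by (rule posfun_part[OF Adm_D(1)[OF \<mu>] Q(2)])
    have "part Q \<mu> (\<lambda>x. part Q' \<mu> (\<lambda>y. f (x, y))) \<le> C * S * S"
    proof (rule S(2)[OF \<mu> Q(1) Cc_partial_integral[OF lc f(1) pQ]])
      show "0 \<le> C * S" using C(1) S(1) by simp
      fix i x assume i: "i \<in> Q" "x \<in> A i"
      show "part Q' \<mu> (\<lambda>y. f (x, y)) \<le> C * S"
      proof (rule S(2)[OF \<mu> Q(2) Cc_section[OF f(1)] C(1)])
        fix j y assume "j \<in> Q'" "y \<in> A j"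
        then have "ereal (f (x, y)) \<le> ereal C" using order_trans[OF f(2) le[OF i(1) _ i(2)]] by blast
        then show "f (x, y) \<le> C" by simp
      qed
    qed
    then show "ereal (tensor (part Q \<mu>) (part Q' \<mu>) f) \<le> ereal (C * S * S)"
      using f(1) by (simp add: tensor_apply)
  qed
  show thesis
  proof (rule that[of "C * S * S"])
    show "pos_integral (tensor (part P \<mu>) (part N \<mu>)) \<kappa> \<le> ereal (C * S * S)" if "\<mu> \<in> Adm" for \<mu>
      by (rule bound[OF that]) (use \<kappa>C in auto)
    show "pos_integral (tensor (part N \<mu>) (part P \<mu>)) \<kappa> \<le> ereal (C * S * S)" if "\<mu> \<in> Adm" for \<mu>
    proof (rule bound[OF that])
      fix i j x y assume "i \<in> N" "j \<in> P" "x \<in> A i" "y \<in> A j"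
      then show "\<kappa> (x, y) \<le> ereal C" using \<kappa>C[of j i y x] sym[of x y] by simp
    qed auto
  qed
qed

text \<open>The energy of the difference is finite and the mixed terms are finite, so
  \<open>finite_signed_integral\<close> makes the sum of the two energies finite.\<close>

lemma Adm_Eplus:
  assumes "\<mu> \<in> Adm"
  shows "part P \<mu> \<in> Eplus" "part N \<mu> \<in> Eplus"
proof -
  note \<mu> = Adm_D[OF assms]
  have p: "posfun (part P \<mu>)" "posfun (part N \<mu>)" by (rule posfun_part[OF \<mu>(1)]; simp)+
  note t = tensor_pos[OF p(1) p(1)] tensor_pos[OF p(2) p(2)] tensor_pos[OF p] tensor_pos[OF p(2) p(1)]
  have fe: "integral_defined (tensor (cond_R P N \<mu>) (cond_R P N \<mu>)) \<kappa>"
    "\<bar>signed_integral (tensor (cond_R P N \<mu>) (cond_R P N \<mu>)) \<kappa>\<bar> \<noteq> \<infinity>"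
    using \<mu>(2) by (auto simp: finite_energy_def energy_defined_def energy_def)
  obtain C where "pos_integral (tensor (part P \<mu>) (part N \<mu>)) \<kappa> \<le> ereal C"
    "pos_integral (tensor (part N \<mu>) (part P \<mu>)) \<kappa> \<le> ereal C"
    using cross_energy_bound assms by metis
  then have c: "pos_integral (radon_add (tensor (part P \<mu>) (part N \<mu>)) (tensor (part N \<mu>) (part P \<mu>))) \<kappa> \<noteq> \<infinity>"
    using pos_integral_add[OF t(3,4) Phi] by auto
  have "pos_integral (radon_add (tensor (part P \<mu>) (part P \<mu>)) (tensor (part N \<mu>) (part N \<mu>))) \<kappa> \<noteq> \<infinity>"
    by (rule finite_signed_integral(2)[OF posfun_ops(1)[OF t(1,2)] posfun_ops(1)[OF t(3,4)] Phi _ _ c])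
       (use fe in \<open>simp_all add: cond_R_eq[OF \<mu>(1)] tensor_radon_diff[OF p]\<close>)
  then show "part P \<mu> \<in> Eplus" "part N \<mu> \<in> Eplus"
    using pos_integral_add[OF t(1,2) Phi] p pos_integral_not_MInf[OF Phi] by (auto simp: Eplus_iff)
qed

end

context condenser_problem
begin

section \<open>Midpoints of admissible families and their energies\<close>

definition cond_mid ::
  "(nat \<Rightarrow> 'a functional) \<Rightarrow> (nat \<Rightarrow> 'a functional) \<Rightarrow> (nat \<Rightarrow> 'a functional)" where
  "cond_mid \<mu> \<nu> = (\<lambda>i\<in>J. radon_mid (\<mu> i) (\<nu> i))"

definition cond_energy :: "(nat \<Rightarrow> 'a functional) \<Rightarrow> real" where
  "cond_energy \<mu> = dist2 (part P \<mu>) (part N \<mu>)"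

text \<open>Almost-minimizers of this in a convex class have both charges close to each other,
  whereas \<open>cond_energy\<close> controls only the difference of the charges.\<close>

definition split_energy :: "(nat \<Rightarrow> 'a functional) \<Rightarrow> real" where
  "split_energy \<mu> = mut (part P \<mu>) (part P \<mu>) + mut (part N \<mu>) (part N \<mu>)"

lemma cond_norm_eq:
  assumes "\<mu> \<in> M" "part P \<mu> \<in> Eplus" "part N \<mu> \<in> Eplus"
  shows "(cond_norm \<kappa> P N \<mu>)\<^sup>2 = cond_energy \<mu>" "cond_R P N \<mu> \<in> finite_energy \<kappa>" "0 \<le> cond_energy \<mu>"
  using energy_radon_diff[OF assms(2,3)] strong_norm_radon_diff[OF assms(2,3)]
  by (simp_all add: cond_norm_def cond_energy_def cond_R_eq[OF assms(1)])

lemma cond_mid_M: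
  assumes "\<mu> \<in> M" "\<nu> \<in> M"
  shows "cond_mid \<mu> \<nu> \<in> M"
proof -
  have "radon_mid (\<mu> i) (\<nu> i) \<in> radon_pos (A i)" if i: "i \<in> J" for i
    using M_D[OF assms(1) i] M_D[OF assms(2) i] meas_support_mid[OF lc M_D(1)[OF assms(1) i] M_D(1)[OF assms(2) i]]
    unfolding radon_pos_UNIV[OF lc] by auto
  then show ?thesis by (simp add: cond_mid_def cond_meas_def)
qed

lemma part_mid:
  assumes "\<mu> \<in> M" "\<nu> \<in> M" "Q \<subseteq> J"
  shows "part Q (cond_mid \<mu> \<nu>) = radon_mid (part Q \<mu>) (part Q \<nu>)"
proof (rule linfun_eqI)
  fix \<phi> :: "'a \<Rightarrow> real" assume \<phi>: "\<phi> \<in> Cc"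
  have "(\<Sum>i\<in>Q \<inter> meets (func_support \<phi>). cond_mid \<mu> \<nu> i \<phi>) = (\<Sum>i\<in>Q \<inter> meets (func_support \<phi>). (\<mu> i \<phi> + \<nu> i \<phi>) / 2)"
    by (rule sum.cong[OF refl]) (use \<phi> assms(3) in \<open>auto simp: cond_mid_def\<close>)
  then show "part Q (cond_mid \<mu> \<nu>) \<phi> = radon_mid (part Q \<mu>) (part Q \<nu>) \<phi>"
    using \<phi> by (simp add: part_def sum.distrib sum_divide_distrib[symmetric])
qed (use posfun_part[OF cond_mid_M[OF assms(1,2)] assms(3)] posfun_mid[OF posfun_part[OF assms(1,3)] posfun_part[OF assms(2,3)]] in auto)

text \<open>The constraints are affine and the energy is convex, so sublevel sets contain midpoints;
  the last identity supplies uniform convexity in both charges.\<close>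

lemma cond_mid_Adm:
  assumes "\<mu> \<in> Adm" "\<nu> \<in> Adm"
  shows "cond_mid \<mu> \<nu> \<in> Adm"
    "cond_energy (cond_mid \<mu> \<nu>) \<le> (cond_energy \<mu> + cond_energy \<nu>) / 2"
    "split_energy (cond_mid \<mu> \<nu>) = (split_energy \<mu> + split_energy \<nu>) / 2 -
      (dist2 (part P \<mu>) (part P \<nu>) + dist2 (part N \<mu>) (part N \<nu>)) / 4"
proof -
  note m = Adm_D(1)[OF assms(1)] Adm_D(1)[OF assms(2)]
  note E = Adm_Eplus[OF assms(1)] Adm_Eplus[OF assms(2)]
  have pm: "part P (cond_mid \<mu> \<nu>) = radon_mid (part P \<mu>) (part P \<nu>)"
    "part N (cond_mid \<mu> \<nu>) = radon_mid (part N \<mu>) (part N \<nu>)"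
    by (rule part_mid[OF m]; simp)+
  have E': "part P (cond_mid \<mu> \<nu>) \<in> Eplus" "part N (cond_mid \<mu> \<nu>) \<in> Eplus"
    unfolding pm using E by (auto intro: Eplus_mid)
  have "pos_integral (cond_mid \<mu> \<nu> i) (\<lambda>x. ereal (g i x)) = ereal (a i)" if i: "i \<in> J" for i
  proof -
    have \<Phi>: "(\<lambda>x. ereal (g i x)) \<in> Phi"
      using g_pos[OF i] g_cont[OF i]
      by (auto simp: Phi_def less_imp_le intro!: open_Collect_less continuous_on_ereal)
    have "pos_integral (radon_add (\<mu> i) (\<nu> i)) (\<lambda>x. ereal (g i x)) = ereal (2 * a i)"
      using pos_integral_add[OF M_D(1)[OF m(1) i] M_D(1)[OF m(2) i] \<Phi>] Adm_D(3)[OF assms(1) i] Adm_D(3)[OF assms(2) i] by simp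
    then show ?thesis
      using i pos_integral_scale[OF _ \<Phi>, of "1/2" "radon_add (\<mu> i) (\<nu> i)"] by (simp add: cond_mid_def radon_mid_def)
  qed
  then show "cond_mid \<mu> \<nu> \<in> Adm"
    using cond_mid_M[OF m] cond_norm_eq(2)[OF cond_mid_M[OF m] E'] by (simp add: admissible_def cond_finite_energy_def)
  show "cond_energy (cond_mid \<mu> \<nu>) \<le> (cond_energy \<mu> + cond_energy \<nu>) / 2"
    unfolding cond_energy_def pm by (rule dist2_mid[OF E(1,3,2,4)])
  show "split_energy (cond_mid \<mu> \<nu>) = (split_energy \<mu> + split_energy \<nu>) / 2 -
      (dist2 (part P \<mu>) (part P \<nu>) + dist2 (part N \<mu>) (part N \<nu>)) / 4"
    unfolding split_energy_def pm mut_mid[OF E(1,3)] mut_mid[OF E(2,4)] by argo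
qed

text \<open>The two energies differ by the mixed terms, which are uniformly bounded above.\<close>

lemma split_energy_bound:
  obtains C where "\<And>\<mu>. \<mu> \<in> Adm \<Longrightarrow> split_energy \<mu> \<le> cond_energy \<mu> + C"
proof -
  obtain C where C: "\<And>\<mu>. \<mu> \<in> Adm \<Longrightarrow> pos_integral (tensor (part P \<mu>) (part N \<mu>)) \<kappa> \<le> ereal C"
    "\<And>\<mu>. \<mu> \<in> Adm \<Longrightarrow> pos_integral (tensor (part N \<mu>) (part P \<mu>)) \<kappa> \<le> ereal C"
    using cross_energy_bound by blast
  have "split_energy \<mu> \<le> cond_energy \<mu> + 2 * C" if \<mu>: "\<mu> \<in> Adm" for \<mu>
  proof -
    have "mut (part P \<mu>) (part N \<mu>) \<le> C" "mut (part N \<mu>) (part P \<mu>) \<le> C"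
      using C(1,2)[OF \<mu>] mut_eq[OF Adm_Eplus[OF \<mu>]] mut_eq[OF Adm_Eplus(2)[OF \<mu>] Adm_Eplus(1)[OF \<mu>]] by simp_all
    then show ?thesis by (simp add: split_energy_def cond_energy_def dist2_def)
  qed
  then show thesis by (rule that)
qed

lemma split_energy_nonneg: "\<mu> \<in> Adm \<Longrightarrow> 0 \<le> split_energy \<mu>"
  unfolding split_energy_def by (intro add_nonneg_nonneg mut_nonneg Adm_Eplus)

section \<open>Vague closures\<close>

lemma topspace_cond_vague: "topspace (cond_vague P N A) = M"
proof -
  have "radon_pos (A i) \<subseteq> topspace vague" for i
    unfolding vague_def topspace_subtopology using radon_topspace by (auto simp: radon_pos_def)
  then show ?thesis
    by (auto simp: cond_vague_def cond_meas_def inf.absorb2)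
qed

lemma continuous_map_evaluate:
  assumes "i \<in> J" "\<phi> \<in> Cc"
  shows "continuous_map (cond_vague P N A) euclideanreal (\<lambda>\<mu>. \<mu> i \<phi>)"
proof -
  have 1: "continuous_map (cond_vague P N A) (subtopology vague (radon_pos (A i))) (\<lambda>\<mu>. \<mu> i)"
    unfolding cond_vague_def by (rule continuous_map_product_projection[OF assms(1)])
  have 2: "continuous_map (subtopology vague (radon_pos (A i))) euclideanreal (\<lambda>\<nu>. \<nu> \<phi>)"
    unfolding vague_def
    using continuous_map_product_projection[OF assms(2), of "\<lambda>_. euclideanreal"]
    by (intro continuous_map_from_subtopology) simp
  show ?thesis using continuous_map_compose[OF 1 2] by (simp add: comp_def)
qed

lemma closure_of_cond_vague_le:
  assumes "\<rho> \<in> cond_vague P N A closure_of W" "i \<in> J" "\<phi> \<in> Cc" "\<And>\<mu>. \<mu> \<in> W \<Longrightarrow> \<mu> i \<phi> \<in> C" "closed C"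
  shows "\<rho> i \<phi> \<in> C"
proof -
  let ?X = "cond_vague P N A"
  have "closedin ?X {\<nu> \<in> topspace ?X. \<nu> i \<phi> \<in> C}"
    by (rule closedin_continuous_map_preimage[OF continuous_map_evaluate[OF assms(2,3)]]) (use assms(5) in simp)
  moreover have "topspace ?X \<inter> W \<subseteq> {\<nu> \<in> topspace ?X. \<nu> i \<phi> \<in> C}" using assms(4) by auto
  ultimately have "?X closure_of (topspace ?X \<inter> W) \<subseteq> {\<nu> \<in> topspace ?X. \<nu> i \<phi> \<in> C}"
    by (intro closure_of_minimal)
  moreover have "\<rho> \<in> ?X closure_of (topspace ?X \<inter> W)"
    using assms(1) closure_of_restrict[of ?X W] by simp
  ultimately show ?thesis by auto
qed

text \<open>Basic vague neighbourhoods of \<open>\<rho>\<close>. They are convex, so intersecting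
  them with sublevel sets keeps midpoints.\<close>

definition vague_box ::
  "(nat \<Rightarrow> 'a functional) \<Rightarrow> (nat \<times> ('a \<Rightarrow> real)) set \<Rightarrow> real \<Rightarrow> (nat \<Rightarrow> 'a functional) set" where
  "vague_box \<rho> S d = {\<mu> \<in> M. \<forall>(i, \<phi>)\<in>S. \<bar>\<mu> i \<phi> - \<rho> i \<phi>\<bar> < d}"

lemma openin_vague_box:
  assumes "finite S" "S \<subseteq> J \<times> Cc"
  shows "openin (cond_vague P N A) (vague_box \<rho> S d)"
proof -
  let ?X = "cond_vague P N A"
  have op: "openin ?X {\<mu> \<in> topspace ?X. \<bar>\<mu> (fst s) (snd s) - \<rho> (fst s) (snd s)\<bar> < d}" if "s \<in> S" for s
  proof -
    have "continuous_map ?X euclideanreal (\<lambda>\<mu>. \<bar>\<mu> (fst s) (snd s) - \<rho> (fst s) (snd s)\<bar>)"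
      using assms(2) that by (intro continuous_map_real_abs continuous_map_diff continuous_map_evaluate) auto
    from openin_continuous_map_preimage[OF this, of "{..<d}"] show ?thesis by simp
  qed
  have "vague_box \<rho> S d = topspace ?X \<inter> (\<Inter>s\<in>S. {\<mu> \<in> topspace ?X. \<bar>\<mu> (fst s) (snd s) - \<rho> (fst s) (snd s)\<bar> < d})"
    unfolding topspace_cond_vague by (auto simp: vague_box_def case_prod_unfold)
  moreover have "openin ?X (topspace ?X \<inter> (\<Inter>s\<in>S. {\<mu> \<in> topspace ?X. \<bar>\<mu> (fst s) (snd s) - \<rho> (fst s) (snd s)\<bar> < d}))"
    using assms(1) op
    by (cases "S = {}") (auto intro!: openin_Int openin_INT)
  ultimately show ?thesis by simp
qed

lemma vague_box_mid:
  assumes "\<mu> \<in> vague_box \<rho> S d" "\<nu> \<in> vague_box \<rho> S d" "S \<subseteq> J \<times> Cc"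
  shows "cond_mid \<mu> \<nu> \<in> vague_box \<rho> S d"
proof -
  have "\<bar>cond_mid \<mu> \<nu> i \<phi> - \<rho> i \<phi>\<bar> < d" if s: "(i, \<phi>) \<in> S" for i \<phi>
  proof -
    have "cond_mid \<mu> \<nu> i \<phi> = (\<mu> i \<phi> + \<nu> i \<phi>) / 2" using s assms(3) by (auto simp: cond_mid_def)
    moreover have "\<bar>\<mu> i \<phi> - \<rho> i \<phi>\<bar> < d" "\<bar>\<nu> i \<phi> - \<rho> i \<phi>\<bar> < d" using s assms(1,2) by (auto simp: vague_box_def)
    ultimately show ?thesis unfolding abs_diff_less_iff by argo
  qed
  then show ?thesis using assms(1,2) cond_mid_M by (auto simp: vague_box_def)
qed

section \<open>Existence and compactness of minimizers\<close>

context
  fixes m :: real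
  assumes min_energy: "min_energy \<kappa> P N A a g = ereal m"
begin

definition level :: "real \<Rightarrow> (nat \<Rightarrow> 'a functional) set" where
  "level e = {\<mu> \<in> Adm. cond_energy \<mu> \<le> m + e}"

lemma min_energy_eq: "ereal m = (INF \<mu>\<in>Adm. ereal (cond_energy \<mu>))"
proof -
  have "min_energy \<kappa> P N A a g = (INF \<mu>\<in>Adm. ereal (cond_energy \<mu>))"
    unfolding min_energy_def
    by (rule INF_cong[OF refl]) (use cond_norm_eq(1)[OF Adm_D(1) Adm_Eplus] in simp)
  then show ?thesis using min_energy by simp
qed

lemma level_nonempty: "0 < e \<Longrightarrow> level e \<noteq> {}"
proof -
  assume e: "0 < e"
  have "(INF \<mu>\<in>Adm. ereal (cond_energy \<mu>)) < ereal (m + e)"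
    using e unfolding min_energy_eq[symmetric] by simp
  then show ?thesis by (auto simp: INF_less_iff level_def less_imp_le)
qed

lemma level_mono: "d \<le> e \<Longrightarrow> level d \<subseteq> level e"
  by (auto simp: level_def)

lemma minimizers_eq: "minimizers \<kappa> P N A a g = {\<mu> \<in> Adm. cond_energy \<mu> \<le> m}"
proof -
  have "ereal ((cond_norm \<kappa> P N \<mu>)\<^sup>2) = min_energy \<kappa> P N A a g \<longleftrightarrow> cond_energy \<mu> \<le> m" if \<mu>: "\<mu> \<in> Adm" for \<mu>
  proof -
    have "ereal m \<le> ereal (cond_energy \<mu>)"
      unfolding min_energy_eq by (rule INF_lower[OF \<mu>])
    then show ?thesis
      using min_energy cond_norm_eq(1)[OF Adm_D(1)[OF \<mu>] Adm_Eplus[OF \<mu>]] by auto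
  qed
  then show ?thesis unfolding minimizers_def by auto
qed

lemma closure_level_M: "\<rho> \<in> cond_vague P N A closure_of level e \<Longrightarrow> \<rho> \<in> M"
  using subsetD[OF closure_of_subset_topspace[of "cond_vague P N A" "level e"]]
  by (simp add: topspace_cond_vague)

text \<open>The upper bound is semicontinuity of the integral. The lower bound could fail through
  escape of mass; it is secured by a cutoff that captures the integral up to \<open>d\<close> for
  all of \<open>level 1\<close> at once.\<close>

lemma closure_level_integral:
  assumes \<rho>: "\<rho> \<in> cond_vague P N A closure_of level 1" and i: "i \<in> J"
  shows "pos_integral (\<rho> i) (\<lambda>x. ereal (g i x)) = ereal (a i)"
proof (rule antisym)
  show "pos_integral (\<rho> i) (\<lambda>x. ereal (g i x)) \<le> ereal (a i)"
  proof (rule pos_integral_least)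
    fix \<phi> :: "'a \<Rightarrow> real" assume \<phi>: "\<phi> \<in> Cc" "\<And>x. ereal (\<phi> x) \<le> ereal (g i x)"
    have "\<rho> i \<phi> \<in> {..a i}"
    proof (rule closure_of_cond_vague_le[OF \<rho> i \<phi>(1)])
      fix \<mu> assume "\<mu> \<in> level 1"
      then have "\<mu> \<in> Adm" by (simp add: level_def)
      then have "\<mu> i \<phi> \<le> 1 * a i" by (rule Adm_integral_le[OF _ i \<phi>(1)]) (use \<phi>(2) in auto)
      then show "\<mu> i \<phi> \<in> {..a i}" by simp
    qed simp
    then show "ereal (\<rho> i \<phi>) \<le> ereal (a i)" by simp
  qed
  have lower: "ereal (a i - d) \<le> pos_integral (\<rho> i) (\<lambda>x. ereal (g i x))"
    if \<eta>: "\<eta> \<in> Cc" "\<And>x. 0 \<le> \<eta> x" "\<And>x. \<eta> x \<le> 1"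
      and le: "\<And>\<mu>. \<mu> \<in> level 1 \<Longrightarrow> pos_integral (\<mu> i) (\<lambda>x. ereal (g i x)) \<le> ereal (\<mu> i (\<lambda>x. g i x * \<eta> x) + d)"
    for \<eta> d
  proof -
    have c: "(\<lambda>x. g i x * \<eta> x) \<in> Cc" by (rule Cc_mult(1)[OF \<eta>(1) g_cont[OF i]])
    have "\<rho> i (\<lambda>x. g i x * \<eta> x) \<in> {a i - d..}"
    proof (rule closure_of_cond_vague_le[OF \<rho> i c])
      fix \<mu> assume \<mu>: "\<mu> \<in> level 1"
      then have "\<mu> \<in> Adm" by (simp add: level_def)
      then show "\<mu> i (\<lambda>x. g i x * \<eta> x) \<in> {a i - d..}" using le[OF \<mu>] Adm_D(3)[of \<mu> i] i by simp
    qed simp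
    then have "ereal (a i - d) \<le> ereal (\<rho> i (\<lambda>x. g i x * \<eta> x))" by simp
    also have "\<dots> \<le> pos_integral (\<rho> i) (\<lambda>x. ereal (g i x))"
      by (rule pos_integral_upper[OF c]) (use \<eta>(3) g_pos[OF i] in \<open>simp add: mult_left_le less_imp_le\<close>)
    finally show ?thesis .
  qed
  show "ereal (a i) \<le> pos_integral (\<rho> i) (\<lambda>x. ereal (g i x))"
  proof (cases "compact (A i)")
    case True
    obtain \<eta> where \<eta>: "\<eta> \<in> Cc" "\<And>x. 0 \<le> \<eta> x" "\<And>x. \<eta> x \<le> 1" "\<And>x. x \<in> A i \<Longrightarrow> \<eta> x = 1"
      using bump_function[OF lc True open_UNIV] by (metis subset_UNIV)
    \<comment> \<open>On a compact plate one cutoff loses nothing, so \<open>lower\<close> applies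
      with d = 0.\<close>
    have le: "pos_integral (\<mu> i) (\<lambda>x. ereal (g i x)) \<le> ereal (\<mu> i (\<lambda>x. g i x * \<eta> x) + 0)" if "\<mu> \<in> level 1" for \<mu>
    proof (rule pos_integral_least)
      fix \<phi> :: "'a \<Rightarrow> real" assume \<phi>: "\<phi> \<in> Cc" "\<And>x. ereal (\<phi> x) \<le> ereal (g i x)"
      have \<mu>: "\<mu> \<in> M" using that Adm_D(1) by (simp add: level_def)
      have "\<mu> i \<phi> \<le> \<mu> i (\<lambda>x. g i x * \<eta> x)"
      proof (rule posfun_mono_on_support[OF lc M_D[OF \<mu> i] \<phi>(1) Cc_mult(1)[OF \<eta>(1) g_cont[OF i]]])
        show "\<phi> x \<le> g i x * \<eta> x" if "x \<in> A i" for x using \<phi>(2)[of x] \<eta>(4)[OF that] by simp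
      qed
      then show "ereal (\<mu> i \<phi>) \<le> ereal (\<mu> i (\<lambda>x. g i x * \<eta> x) + 0)" by simp
    qed
    have "ereal (a i - 0) \<le> pos_integral (\<rho> i) (\<lambda>x. ereal (g i x))"
      by (rule lower[OF \<eta>(1-3)], rule le)
    then show ?thesis by simp
  next
    case False
    then have fin: "inner_capacity \<kappa> (A i) < \<infinity>" using compact_or_capacity[OF i] by blast
    \<comment> \<open>In a compact space the closed plate would be compact; hence \<open>Phi\<close>
      makes the kernel nonnegative.\<close>
    have "\<not> compact (UNIV :: ('a \<times> 'a) set)"
    proof
      assume "compact (UNIV :: ('a \<times> 'a) set)"
      then have "compact (fst ` (UNIV :: ('a \<times> 'a) set))" by (intro compact_continuous_image continuous_intros)
      then have "compact (UNIV :: 'a set)" by simp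
      then show False using False compact_Int_closed[OF _ closed_plate[OF i], of UNIV] by simp
    qed
    then have \<kappa>: "0 \<le> \<kappa> z" for z using Phi by (cases z) (simp add: Phi_def)
    obtain C where C: "\<And>\<mu>. \<mu> \<in> Adm \<Longrightarrow> split_energy \<mu> \<le> cond_energy \<mu> + C"
      using split_energy_bound by blast
    define B where "B = max 0 (m + 1 + C)"
    \<comment> \<open>The energy of one plate is dominated by that of its charge, hence bounded by
      the split energy.\<close>
    have plate: "\<mu> i \<in> Eplus \<and> mut (\<mu> i) (\<mu> i) \<le> B" if "\<mu> \<in> level 1" for \<mu>
    proof -
      have \<mu>: "\<mu> \<in> Adm" "cond_energy \<mu> \<le> m + 1" using that by (auto simp: level_def)
      note E = Adm_Eplus[OF \<mu>(1)]
      have *: "\<mu> i \<in> Eplus \<and> mut (\<mu> i) (\<mu> i) \<le> mut (part Q \<mu>) (part Q \<mu>)"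
        if Q: "Q \<subseteq> J" "i \<in> Q" "part Q \<mu> \<in> Eplus" for Q
        using Eplus_dominated[OF M_D(1)[OF Adm_D(1)[OF \<mu>(1)] i] Q(3) \<kappa> plate_le_part[OF Adm_D(1)[OF \<mu>(1)] Q(1,2)]]
        by blast
      have "split_energy \<mu> \<le> B" using C[OF \<mu>(1)] \<mu>(2) by (simp add: B_def)
      then have "mut (part P \<mu>) (part P \<mu>) \<le> B" "mut (part N \<mu>) (part N \<mu>) \<le> B"
        using mut_nonneg[OF E(1)] mut_nonneg[OF E(2)] by (auto simp: split_energy_def)
      then show ?thesis using *[of P] *[of N] E i by force
    qed
    have B: "0 \<le> B" by (simp add: B_def)
    show ?thesis
    proof (rule ereal_le_epsilon2)
      fix d :: real assume d: "0 < d"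
      obtain \<eta> where \<eta>: "\<eta> \<in> Cc" "\<And>x. 0 \<le> \<eta> x" "\<And>x. \<eta> x \<le> 1"
        "\<And>\<sigma>. \<sigma> \<in> Eplus \<Longrightarrow> meas_support \<sigma> \<subseteq> A i \<Longrightarrow> mut \<sigma> \<sigma> \<le> B \<Longrightarrow>
          pos_integral \<sigma> (\<lambda>x. ereal (g i x)) \<le> ereal (\<sigma> (\<lambda>x. g i x * \<eta> x) + d)"
        using tightness[OF \<kappa> closed_plate[OF i] g_cont[OF i] g_pos[OF i] tails[OF i] fin B d] by blast
      have "ereal (a i - d) \<le> pos_integral (\<rho> i) (\<lambda>x. ereal (g i x))"
      proof (rule lower[OF \<eta>(1-3)])
        fix \<mu> assume \<mu>: "\<mu> \<in> level 1"
        then have "\<mu> \<in> M" using Adm_D(1) by (simp add: level_def)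
        then show "pos_integral (\<mu> i) (\<lambda>x. ereal (g i x)) \<le> ereal (\<mu> i (\<lambda>x. g i x * \<eta> x) + d)"
          using \<eta>(4) plate[OF \<mu>] M_D(2)[OF _ i] by blast
      qed
      then show "ereal (a i) \<le> pos_integral (\<rho> i) (\<lambda>x. ereal (g i x)) + ereal d"
        by (cases "pos_integral (\<rho> i) (\<lambda>x. ereal (g i x))") auto
    qed
  qed
qed

lemma closure_level_minimizer:
  assumes \<rho>: "\<And>e. 0 < e \<Longrightarrow> \<rho> \<in> cond_vague P N A closure_of level e"
  shows "\<rho> \<in> minimizers \<kappa> P N A a g"
proof -
  have \<rho>M: "\<rho> \<in> M" using closure_level_M[OF \<rho>[of 1]] by simp
  obtain C where C: "\<And>\<mu>. \<mu> \<in> Adm \<Longrightarrow> split_energy \<mu> \<le> cond_energy \<mu> + C"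
    using split_energy_bound by blast
  \<comment> \<open>Energy level and neighbourhood shrink together, so one filter both minimizes the
    energy and converges vaguely to \<open>\<rho>\<close>.\<close>
  define I where "I = {0::real<..} \<times> {S. finite S \<and> S \<subseteq> J \<times> (Cc :: ('a \<Rightarrow> real) set)} \<times> {0::real<..}"
  define V where "V = (\<lambda>(e, S, d). level e \<inter> vague_box \<rho> S d)"
  have Vne: "V (e, S, d) \<noteq> {}" if "(e, S, d) \<in> I" for e S d
  proof -
    have "openin (cond_vague P N A) (vague_box \<rho> S d)" using that by (intro openin_vague_box) (auto simp: I_def)
    moreover have "\<rho> \<in> vague_box \<rho> S d" using that \<rho>M by (auto simp: vague_box_def I_def)
    moreover have "\<rho> \<in> cond_vague P N A closure_of level e" using that \<rho> by (simp add: I_def)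
    ultimately show ?thesis unfolding in_closure_of V_def by blast
  qed
  have V_mono: "V (e, S, d) \<subseteq> V (e', S', d')" if "e \<le> e'" "S' \<subseteq> S" "d \<le> d'" for e e' S S' d d'
    using level_mono[OF that(1)] that(2,3) unfolding V_def vague_box_def by fastforce
  have V_cases: thesis if "W \<in> V ` I" "\<And>e S d. (e, S, d) \<in> I \<Longrightarrow> W = V (e, S, d) \<Longrightarrow> thesis" for W thesis
    using that by (auto simp del: split_paired_All)
  have V_Adm: "\<mu> \<in> Adm" if "\<mu> \<in> V s" for \<mu> s using that by (auto simp: V_def level_def split: prod.splits)
  let ?D = "\<lambda>\<mu> \<nu>. dist2 (part P \<mu>) (part P \<nu>) + dist2 (part N \<mu>) (part N \<nu>)"
  have "\<exists>F. F \<noteq> bot \<and> (\<forall>W\<in>V ` I. eventually (\<lambda>x. x \<in> W) F) \<and>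
    (\<forall>e>0. \<exists>Z. eventually (\<lambda>x. x \<in> Z) F \<and> (\<forall>x\<in>Z. \<forall>y\<in>Z. ?D x y < e))"
  proof (rule cauchy_filter_of_convex_sets[where f = split_energy and C = "m + 1 + C"])
    show "V ` I \<noteq> {}" by (auto simp: I_def intro!: exI[of _ 1] exI[of _ "{}"])
  next
    fix V1 V2 assume "V1 \<in> V ` I" "V2 \<in> V ` I"
    then obtain e1 S1 d1 e2 S2 d2 where 1: "(e1, S1, d1) \<in> I" "V1 = V (e1, S1, d1)"
      and 2: "(e2, S2, d2) \<in> I" "V2 = V (e2, S2, d2)" by (elim V_cases)
    let ?s = "(min e1 e2, S1 \<union> S2, min d1 d2)"
    have "?s \<in> I" using 1(1) 2(1) by (auto simp: I_def)
    moreover have "V ?s \<subseteq> V1 \<inter> V2" unfolding 1(2) 2(2) by (intro Int_greatest V_mono) auto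
    ultimately show "\<exists>U\<in>V ` I. U \<subseteq> V1 \<inter> V2" by blast
  next
    fix W assume "W \<in> V ` I"
    then obtain e S d where s: "(e, S, d) \<in> I" "W = V (e, S, d)" by (elim V_cases)
    \<comment> \<open>Passing to a level of excess at most 1 yields one bound for all sets of the
      family, however large \<open>e\<close> is.\<close>
    have "(min e 1, S, d) \<in> I" using s(1) by (simp add: I_def)
    from Vne[OF this] obtain \<mu> where \<mu>: "\<mu> \<in> V (min e 1, S, d)" by blast
    have "cond_energy \<mu> \<le> m + 1" using \<mu> by (auto simp: V_def level_def)
    then have "split_energy \<mu> \<le> m + 1 + C" using C[OF V_Adm[OF \<mu>]] by simp
    moreover have "\<mu> \<in> W" using V_mono[of "min e 1" e S S d d] \<mu> s(2) by auto
    ultimately show "\<exists>\<mu>\<in>W. split_energy \<mu> \<le> m + 1 + C" by blast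
  next
    fix W \<mu> assume "W \<in> V ` I" "\<mu> \<in> W"
    then show "0 \<le> split_energy \<mu>" using V_Adm split_energy_nonneg by blast
  next
    fix W \<mu> \<nu> assume W: "W \<in> V ` I" and in_W: "\<mu> \<in> W" "\<nu> \<in> W"
    then obtain e S d where s: "(e, S, d) \<in> I" "W = V (e, S, d)" by (elim V_cases)
    have A: "\<mu> \<in> Adm" "\<nu> \<in> Adm" using V_Adm in_W s(2) by auto
    have "S \<subseteq> J \<times> Cc" using s(1) by (simp add: I_def)
    then have "cond_mid \<mu> \<nu> \<in> vague_box \<rho> S d"
      using in_W s(2) by (intro vague_box_mid) (auto simp: V_def)
    moreover have "cond_mid \<mu> \<nu> \<in> level e"
      using cond_mid_Adm(1,2)[OF A] in_W s(2) by (auto simp: V_def level_def)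
    ultimately have "cond_mid \<mu> \<nu> \<in> W" using s(2) by (simp add: V_def)
    then show "\<exists>z\<in>W. split_energy z \<le> (split_energy \<mu> + split_energy \<nu>) / 2 - ?D \<mu> \<nu> / 4"
      using cond_mid_Adm(3)[OF A] by (intro bexI[of _ "cond_mid \<mu> \<nu>"]) simp_all
  qed
  then obtain F where F: "F \<noteq> bot" "\<And>s. s \<in> I \<Longrightarrow> eventually (\<lambda>x. x \<in> V s) F"
      "\<And>e. 0 < e \<Longrightarrow> \<exists>Z. eventually (\<lambda>x. x \<in> Z) F \<and> (\<forall>x\<in>Z. \<forall>y\<in>Z. ?D x y < e)"
    by auto
  have FA: "\<forall>\<^sub>F \<mu> in F. \<mu> \<in> Adm"
    using F(2)[of "(1, {}, 1)"] by (auto simp: I_def elim!: eventually_mono intro: V_Adm)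
  have point: "((\<lambda>\<mu>. \<mu> i \<phi>) \<longlongrightarrow> \<rho> i \<phi>) F" if "i \<in> J" "\<phi> \<in> Cc" for i \<phi>
  proof (rule tendstoI)
    fix e :: real assume "0 < e"
    then have "(1, {(i, \<phi>)}, e) \<in> I" using that by (simp add: I_def)
    from F(2)[OF this] show "\<forall>\<^sub>F \<mu> in F. dist (\<mu> i \<phi>) (\<rho> i \<phi>) < e"
      by eventually_elim (simp add: V_def vague_box_def dist_real_def)
  qed
  \<comment> \<open>The index set depends on \<phi> but not on \<mu>, so this is the limit of a
    fixed finite sum.\<close>
  have part_lim: "((\<lambda>\<mu>. part Q \<mu> \<phi>) \<longlongrightarrow> part Q \<rho> \<phi>) F" if "Q \<subseteq> J" "\<phi> \<in> Cc" for Q \<phi>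
    using that point by (auto simp: part_def intro!: tendsto_sum)
  have strong: "part Q \<rho> \<in> Eplus \<and> ((\<lambda>\<mu>. dist2 (part Q \<mu>) (part Q \<rho>)) \<longlongrightarrow> 0) F"
    if Q: "Q = P \<or> Q = N" for Q
  proof -
    have QJ: "Q \<subseteq> J" using Q by auto
    have E: "\<forall>\<^sub>F \<mu> in F. part Q \<mu> \<in> Eplus"
      using FA by eventually_elim (use Q Adm_Eplus in blast)
    have cau: "\<exists>Z. eventually (\<lambda>x. x \<in> Z) F \<and> (\<forall>x\<in>Z. \<forall>y\<in>Z. dist2 (part Q x) (part Q y) < e)" if e: "0 < e" for e
    proof -
      obtain Z where Z: "eventually (\<lambda>x. x \<in> Z) F" "\<forall>x\<in>Z. \<forall>y\<in>Z. ?D x y < e" using F(3)[OF e] by blast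
      have "dist2 (part Q x) (part Q y) < e" if xy: "x \<in> Z \<inter> Adm" "y \<in> Z \<inter> Adm" for x y
      proof -
        have x: "x \<in> Adm" "y \<in> Adm" using xy by auto
        \<comment> \<open>Both summands of \<open>?D\<close> are nonnegative, so each one is small
          by itself.\<close>
        have "0 \<le> dist2 (part P x) (part P y)" "0 \<le> dist2 (part N x) (part N y)"
          using energy_radon_diff(3) Adm_Eplus[OF x(1)] Adm_Eplus[OF x(2)] by blast+
        moreover have "?D x y < e" using Z(2) xy by blast
        ultimately show ?thesis using Q by auto
      qed
      moreover have "eventually (\<lambda>x. x \<in> Z \<inter> Adm) F" using Z(1) FA by eventually_elim simp
      ultimately show ?thesis by blast
    qed
    note sc = strong_convergence[where T = "part Q", OF F(1) E cau posfun_part[OF \<rho>M QJ] part_lim[OF QJ]]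
    show ?thesis using sc by blast
  qed
  note sP = conjunct1[OF strong[OF disjI1[OF refl]]] conjunct2[OF strong[OF disjI1[OF refl]]]
  note sN = conjunct1[OF strong[OF disjI2[OF refl]]] conjunct2[OF strong[OF disjI2[OF refl]]]
  have "cond_energy \<rho> \<le> m + e * (m + 1)" if e: "0 < e" for e
  proof -
    \<comment> \<open>Chosen so that \<open>(1 + e) * ?d\<close> equals \<open>e\<close>; the bound
      becomes (1 + e) m + e = m + e (m + 1).\<close>
    let ?d = "e / (1 + e)"
    let ?r = "\<lambda>\<mu>. (1 + e) * (m + ?d) +
      (1 + 1 / e) * (2 * dist2 (part P \<mu>) (part P \<rho>) + 2 * dist2 (part N \<mu>) (part N \<rho>))"
    have s: "(?d, {}, 1) \<in> I" using e by (simp add: I_def)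
    have "\<forall>\<^sub>F \<mu> in F. cond_energy \<rho> \<le> ?r \<mu>"
      using F(2)[OF s] FA
    proof eventually_elim
      case (elim \<mu>)
      note E = Adm_Eplus[OF elim(2)]
      have "cond_energy \<mu> \<le> m + ?d" using elim(1) by (simp add: V_def level_def)
      then have 1: "(1 + e) * cond_energy \<mu> \<le> (1 + e) * (m + ?d)" using e by (intro mult_left_mono) auto
      have "dist2 (part Q \<rho>) (part Q \<mu>) = dist2 (part Q \<mu>) (part Q \<rho>)" for Q by (simp add: dist2_def)
      then show ?case
        using dist2_approx[OF sP(1) E(1) sN(1) E(2) e] 1 by (simp add: cond_energy_def)
    qed
    moreover have "(?r \<longlongrightarrow> (1 + e) * (m + ?d) + (1 + 1 / e) * (2 * 0 + 2 * 0)) F"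
      by (intro tendsto_intros sP(2) sN(2))
    ultimately have "cond_energy \<rho> \<le> (1 + e) * (m + ?d) + (1 + 1 / e) * (2 * 0 + 2 * 0)"
      using tendsto_lowerbound F(1) by blast
    moreover have "(1 + e) * (m + ?d) = (1 + e) * m + e" using e by (simp add: distrib_left)
    ultimately show ?thesis by (simp add: algebra_simps)
  qed
  moreover have "0 \<le> m + 1"
  proof -
    have "0 \<le> ereal m" unfolding min_energy_eq
      by (rule INF_greatest) (use cond_norm_eq(3)[OF Adm_D(1) Adm_Eplus] in simp)
    then show ?thesis by simp
  qed
  ultimately have "cond_energy \<rho> \<le> m" by (rule le_of_le_add_epsilon)
  moreover have "\<rho> \<in> Adm"
    using \<rho>M cond_norm_eq(2)[OF \<rho>M sP(1) sN(1)] closure_level_integral[OF \<rho>[of 1]]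
    by (simp add: admissible_def cond_finite_energy_def)
  ultimately show ?thesis unfolding minimizers_eq by simp
qed

lemma minimizers_nonempty_compact:
  "minimizers \<kappa> P N A a g \<noteq> {} \<and> compactin (cond_vague P N A) (minimizers \<kappa> P N A a g)"
proof -
  let ?X = "cond_vague P N A" and ?S = "minimizers \<kappa> P N A a g"
  obtain c where c: "\<And>\<mu> i \<phi>. \<mu> \<in> Adm \<Longrightarrow> i \<in> J \<Longrightarrow> \<phi> \<in> Cc \<Longrightarrow> \<bar>\<mu> i \<phi>\<bar> \<le> c i \<phi>"
    using Adm_bounded by blast
  define K where "K = (\<Pi>\<^sub>E i\<in>J. {\<nu> \<in> radon_pos (A i). \<forall>\<phi>\<in>Cc. \<bar>\<nu> \<phi>\<bar> \<le> c i \<phi>})"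
  have K: "compactin ?X K"
    unfolding cond_vague_def K_def compactin_PiE compactin_subtopology
    using compactin_vague_bounded[OF lc closed_plate] by auto
  have AK: "Adm \<subseteq> K"
  proof
    fix \<mu> assume \<mu>: "\<mu> \<in> Adm"
    then have "\<mu> \<in> (\<Pi>\<^sub>E i\<in>J. radon_pos (A i))" using Adm_D(1) by (simp add: cond_meas_def)
    then show "\<mu> \<in> K" unfolding K_def using c[OF \<mu>] by (simp add: PiE_iff)
  qed
  have top: "level e \<subseteq> topspace ?X" for e
    unfolding topspace_cond_vague level_def using Adm_D(1) by blast
  let ?\<U> = "(\<lambda>e. ?X closure_of level e) ` {0<..}"
  have S: "?S = K \<inter> \<Inter>?\<U>"
  proof
    show "?S \<subseteq> K \<inter> \<Inter>?\<U>"
    proof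
      fix \<mu> assume "\<mu> \<in> ?S"
      then have \<mu>: "\<mu> \<in> Adm" "cond_energy \<mu> \<le> m" unfolding minimizers_eq by auto
      have "\<mu> \<in> ?X closure_of level e" if "0 < e" for e
        using closure_of_subset[OF top[of e]] \<mu> that by (auto simp: level_def)
      then show "\<mu> \<in> K \<inter> \<Inter>?\<U>" using AK \<mu>(1) by auto
    qed
    show "K \<inter> \<Inter>?\<U> \<subseteq> ?S"
      by (auto intro!: closure_level_minimizer)
  qed
  have "closedin ?X (\<Inter>?\<U>)" by (intro closedin_Inter) (auto intro: exI[of _ 1])
  then have "compactin ?X ?S" unfolding S by (rule compact_Int_closedin[OF K])
  moreover have "K \<inter> \<Inter>\<F> \<noteq> {}" if \<F>: "finite \<F>" "\<F> \<subseteq> ?\<U>" for \<F>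
  proof -
    obtain G where G: "finite G" "G \<subseteq> {0<..}" "\<F> = (\<lambda>e. ?X closure_of level e) ` G"
      using finite_subset_image[OF \<F>] by auto
    \<comment> \<open>The inserted 1 covers an empty \<open>G\<close>.\<close>
    let ?e = "Min (insert 1 G)"
    have "0 < ?e" using G(1,2) by auto
    from level_nonempty[OF this] obtain \<mu> where \<mu>: "\<mu> \<in> level ?e" by blast
    have "\<mu> \<in> ?X closure_of level e" if "e \<in> G" for e
      using closure_of_subset[OF top[of e]] level_mono[of ?e e] G(1) that \<mu> by auto
    moreover have "\<mu> \<in> K" using \<mu> AK by (auto simp: level_def)
    ultimately show ?thesis unfolding G(3) by blast
  qed
  then have "K \<inter> \<Inter>?\<U> \<noteq> {}"
    using K unfolding compactin_fip by (elim conjE allE[of _ ?\<U>]) auto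
  ultimately show ?thesis using S by simp
qed

end

end

theorem theorem5p1:
  fixes \<kappa> :: "'a::t2_space \<times> 'a \<Rightarrow> ereal"
    and P N :: "nat set"
    and A :: "nat \<Rightarrow> 'a set"
    and g :: "nat \<Rightarrow> 'a \<Rightarrow> real"
    and a :: "nat \<Rightarrow> real"
  assumes "locally_compact_space (euclidean :: 'a topology)"
    and "\<kappa> \<in> Phi"
    and "consistent \<kappa>"
    and "condenser P N A"
    and "\<And>i. i \<in> P \<union> N \<Longrightarrow> continuous_on UNIV (g i)"
    and "\<And>i x. i \<in> P \<union> N \<Longrightarrow> 0 < g i x"
    and "\<And>i. i \<in> P \<union> N \<Longrightarrow>
           (SUP x\<in>A i. ennreal (g i x)) < \<infinity> \<or>
           (\<exists>r>1. \<exists>\<omega>\<in>finite_energy \<kappa>.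
              nearly_everywhere \<kappa> (A i)
                (\<lambda>x. potential_defined \<kappa> x \<omega> \<and> ereal (g i x powr r) \<le> potential \<kappa> x \<omega>))"
    and "\<And>i. i \<in> P \<union> N \<Longrightarrow> compact (A i) \<or> inner_capacity \<kappa> (A i) < \<infinity>"
    and "\<And>i. i \<in> P \<union> N \<Longrightarrow> 0 < a i"
    and "0 < cond_cap \<kappa> P N A a g"
    and "N = {} \<or>
         (\<Sum>\<^sub>\<infinity>i\<in>P \<union> N. ennreal (a i) * inverse (INF x\<in>A i. ennreal (g i x))) < \<infinity> \<and>
         (SUP z\<in>(\<Union>i\<in>P. A i) \<times> (\<Union>j\<in>N. A j). \<kappa> z) < \<infinity>"
  shows "minimizers \<kappa> P N A a g \<noteq> {} \<and> compactin (cond_vague P N A) (minimizers \<kappa> P N A a g)"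
proof -
  interpret consistent_kernel \<kappa>
    by unfold_locales (use assms(1-3) in \<open>auto simp: consistent_def\<close>)
  have tails: "tail_controlled (A i) (g i)" if i: "i \<in> P \<union> N" for i
    using assms(7)[OF i]
  proof
    assume *: "(SUP x\<in>A i. ennreal (g i x)) < \<infinity>"
    then obtain G where G: "(SUP x\<in>A i. ennreal (g i x)) = ennreal G" "0 \<le> G"
      by (cases "SUP x\<in>A i. ennreal (g i x)") auto
    have "g i x \<le> G" if "x \<in> A i" for x
    proof -
      have "ennreal (g i x) \<le> ennreal G" unfolding G(1)[symmetric] by (rule SUP_upper[OF that])
      then show ?thesis using G(2) by (simp add: ennreal_le_iff)
    qed
    then show ?thesis by (auto simp: tail_controlled_def)
  qed (simp add: tail_controlled_def)
  interpret condenser_problem \<kappa> P N A a g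
    by unfold_locales (use assms(4-6,8,9,11) tails in auto)
  \<comment> \<open>Since 1/\<infinity> = 0, positive capacity excludes an infinite infimum; in
    particular admissible families exist.\<close>
  have "min_energy \<kappa> P N A a g \<noteq> \<infinity>"
    using assms(10) by (auto simp: cond_cap_def)
  moreover have "0 \<le> min_energy \<kappa> P N A a g"
    unfolding min_energy_def by (rule INF_greatest) simp
  ultimately obtain m where "min_energy \<kappa> P N A a g = ereal m"
    by (cases "min_energy \<kappa> P N A a g") auto
  then show ?thesis by (rule minimizers_nonempty_compact)
qed

end
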